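(* In dimension $d=3$ there are an $\epsilon>0$ and an absolute constant $K$ such that for every integer $n\ge 1$ and every choice of real coefficients $\{\alpha_R\}$ indexed by the dyadic rectangles $R\subset[0,1]^3$ with $|R|=2^{-n}$, $$2^{-n}\sum_{|R|=2^{-n}}|\alpha_R|\;\le\; K\,n^{1-\epsilon}\,\Bigl\|\sum_{|R|=2^{-n}}\alpha_R h_R\Bigr\|_\infty .$$ Both sums are over all dyadic rectangles $R\subset[0,1]^3$ of volume exactly $2^{-n}$.
   Context: Dyadic intervals are $[j2^k,(j+1)2^k)$, $j,k\in\mathbb Z$. For a dyadic interval $I$ with left half $I_{\rm left}$ and right half $I_{\rm right}$, the ($L^\infty$-normalized) Haar function is $h_I=-\mathbf 1_{I_{\rm left}}+\mathbf 1_{I_{\rm right}}$. A dyadic rectangle in dimension $d$ is a product $R=R_1\times\cdots\times R_d$ of dyadic intervals, $|R|$ is its volume, and $h_R(x_1,\dots,x_d)=\prod_{j=1}^d h_{R_j}(x_j)$. The norm is the $L^\infty$ norm on the unit cube. *)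

theory Defs
  imports "HOL-Analysis.Analysis" "HOL-Probability.Essential_Supremum"
begin

definition dyadic_interval :: "real set \<Rightarrow> bool" where
  "dyadic_interval I \<longleftrightarrow>
     (\<exists>j k :: int. I = {of_int j * 2 powi k ..< of_int (j + 1) * 2 powi k})"

definition left_half :: "real set \<Rightarrow> real set" where
  "left_half I = {Inf I ..< (Inf I + Sup I) / 2}"

definition right_half :: "real set \<Rightarrow> real set" where
  "right_half I = {(Inf I + Sup I) / 2 ..< Sup I}"

definition haar :: "real set \<Rightarrow> real \<Rightarrow> real" where
  "haar I x = - indicator (left_half I) x + indicator (right_half I) x"

definition dyadic_rectangle :: "(real ^ 'd) set \<Rightarrow> bool" where
  "dyadic_rectangle R \<longleftrightarrow>
     (\<exists>I. (\<forall>i. dyadic_interval (I i)) \<and> R = {x. \<forall>i. x $ i \<in> I i})"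

text \<open>
  A dyadic rectangle is a nonempty product, so its factors are recovered as its coordinate
  projections.
\<close>

definition rect_factor :: "(real ^ 'd) set \<Rightarrow> 'd \<Rightarrow> real set" where
  "rect_factor R i = (\<lambda>x. x $ i) ` R"

definition haar_rect :: "(real ^ 'd) set \<Rightarrow> real ^ 'd \<Rightarrow> real" where
  "haar_rect R x = (\<Prod>i\<in>UNIV. haar (rect_factor R i) (x $ i))"

text \<open>In \<^term>\<open>cbox 0 1\<close>, \<^term>\<open>1 :: real ^ 'd\<close> is the vector with all entries 1.\<close>

definition dyadic_rectangles :: "nat \<Rightarrow> (real ^ 'd) set set" where
  "dyadic_rectangles n =
     {R. dyadic_rectangle R \<and> R \<subseteq> cbox 0 1 \<and> measure lborel R = 2 powi (- int n)}"

definition Linf_norm :: "(real ^ 'd \<Rightarrow> real) \<Rightarrow> ereal" where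
  "Linf_norm f = esssup (restrict_space lborel (cbox 0 1)) (\<lambda>x. ereal \<bar>f x\<bar>)"

end

theory Submission
  imports Defs
begin

text \<open>
  Discretise the cube: a point is the set of its binary digits, so that everything is an average over
  finitely many bits. Writing \<open>H\<^sub>r\<close> for the part of the sum with side lengths
  \<open>2\<^sup>-\<^sup>r\<close> and \<open>f\<^sub>r\<close> for its signs, one tests \<open>\<Sum>r. H\<^sub>r\<close> against a short Riesz product
  \<open>\<Prod>t<q. 1 + \<rho> F\<^sub>t\<close>, where \<open>F\<^sub>t\<close> is the sum of the \<open>f\<^sub>r\<close> with \<open>r 1\<close> in the \<open>t\<close>-th of \<open>q\<close> blocks
  (\<open>q\<close> a tiny power of \<open>n\<close>) and \<open>\<rho>\<close> is a little larger than \<open>1/n\<close>. Products of several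
  \<open>f\<^sub>r\<close> whose maximal levels in every coordinate are attained only once are orthogonal to
  \<open>\<Sum>r. H\<^sub>r\<close>, so only the linear term and the tuples with coincidences survive. The latter have bounded
  \<open>L\<^sup>1\<close> norm thanks to Beck's gain: a sum over pairs with one common coordinate is smaller by a factor
  \<open>n\<^sup>-\<^sup>1\<^sup>/\<^sup>4\<close> than the trivial bound, outside a set of measure \<open>exp(-k)\<close> so small that on it crude
  bounds suffice. The same gain shows that the square function of \<open>F\<^sub>t\<close> is essentially constant, which
  keeps the Riesz product bounded in \<open>L\<^sup>1\<close>. All tail bounds come from a self-normalised Azuma inequality
  for functions that are odd in one bit and independent of the later ones.
\<close>

section \<open>Bits, levels and tails\<close>

text \<open>A test function of L1 norm at most 3 whose linear part is \<open>\<rho>\<close> times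
  the signs bounds \<open>\<rho>\<close> times the left-hand side by three times the norm, so all
  hinges on how far \<open>\<rho>\<close> can exceed \<open>1/n\<close>. The obstacle is
  coincidence. Disjoint blocks exclude it in coordinate 1, but in coordinates 2 and 3 "the maximum
  is attained once" is not a product condition, whereas L1 bounds are available for product sets of
  tuples, where the untouched blocks still form a Riesz product. Fixing the exact maximal level
  would restore products but cost a sum over \<open>n\<close> levels; so only a coarse block of
  about \<open>n/J\<close> levels is fixed, at the cost of \<open>J\<close> choices. Up to small
  powers, three entries in the top block contribute \<open>J^(-3/2)\<close>, which beats
  \<open>J\<close>. Two entries contribute \<open>J^(-1)\<close>, which does not: there equality of
  levels is used, and Beck's gain, a power of \<open>n\<close>, pays for everything. L1 norms of
  signed sums are not monotone in the set of tuples, so the cases are combined by inclusion and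
  exclusion.\<close>

lemma sinh_le_mult_cosh:
  fixes x :: real
  assumes "0 \<le> x"
  shows "sinh x \<le> x * cosh x"
proof -
  have "0 * cosh 0 - sinh 0 \<le> x * cosh x - sinh (x::real)"
  proof (rule DERIV_nonneg_imp_nondecreasing[OF assms])
    fix y :: real assume "0 \<le> y" "y \<le> x"
    have "((\<lambda>y. y * cosh y - sinh y) has_real_derivative y * sinh y) (at y)"
      by (auto intro!: derivative_eq_intros)
    moreover have "0 \<le> y * sinh y" using \<open>0 \<le> y\<close> by simp
    ultimately show "\<exists>d. ((\<lambda>y. y * cosh y - sinh y) has_real_derivative d) (at y) \<and> 0 \<le> d" by blast
  qed
  then show ?thesis by simp
qed

text \<open>The sub-Gaussian bound for a fair sign. The derivative of
  \<open>exp (- x\<^sup>2 / 2) * cosh x\<close> has the sign of \<open>sinh x - x * cosh x\<close>,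
  so for \<open>x \<ge> 0\<close> this product decreases from its value 1 at the origin; evenness
  covers the rest.\<close>

lemma cosh_le_exp_sq:
  fixes x :: real
  shows "cosh x \<le> exp (x\<^sup>2 / 2)"
proof -
  have *: "cosh x \<le> exp (x\<^sup>2 / 2)" if "0 \<le> x" for x :: real
  proof -
    have "exp (- (x\<^sup>2 / 2)) * cosh x \<le> exp (- (0\<^sup>2 / 2)) * cosh (0::real)"
    proof (rule DERIV_nonpos_imp_nonincreasing[OF that])
      fix y :: real assume "0 \<le> y" "y \<le> x"
      have "((\<lambda>y. exp (- (y\<^sup>2 / 2)) * cosh y) has_real_derivative
          exp (- (y\<^sup>2 / 2)) * (sinh y - y * cosh y)) (at y)"
        by (auto intro!: derivative_eq_intros simp: algebra_simps)
      moreover have "exp (- (y\<^sup>2 / 2)) * (sinh y - y * cosh y) \<le> 0"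
        using sinh_le_mult_cosh[OF \<open>0 \<le> y\<close>] by (intro mult_nonneg_nonpos) auto
      ultimately show "\<exists>d. ((\<lambda>y. exp (- (y\<^sup>2 / 2)) * cosh y) has_real_derivative d) (at y) \<and> d \<le> 0"
        by blast
    qed
    then show ?thesis by (simp add: exp_minus field_simps)
  qed
  show ?thesis using *[of x] *[of "-x"] by (cases "0 \<le> x") auto
qed

text \<open>\<open>(i, j)\<close> belongs to the set when digit \<open>j\<close> of coordinate
  \<open>i\<close> is 1, digit 0 being the leading one after the binary point. Changing a digit is
  then a symmetric difference, and functions live on all sets although averages run over finitely
  many.\<close>

type_synonym bits = "(3 \<times> nat) set"

definition flip :: "'a \<Rightarrow> 'a set \<Rightarrow> 'a set" where
  "flip c B = (if c \<in> B then B - {c} else insert c B)"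

lemma flip_flip [simp]: "flip c (flip c B) = B"
  by (auto simp: flip_def)

text \<open>\<open>below i m g\<close>: \<open>g\<close> depends only on the bits \<open>< m\<close> of coordinate \<open>i\<close>.
  \<open>lev i m g\<close>: in coordinate \<open>i\<close>, \<open>g\<close> is a combination of Haar functions of side \<open>2\<^sup>-\<^sup>m\<close>.\<close>

definition below :: "3 \<Rightarrow> nat \<Rightarrow> (bits \<Rightarrow> real) \<Rightarrow> bool" where
  "below i m g \<longleftrightarrow> (\<forall>j\<ge>m. \<forall>B. g (flip (i, j) B) = g B)"

definition lev :: "3 \<Rightarrow> nat \<Rightarrow> (bits \<Rightarrow> real) \<Rightarrow> bool" where
  "lev i m g \<longleftrightarrow> (\<forall>B. g (flip (i, m) B) = - g B) \<and> below i (Suc m) g"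

lemma below_mono: "below i m g \<Longrightarrow> m \<le> m' \<Longrightarrow> below i m' g"
  by (auto simp: below_def)

lemma below_const [simp]: "below i m (\<lambda>B. c)"
  by (auto simp: below_def)

lemma below_add: "below i m f \<Longrightarrow> below i m g \<Longrightarrow> below i m (\<lambda>B. f B + g B)"
  by (auto simp: below_def)

lemma below_mult: "below i m f \<Longrightarrow> below i m g \<Longrightarrow> below i m (\<lambda>B. f B * g B)"
  by (auto simp: below_def)

lemma below_power: "below i m f \<Longrightarrow> below i m (\<lambda>B. f B ^ p)"
  by (auto simp: below_def)

lemma below_sum: "(\<And>x. x \<in> A \<Longrightarrow> below i m (f x)) \<Longrightarrow> below i m (\<lambda>B. \<Sum>x\<in>A. f x B)"
  by (auto simp: below_def)

lemma below_prod: "(\<And>x. x \<in> A \<Longrightarrow> below i m (f x)) \<Longrightarrow> below i m (\<lambda>B. \<Prod>x\<in>A. f x B)"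
  by (auto simp: below_def)

lemma lev_below: "lev i m g \<Longrightarrow> m < m' \<Longrightarrow> below i m' g"
  by (auto simp: lev_def intro: below_mono)

lemma lev_zero [simp]: "lev i m (\<lambda>B. 0)"
  by (auto simp: lev_def)

lemma lev_mult: "lev i m f \<Longrightarrow> below i m g \<Longrightarrow> lev i m (\<lambda>B. f B * g B)"
  by (auto simp: lev_def below_def)

lemma lev_mult': "below i m g \<Longrightarrow> lev i m f \<Longrightarrow> lev i m (\<lambda>B. g B * f B)"
  by (auto simp: lev_def below_def)

lemma lev_cmult: "lev i m f \<Longrightarrow> lev i m (\<lambda>B. c * f B)"
  by (auto simp: lev_def below_def)

lemma lev_sum: "(\<And>x. x \<in> A \<Longrightarrow> lev i m (f x)) \<Longrightarrow> lev i m (\<lambda>B. \<Sum>x\<in>A. f x B)"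
  by (auto simp: lev_def below_def sum_negf)

lemma lev_mult_lev: "lev i m f \<Longrightarrow> lev i m g \<Longrightarrow> below i m (\<lambda>B. f B * g B)"
  unfolding below_def lev_def by (metis Suc_leI le_neq_implies_less minus_mult_minus)

section \<open>Averages over finitely many digits and a calculus of tail bounds\<close>

locale cube =
  fixes n :: nat
begin

text \<open>Levels run through \<open>0..n\<close>, and a Haar function of side
  \<open>2^(-m)\<close> takes its sign from digit \<open>m\<close>; hence \<open>n + 1\<close>
  digits per coordinate.\<close>

definition \<Omega> :: "bits set" where "\<Omega> = Pow (UNIV \<times> {..n})"

definition E :: "(bits \<Rightarrow> real) \<Rightarrow> real" where
  "E g = (\<Sum>B\<in>\<Omega>. g B) / card \<Omega>"

definition Pr :: "(bits \<Rightarrow> bool) \<Rightarrow> real" where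
  "Pr Q = E (\<lambda>B. of_bool (Q B))"

text \<open>A statement "with high probability" is recorded by two numbers: thresholds combine like
  deterministic bounds, failure probabilities add, and exceptional sets need no names.\<close>

definition tail :: "(bits \<Rightarrow> real) \<Rightarrow> real \<Rightarrow> real \<Rightarrow> bool" where
  "tail g a p \<longleftrightarrow> Pr (\<lambda>B. a < \<bar>g B\<bar>) \<le> p"

lemma finite_\<Omega> [simp]: "finite \<Omega>"
  by (simp add: \<Omega>_def)

lemma card_\<Omega>_pos [simp]: "0 < card \<Omega>"
  by (auto simp: \<Omega>_def card_gt_0_iff)

lemma E_add: "E (\<lambda>B. f B + g B) = E f + E g"
  by (simp add: E_def sum.distrib add_divide_distrib)

lemma E_diff: "E (\<lambda>B. f B - g B) = E f - E g"
  by (simp add: E_def sum_subtractf diff_divide_distrib)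

lemma E_cmult: "E (\<lambda>B. c * f B) = c * E f"
  by (simp add: E_def sum_distrib_left)

lemma E_const [simp]: "E (\<lambda>B. c) = c"
proof -
  have "real (card \<Omega>) \<noteq> 0" using card_\<Omega>_pos by linarith
  then show ?thesis by (simp add: E_def)
qed

lemma E_sum: "E (\<lambda>B. \<Sum>x\<in>A. f x B) = (\<Sum>x\<in>A. E (f x))"
  unfolding E_def by (subst sum.swap) (simp add: sum_divide_distrib)

lemma E_mono: "(\<And>B. f B \<le> g B) \<Longrightarrow> E f \<le> E g"
  unfolding E_def by (intro divide_right_mono sum_mono) auto

lemma E_nonneg: "(\<And>B. 0 \<le> f B) \<Longrightarrow> 0 \<le> E f"
  using E_mono[of "\<lambda>_. 0" f] by simp

lemma E_abs: "\<bar>E f\<bar> \<le> E (\<lambda>B. \<bar>f B\<bar>)"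
  unfolding E_def by (simp add: divide_right_mono sum_abs)

lemma E_flip:
  assumes "m \<le> n"
  shows "E (\<lambda>B. f (flip (i, m) B)) = E f"
proof -
  have "bij_betw (flip (i, m)) \<Omega> \<Omega>"
    using assms by (intro bij_betwI[where g = "flip (i, m)"]) (auto simp: \<Omega>_def flip_def split: if_splits)
  then show ?thesis
    unfolding E_def by (simp add: sum.reindex_bij_betw)
qed

lemma E_lev:
  assumes "m \<le> n" "lev i m f"
  shows "E f = 0"
proof -
  have "E f = E (\<lambda>B. - 1 * f B)"
    using E_flip[OF assms(1), of f i] assms(2) by (simp add: lev_def)
  then show ?thesis unfolding E_cmult by simp
qed

lemma E_cauchy_schwarz: "(E (\<lambda>B. f B * g B))\<^sup>2 \<le> E (\<lambda>B. (f B)\<^sup>2) * E (\<lambda>B. (g B)\<^sup>2)"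
proof -
  have "(E (\<lambda>B. f B * g B))\<^sup>2 = (\<Sum>B\<in>\<Omega>. f B * g B)\<^sup>2 / (real (card \<Omega>))\<^sup>2"
    by (simp add: E_def power_divide)
  also have "\<dots> \<le> ((\<Sum>B\<in>\<Omega>. (f B)\<^sup>2) * (\<Sum>B\<in>\<Omega>. (g B)\<^sup>2)) / (real (card \<Omega>))\<^sup>2"
    by (intro divide_right_mono Cauchy_Schwarz_ineq_sum) auto
  also have "\<dots> = E (\<lambda>B. (f B)\<^sup>2) * E (\<lambda>B. (g B)\<^sup>2)"
    by (simp add: E_def power2_eq_square)
  finally show ?thesis .
qed

lemma Pr_le_E: "(\<And>B. Q B \<Longrightarrow> 1 \<le> f B) \<Longrightarrow> (\<And>B. 0 \<le> f B) \<Longrightarrow> Pr Q \<le> E f"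
  unfolding Pr_def by (intro E_mono) auto

lemma Pr_mono: "(\<And>B. Q B \<Longrightarrow> R B) \<Longrightarrow> Pr Q \<le> Pr R"
  unfolding Pr_def by (intro E_mono) auto

lemma Pr_disj: "Pr (\<lambda>B. Q B \<or> R B) \<le> Pr Q + Pr R"
  unfolding Pr_def E_add[symmetric] by (intro E_mono) auto

lemma Pr_bex:
  assumes "finite A"
  shows "Pr (\<lambda>B. \<exists>x\<in>A. Q x B) \<le> (\<Sum>x\<in>A. Pr (Q x))"
  unfolding Pr_def E_sum[symmetric]
proof (intro E_mono)
  fix B
  show "of_bool (\<exists>x\<in>A. Q x B) \<le> (\<Sum>x\<in>A. of_bool (Q x B) :: real)"
  proof (cases "\<exists>x\<in>A. Q x B")
    case True
    then obtain x where "x \<in> A" "Q x B" by blast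
    then show ?thesis using member_le_sum[of x A "\<lambda>x. of_bool (Q x B) :: real"] assms True by simp
  qed (simp add: sum_nonneg)
qed

lemma Pr_False [simp]: "Pr (\<lambda>B. False) = 0"
  by (simp add: Pr_def)

lemma tail_sure: "(\<And>B. \<bar>g B\<bar> \<le> a) \<Longrightarrow> tail g a 0"
  unfolding tail_def by (simp add: not_less[symmetric])

lemma tail_mono: "tail g a p \<Longrightarrow> a \<le> a' \<Longrightarrow> p \<le> p' \<Longrightarrow> tail g a' p'"
  unfolding tail_def using Pr_mono[of "\<lambda>B. a' < \<bar>g B\<bar>" "\<lambda>B. a < \<bar>g B\<bar>"] by fastforce

lemma tail_dominated:
  assumes "tail g a p" "\<And>B. \<bar>g B\<bar> \<le> a \<Longrightarrow> \<bar>h B\<bar> \<le> b"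
  shows "tail h b p"
proof -
  have "Pr (\<lambda>B. b < \<bar>h B\<bar>) \<le> Pr (\<lambda>B. a < \<bar>g B\<bar>)"
    using assms(2) by (intro Pr_mono) (meson not_le)
  then show ?thesis using assms(1) by (simp add: tail_def)
qed

lemma tail_dominated2:
  assumes "tail g a p" "tail g' a' p'" "\<And>B. \<bar>g B\<bar> \<le> a \<Longrightarrow> \<bar>g' B\<bar> \<le> a' \<Longrightarrow> \<bar>h B\<bar> \<le> b"
  shows "tail h b (p + p')"
proof -
  have "Pr (\<lambda>B. b < \<bar>h B\<bar>) \<le> Pr (\<lambda>B. a < \<bar>g B\<bar> \<or> a' < \<bar>g' B\<bar>)"
    using assms(3) by (intro Pr_mono) (meson not_le)
  also have "\<dots> \<le> Pr (\<lambda>B. a < \<bar>g B\<bar>) + Pr (\<lambda>B. a' < \<bar>g' B\<bar>)" by (rule Pr_disj)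
  finally show ?thesis using assms(1,2) by (simp add: tail_def)
qed

text \<open>The union bound in the form in which it is applied: off the union of the exceptional
  sets all bounds hold at once, and what remains is a deterministic estimate at a single
  \<open>B\<close>.\<close>

lemma tail_dominated_family:
  fixes p :: real
  assumes "finite A" "\<And>x. x \<in> A \<Longrightarrow> tail (g x) (a x) p"
    "\<And>B. (\<And>x. x \<in> A \<Longrightarrow> \<bar>g x B\<bar> \<le> a x) \<Longrightarrow> \<bar>h B\<bar> \<le> b"
  shows "tail h b (card A * p)"
proof -
  have "Pr (\<lambda>B. b < \<bar>h B\<bar>) \<le> Pr (\<lambda>B. \<exists>x\<in>A. a x < \<bar>g x B\<bar>)"
    using assms(3) by (intro Pr_mono) (meson not_le)
  also have "\<dots> \<le> (\<Sum>x\<in>A. Pr (\<lambda>B. a x < \<bar>g x B\<bar>))" by (rule Pr_bex[OF assms(1)])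
  also have "\<dots> \<le> (\<Sum>x\<in>A. p)" using assms(2) by (intro sum_mono) (simp add: tail_def)
  finally show ?thesis by (simp add: tail_def)
qed

lemma tail_add: "tail f a p \<Longrightarrow> tail g b p' \<Longrightarrow> tail (\<lambda>B. f B + g B) (a + b) (p + p')"
  by (erule (1) tail_dominated2) linarith

lemma tail_mult:
  "tail f a p \<Longrightarrow> tail g b p' \<Longrightarrow> 0 \<le> a \<Longrightarrow> tail (\<lambda>B. f B * g B) (a * b) (p + p')"
  by (erule (1) tail_dominated2) (simp add: abs_mult mult_mono)

lemma tail_cmult: "tail f a p \<Longrightarrow> tail (\<lambda>B. c * f B) (\<bar>c\<bar> * a) p"
  by (erule tail_dominated) (simp add: abs_mult mult_left_mono)

lemma tail_sum:
  fixes a p :: real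
  assumes "finite A" "\<And>x. x \<in> A \<Longrightarrow> tail (g x) a p"
  shows "tail (\<lambda>B. \<Sum>x\<in>A. g x B) (card A * a) (card A * p)"
proof (rule tail_dominated_family[where a = "\<lambda>_. a", OF assms])
  fix B assume "\<And>x. x \<in> A \<Longrightarrow> \<bar>g x B\<bar> \<le> a"
  then have "(\<Sum>x\<in>A. \<bar>g x B\<bar>) \<le> (\<Sum>x\<in>A. a)" by (intro sum_mono)
  then show "\<bar>\<Sum>x\<in>A. g x B\<bar> \<le> card A * a"
    by (intro order_trans[OF sum_abs]) simp
qed auto

lemma tail_prod:
  fixes p :: real
  assumes "finite A" "\<And>x. x \<in> A \<Longrightarrow> tail (g x) (a x) p"
  shows "tail (\<lambda>B. \<Prod>x\<in>A. g x B) (\<Prod>x\<in>A. a x) (card A * p)"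
  using assms
proof (rule tail_dominated_family)
  fix B assume "\<And>x. x \<in> A \<Longrightarrow> \<bar>g x B\<bar> \<le> a x"
  then show "\<bar>\<Prod>x\<in>A. g x B\<bar> \<le> (\<Prod>x\<in>A. a x)"
    unfolding abs_prod by (intro prod_mono) auto
qed auto

text \<open>An exponential supermartingale in the digits of one coordinate, the other coordinates
  being frozen. Remove the largest level \<open>m\<close>: \<open>A\<close> does not see digit
  \<open>m\<close>, and the mean of \<open>D\<close> over the two values of that digit is
  \<open>cosh (c * d m B)\<close> divided by the exponential of half the square, at most 1.
  Subtracting the actual squares makes the inequality self-normalised, so no bound on
  \<open>d\<close> is assumed.\<close>

lemma E_exp_le_one:
  assumes "finite M" "\<And>m. m \<in> M \<Longrightarrow> m \<le> n \<and> lev i m (d m)"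
  shows "E (\<lambda>B. exp (c * (\<Sum>m\<in>M. d m B) - c\<^sup>2 * (\<Sum>m\<in>M. (d m B)\<^sup>2) / 2)) \<le> 1"
  using assms
proof (induction M rule: finite_linorder_max_induct)
  case empty
  then show ?case by simp
next
  case (insert m M)
  define A where "A B = exp (c * (\<Sum>m\<in>M. d m B) - c\<^sup>2 * (\<Sum>m\<in>M. (d m B)\<^sup>2) / 2)" for B
  define D where "D B = exp (c * d m B - c\<^sup>2 * (d m B)\<^sup>2 / 2)" for B
  have m: "m \<le> n" "lev i m (d m)" using insert.prems by auto
  have below_d: "below i m (d k)" if "k \<in> M" for k
    using insert.prems that insert.hyps by (auto intro: lev_below)
  have "below i m (\<lambda>B. (\<Sum>m\<in>M. d m B))" "below i m (\<lambda>B. (\<Sum>m\<in>M. (d m B)\<^sup>2))"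
    using below_d by (auto intro!: below_sum below_power)
  then have A_flip: "A (flip (i, m) B) = A B" for B by (auto simp: A_def below_def)
  have D_flip: "(D B + D (flip (i, m) B)) / 2 \<le> 1" for B
  proof -
    have "(D B + D (flip (i, m) B)) / 2 = cosh (c * d m B) / exp ((c * d m B)\<^sup>2 / 2)"
      using m(2) by (simp add: D_def lev_def cosh_def exp_diff power_mult_distrib add_divide_distrib)
    also have "\<dots> \<le> 1" using cosh_le_exp_sq[of "c * d m B"] by simp
    finally show ?thesis .
  qed
  have "E (\<lambda>B. exp (c * (\<Sum>m\<in>insert m M. d m B) - c\<^sup>2 * (\<Sum>m\<in>insert m M. (d m B)\<^sup>2) / 2))
      = E (\<lambda>B. A B * D B)"
    using insert.hyps by (auto simp: A_def D_def exp_add[symmetric] algebra_simps add_divide_distrib intro!: arg_cong[where f=E])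
  also have "\<dots> = (E (\<lambda>B. A B * D B) + E (\<lambda>B. A (flip (i, m) B) * D (flip (i, m) B))) / 2"
    using E_flip[OF m(1), of "\<lambda>B. A B * D B"] by simp
  also have "\<dots> = E (\<lambda>B. A B * ((D B + D (flip (i, m) B)) / 2))"
    using E_cmult[of "1/2" "\<lambda>B. A B * D B + A B * D (flip (i, m) B)"]
    by (simp add: E_add[symmetric] A_flip distrib_left add_divide_distrib)
  also have "\<dots> \<le> E A"
  proof (intro E_mono)
    fix B show "A B * ((D B + D (flip (i, m) B)) / 2) \<le> A B"
      using D_flip[of B] by (intro mult_left_le) (auto simp: A_def)
  qed
  also have "\<dots> \<le> 1" using insert by (auto simp: A_def[abs_def])
  finally show ?case .
qed

lemma tail_azuma:
  assumes "finite M" "\<And>m. m \<in> M \<Longrightarrow> m \<le> n \<and> lev i m (d m)"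
    and V: "tail (\<lambda>B. \<Sum>m\<in>M. (d m B)\<^sup>2) y p" and "0 < y" "0 < k"
  shows "tail (\<lambda>B. \<Sum>m\<in>M. d m B) (sqrt (k * y)) (p + 2 * exp (- k / 2))"
proof -
  define S where "S B = (\<Sum>m\<in>M. d m B)" for B
  define V where "V B = (\<Sum>m\<in>M. (d m B)\<^sup>2)" for B
  define x where "x = sqrt (k * y)"
  have x: "0 < x" "x\<^sup>2 = k * y" using assms by (auto simp: x_def)
  have *: "Pr (\<lambda>B. x < s * S B \<and> V B \<le> y) \<le> exp (- k / 2)" if s: "s\<^sup>2 = 1" for s
  proof -
    \<comment> \<open>The value \<open>x / y\<close> maximises
      \<open>c * x - c\<^sup>2 * y / 2\<close>; the maximum \<open>x\<^sup>2 / (2 * y)\<close>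
      equals \<open>k / 2\<close>.\<close>
    define c where "c = x / y * s"
    have cs: "c * S B = (x / y) * (s * S B)" for B by (simp add: c_def)
    have c2: "c\<^sup>2 = k / y" using s x \<open>0 < y\<close> by (simp add: c_def power_mult_distrib power_divide) (simp add: power2_eq_square)
    have "Pr (\<lambda>B. x < s * S B \<and> V B \<le> y) \<le> E (\<lambda>B. exp (- k / 2) * exp (c * S B - c\<^sup>2 * V B / 2))"
    proof (rule Pr_le_E)
      fix B assume B: "x < s * S B \<and> V B \<le> y"
      have "x * x / y \<le> (x / y) * (s * S B)" using B x \<open>0 < y\<close> by (simp add: divide_right_mono)
      moreover have "x * x / y = k" using x \<open>0 < y\<close> by (simp add: power2_eq_square)
      moreover have "c\<^sup>2 * V B \<le> k"
        using B mult_left_mono[of "V B" y "k/y"] \<open>0 < y\<close> \<open>0 < k\<close> by (simp add: c2)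
      ultimately have "0 \<le> - k / 2 + (c * S B - c\<^sup>2 * V B / 2)" unfolding cs by linarith
      then show "1 \<le> exp (- k / 2) * exp (c * S B - c\<^sup>2 * V B / 2)"
        by (simp add: exp_add[symmetric])
    qed auto
    also have "\<dots> \<le> exp (- k / 2)"
      unfolding E_cmult using E_exp_le_one[OF assms(1,2), where c = c] unfolding S_def V_def
      by (intro mult_left_le) auto
    finally show ?thesis .
  qed
  have "Pr (\<lambda>B. x < \<bar>S B\<bar>) \<le> Pr (\<lambda>B. y < \<bar>V B\<bar> \<or> ((x < 1 * S B \<and> V B \<le> y) \<or> (x < (-1) * S B \<and> V B \<le> y)))"
    by (intro Pr_mono) auto
  also have "\<dots> \<le> Pr (\<lambda>B. y < \<bar>V B\<bar>) + (Pr (\<lambda>B. x < 1 * S B \<and> V B \<le> y) + Pr (\<lambda>B. x < (-1) * S B \<and> V B \<le> y))"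
    by (intro order_trans[OF Pr_disj] add_left_mono Pr_disj)
  also have "\<dots> \<le> p + 2 * exp (- k / 2)"
    using V *[of 1] *[of "-1"] by (auto simp: tail_def V_def)
  finally show ?thesis by (simp add: tail_def S_def x_def)
qed

end

section \<open>Arrays of Haar combinations and Beck's gain\<close>

context cube
begin

abbreviation N :: real where "N \<equiv> real n + 1"

text \<open>\<open>\<phi> m a\<close> plays the role of \<open>f r\<close> for the exponent vector with \<open>r i = m\<close>, \<open>r j = a\<close>; the
  remaining exponent \<open>r l\<close> is then \<open>n - m - a\<close>.\<close>

definition array :: "3 \<Rightarrow> 3 \<Rightarrow> 3 \<Rightarrow> (nat \<Rightarrow> nat \<Rightarrow> bits \<Rightarrow> real) \<Rightarrow> bool" where
  "array i j l \<phi> \<longleftrightarrow> (\<forall>m a. (\<forall>B. \<bar>\<phi> m a B\<bar> \<le> 1) \<and> lev i m (\<phi> m a) \<and> lev j a (\<phi> m a) \<and>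
     lev l (n - m - a) (\<phi> m a) \<and> (n < m + a \<longrightarrow> \<phi> m a = (\<lambda>B. 0)))"

lemma array_restrict: "array i j l \<phi> \<Longrightarrow> array i j l (\<lambda>m a. if P m a then \<phi> m a else (\<lambda>B. 0))"
  by (auto simp: array_def)

lemma array_le1: "array i j l \<phi> \<Longrightarrow> \<bar>\<phi> m a B\<bar> \<le> 1"
  and array_lev1: "array i j l \<phi> \<Longrightarrow> lev i m (\<phi> m a)"
  and array_lev2: "array i j l \<phi> \<Longrightarrow> lev j a (\<phi> m a)"
  and array_lev3: "array i j l \<phi> \<Longrightarrow> lev l (n - m - a) (\<phi> m a)"
  and array_0: "array i j l \<phi> \<Longrightarrow> n < m + a \<Longrightarrow> \<phi> m a = (\<lambda>B. 0)"
  by (auto simp: array_def)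

lemma array_sq_le1: "array i j l \<phi> \<Longrightarrow> (\<phi> m a B)\<^sup>2 \<le> 1"
  using array_le1[of i j l \<phi> m a B] by (simp add: abs_square_le_1)

lemma abs_of_bool_le_0: "\<bar>of_bool Q :: real\<bar> \<le> 0 \<longleftrightarrow> \<not> Q"
  by simp

text \<open>Packs the failure of any member of a family into one indicator with threshold 0, so that
  two families of different kinds can be fed to \<open>tail_dominated2\<close>.\<close>

lemma tail_all:
  fixes p :: real
  assumes "finite A" "\<And>x. x \<in> A \<Longrightarrow> tail (g x) (a x) p"
  shows "tail (\<lambda>B. of_bool (\<exists>x\<in>A. a x < \<bar>g x B\<bar>)) 0 (card A * p)"
  using assms by (rule tail_dominated_family) (auto simp: not_less[symmetric])

end

text \<open>Each use of the Azuma inequality loses \<open>sqrt k\<close> in the threshold and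
  \<open>p0\<close> in probability. Later \<open>k\<close> is a small power of \<open>n\<close>,
  large enough for \<open>p0\<close> to absorb every crude sup norm.\<close>

locale cube_tail = cube +
  fixes k :: real
  assumes k: "1 \<le> k"
begin

definition p0 :: real where "p0 = 2 * exp (- k / 2)"

lemma p0_pos: "0 < p0" by (simp add: p0_def)

lemma sqrt_k_mult_le: "0 \<le> x \<Longrightarrow> sqrt (k * x) \<le> k * sqrt x"
proof -
  have "1 * k \<le> k * k" using k by (intro mult_right_mono) auto
  then have "sqrt k \<le> k" using k by (intro real_le_lsqrt) (auto simp: power2_eq_square)
  then show "0 \<le> x \<Longrightarrow> sqrt (k * x) \<le> k * sqrt x" by (simp add: real_sqrt_mult mult_right_mono)
qed

lemma azuma:
  assumes "\<And>m. m \<in> M \<Longrightarrow> m \<le> n \<and> lev i m (d m)"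
    and "tail (\<lambda>B. \<Sum>m\<in>M. (d m B)\<^sup>2) y p" and "0 < y"
  shows "tail (\<lambda>B. \<Sum>m\<in>M. d m B) (sqrt (k * y)) (p + p0)"
proof -
  have "finite M" using assms(1) by (meson atMost_iff finite_atMost finite_subset subsetI)
  then show ?thesis unfolding p0_def using assms k by (intro tail_azuma) auto
qed

text \<open>Within a row the levels \<open>a\<close> of coordinate \<open>j\<close> are distinct, so
  Azuma applies there with at most one unit of variance per entry.\<close>

lemma row_tail:
  assumes "array i j l \<phi>" "Q \<subseteq> {..n}" "real (card Q) \<le> b" "0 < b"
  shows "tail (\<lambda>B. \<Sum>a\<in>Q. \<phi> m a B) (sqrt (k * b)) p0"
proof -
  have "tail (\<lambda>B. \<Sum>a\<in>Q. (\<phi> m a B)\<^sup>2) b 0"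
  proof (rule tail_sure)
    fix B
    have "(\<Sum>a\<in>Q. (\<phi> m a B)\<^sup>2) \<le> (\<Sum>a\<in>Q. 1)" using array_sq_le1[OF assms(1)] by (intro sum_mono) auto
    then show "\<bar>\<Sum>a\<in>Q. (\<phi> m a B)\<^sup>2\<bar> \<le> b" using assms(3) by (simp add: sum_nonneg)
  qed
  then have "tail (\<lambda>B. \<Sum>a\<in>Q. \<phi> m a B) (sqrt (k * b)) (0 + p0)"
    using assms array_lev2[OF assms(1)] by (intro azuma[where i = j]) auto
  then show ?thesis by simp
qed

text \<open>Azuma twice: in coordinate \<open>j\<close> inside each row, then in coordinate
  \<open>i\<close> across the rows with the squared row sums as variance. This gives square-root
  cancellation in both directions and one full factor \<open>k\<close>.\<close>

lemma block_tail:
  assumes "array i j l \<phi>" "P \<subseteq> {..n}" "real (card P) \<le> a" "0 < a" "Q \<subseteq> {..n}" "real (card Q) \<le> b" "0 < b"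
  shows "tail (\<lambda>B. \<Sum>m\<in>P. \<Sum>a\<in>Q. \<phi> m a B) (k * sqrt (a * b)) ((N + 1) * p0)"
proof -
  have fin: "finite P" using assms(2) finite_subset by blast
  have "card P \<le> card {..n}" using assms(2) by (intro card_mono) auto
  then have cP: "real (card P) \<le> N" by simp
  have "tail (\<lambda>B. \<Sum>m\<in>P. (\<Sum>a\<in>Q. \<phi> m a B)\<^sup>2) (a * (k * b)) (card P * p0)"
  proof (rule tail_dominated_family[OF fin])
    show "tail (\<lambda>B. \<Sum>a\<in>Q. \<phi> m a B) (sqrt (k * b)) p0" for m
      using assms by (intro row_tail) auto
    fix B assume B: "\<And>m. m \<in> P \<Longrightarrow> \<bar>\<Sum>a\<in>Q. \<phi> m a B\<bar> \<le> sqrt (k * b)"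
    have "(\<Sum>m\<in>P. (\<Sum>a\<in>Q. \<phi> m a B)\<^sup>2) \<le> (\<Sum>m\<in>P. k * b)"
    proof (intro sum_mono)
      fix m assume "m \<in> P"
      then have "\<bar>\<Sum>a\<in>Q. \<phi> m a B\<bar>\<^sup>2 \<le> (sqrt (k * b))\<^sup>2" using B by (intro power_mono) auto
      then show "(\<Sum>a\<in>Q. \<phi> m a B)\<^sup>2 \<le> k * b" using k assms by simp
    qed
    also have "\<dots> \<le> a * (k * b)" using assms k by (simp add: mult_right_mono)
    finally show "\<bar>\<Sum>m\<in>P. (\<Sum>a\<in>Q. \<phi> m a B)\<^sup>2\<bar> \<le> a * (k * b)" by (simp add: sum_nonneg)
  qed
  then have "tail (\<lambda>B. \<Sum>m\<in>P. \<Sum>a\<in>Q. \<phi> m a B) (sqrt (k * (a * (k * b)))) (card P * p0 + p0)"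
    using assms k array_lev1[OF assms(1)] by (intro azuma[where i = i]) (auto intro!: lev_sum)
  moreover have "sqrt (k * (a * (k * b))) = k * sqrt (a * b)"
    using k by (simp add: real_sqrt_mult ac_simps)
  moreover have "card P * p0 + p0 \<le> (N + 1) * p0"
    using mult_right_mono[OF cP, of p0] p0_pos by (simp add: algebra_simps)
  ultimately show ?thesis using tail_mono by fastforce
qed

text \<open>In coordinate \<open>j\<close> both factors have level \<open>a\<close>, so their
  oddness cancels; in coordinate \<open>i\<close> the top level is the same for all
  \<open>a\<close>. The third coordinate helps because the volume is fixed: for
  \<open>m < m'\<close> the levels \<open>n - m - a\<close> and \<open>n - m' - a\<close> differ,
  and the larger one takes each value once as \<open>a\<close> varies.\<close>

lemma cross_tail:
  assumes \<phi>: "array i j l \<phi>" and "m \<noteq> m'"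
  shows "tail (\<lambda>B. \<Sum>a\<le>n. \<phi> m a B * \<phi> m' a B) (sqrt (k * N)) p0"
proof -
  have *: "tail (\<lambda>B. \<Sum>a\<le>n. \<phi> m a B * \<phi> m' a B) (sqrt (k * N)) p0" if "m < m'" for m m'
  proof -
    \<comment> \<open>Here \<open>c\<close> is the level \<open>n - m - a\<close> itself, so the
      products are listed by their level in coordinate \<open>l\<close>.\<close>
    define d where "d c B = \<phi> m (n - m - c) B * \<phi> m' (n - m - c) B" for c B
    have eq: "(\<Sum>a\<le>n. \<phi> m a B * \<phi> m' a B) = (\<Sum>c\<le>n-m. d c B)" for B
    proof (cases "m \<le> n")
      case True
      have "(\<Sum>a\<le>n. \<phi> m a B * \<phi> m' a B) = (\<Sum>a\<le>n-m. \<phi> m a B * \<phi> m' a B)"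
        using array_0[OF \<phi>] True by (intro sum.mono_neutral_right) auto
      also have "\<dots> = (\<Sum>c\<le>n-m. d c B)"
        by (rule sum.reindex_bij_witness[of _ "\<lambda>c. n - m - c" "\<lambda>c. n - m - c"])
          (auto simp: d_def simp del: diff_diff_left)
      finally show ?thesis .
    next
      case False
      then show ?thesis using array_0[OF \<phi>, of m] by (simp add: d_def)
    qed
    have lev_d: "lev l c (d c)" if c: "c \<le> n - m" for c
    proof (cases "n < m' + (n - m - c)")
      case True
      then have "d c = (\<lambda>B. 0)" using array_0[OF \<phi> True] by (simp add: d_def fun_eq_iff)
      then show ?thesis by simp
    next
      case False
      have "lev l c (\<phi> m (n - m - c))"
        using array_lev3[OF \<phi>, of m "n - m - c"] c by (simp del: diff_diff_left)
      moreover have "below l c (\<phi> m' (n - m - c))"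
        using False c \<open>m < m'\<close> by (intro lev_below[OF array_lev3[OF \<phi>]]) linarith
      ultimately show ?thesis unfolding d_def by (intro lev_mult)
    qed
    have V: "tail (\<lambda>B. \<Sum>c\<le>n-m. (d c B)\<^sup>2) N 0"
    proof (rule tail_sure)
      fix B
      have "(\<Sum>c\<le>n-m. (d c B)\<^sup>2) \<le> (\<Sum>c\<le>n-m. 1)"
        unfolding d_def power_mult_distrib using array_sq_le1[OF \<phi>] by (intro sum_mono mult_le_one) auto
      then show "\<bar>\<Sum>c\<le>n-m. (d c B)\<^sup>2\<bar> \<le> N" by (simp add: sum_nonneg)
    qed
    have "tail (\<lambda>B. \<Sum>c\<le>n-m. d c B) (sqrt (k * N)) (0 + p0)"
      by (rule azuma[where i = l, OF _ V]) (use lev_d in auto)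
    then show ?thesis by (simp add: eq)
  qed
  show ?thesis
    using *[of m m'] *[of m' m] assms(2) by (cases "m < m'") (auto simp: mult.commute)
qed

text \<open>The gain of \<open>N\<^sup>-\<^sup>1\<^sup>/\<^sup>4\<close> over the trivial bound, due to Beck, comes from the off-diagonal
  terms of the square function, where the distinct levels in coordinate \<open>l\<close> produce cancellation.\<close>

lemma beck_gain:
  assumes \<phi>: "array i j l \<phi>" and G: "\<And>m. m \<le> n \<Longrightarrow> below j \<mu> (G m)"
    and \<mu>: "\<And>m a. a < \<mu> \<Longrightarrow> \<phi> m a = (\<lambda>B. 0)"
    and tG: "\<And>m. m \<le> n \<Longrightarrow> tail (G m) \<Gamma> p" and "0 < \<Gamma>"
  shows "tail (\<lambda>B. \<Sum>m\<le>n. G m B * (\<Sum>a\<le>n. \<phi> m a B)) (2 * k * N * sqrt (sqrt N) * \<Gamma>)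
    (N * p + (N\<^sup>2 + 1) * p0)"
proof -
  \<comment> \<open>Terms are regrouped by column. As \<open>G m\<close> lies below
    \<open>\<mu>\<close> and the columns before \<open>\<mu>\<close> vanish, \<open>Y a\<close> is
    of level \<open>a\<close> in coordinate \<open>j\<close>; Azuma applies, and its variance
    expands into the correlations \<open>K\<close> of rows.\<close>
  define Y where "Y a B = (\<Sum>m\<le>n. G m B * \<phi> m a B)" for a B
  define K where "K m m' B = (\<Sum>a\<le>n. \<phi> m a B * \<phi> m' a B)" for m m' B
  \<comment> \<open>Diagonal pairs contribute at most \<open>N\<^sup>2\<close>, the others at most
    \<open>N\<^sup>2\<close> times \<open>k * sqrt N\<close>. The square root is of order
    \<open>N^(5/4)\<close> in place of the trivial \<open>N^(3/2)\<close>.\<close>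
  define y where "y = \<Gamma>\<^sup>2 * (2 * N\<^sup>2 * (k * sqrt N))"
  have N1: "1 \<le> N" by simp
  have sq: "(\<Sum>a\<le>n. (Y a B)\<^sup>2) = (\<Sum>m\<le>n. \<Sum>m'\<le>n. G m B * G m' B * K m m' B)" for B
  proof -
    have "(\<Sum>a\<le>n. (Y a B)\<^sup>2) = (\<Sum>a\<le>n. \<Sum>m\<le>n. \<Sum>m'\<le>n. G m B * G m' B * (\<phi> m a B * \<phi> m' a B))"
      unfolding Y_def power2_eq_square sum_product by (simp add: ac_simps)
    also have "\<dots> = (\<Sum>m\<le>n. \<Sum>a\<le>n. \<Sum>m'\<le>n. G m B * G m' B * (\<phi> m a B * \<phi> m' a B))"
      by (rule sum.swap)
    also have "\<dots> = (\<Sum>m\<le>n. \<Sum>m'\<le>n. \<Sum>a\<le>n. G m B * G m' B * (\<phi> m a B * \<phi> m' a B))"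
      by (rule sum.cong[OF refl], rule sum.swap)
    finally show ?thesis by (simp add: K_def sum_distrib_left)
  qed
  note kN = sqrt_k_mult_le[of N]
  have tK: "tail (K m m') (if m = m' then N else k * sqrt N) p0" for m m'
  proof (cases "m = m'")
    case True
    have "tail (K m m') N 0"
    proof (rule tail_sure)
      fix B
      have "(\<Sum>a\<le>n. (\<phi> m a B)\<^sup>2) \<le> (\<Sum>a\<le>n. 1)" using array_sq_le1[OF \<phi>] by (intro sum_mono) auto
      then show "\<bar>K m m' B\<bar> \<le> N"
        using True by (simp add: K_def power2_eq_square sum_nonneg)
    qed
    then show ?thesis using True p0_pos tail_mono by fastforce
  next
    case False
    show ?thesis using tail_mono[OF cross_tail[OF \<phi> False] kN] False by (simp add: K_def[abs_def])
  qed
  have t1: "tail (\<lambda>B. of_bool (\<exists>m\<in>{..n}. \<Gamma> < \<bar>G m B\<bar>)) 0 (card {..n} * p)"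
    using tG by (intro tail_all[where a = "\<lambda>_. \<Gamma>"]) auto
  have t2: "tail (\<lambda>B. of_bool (\<exists>x\<in>{..n}\<times>{..n}. (if fst x = snd x then N else k * sqrt N) < \<bar>K (fst x) (snd x) B\<bar>)) 0
      (card ({..n} \<times> {..n}) * p0)"
    by (rule tail_all[where g = "\<lambda>x. K (fst x) (snd x)"]) (auto simp: tK)
  have tV: "tail (\<lambda>B. \<Sum>a\<le>n. (Y a B)\<^sup>2) y (card {..n} * p + card ({..n} \<times> {..n}) * p0)"
  proof (rule tail_dominated2[OF t1 t2])
    fix B assume "\<bar>of_bool (\<exists>m\<in>{..n}. \<Gamma> < \<bar>G m B\<bar>) :: real\<bar> \<le> 0"
      and "\<bar>of_bool (\<exists>x\<in>{..n}\<times>{..n}. (if fst x = snd x then N else k * sqrt N) < \<bar>K (fst x) (snd x) B\<bar>) :: real\<bar> \<le> 0"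
    then have "\<forall>m\<in>{..n}. \<bar>G m B\<bar> \<le> \<Gamma>"
      and "\<forall>x\<in>{..n}\<times>{..n}. \<bar>K (fst x) (snd x) B\<bar> \<le> (if fst x = snd x then N else k * sqrt N)"
      unfolding abs_of_bool_le_0 by (auto simp: not_less)
    then have G1: "m \<le> n \<Longrightarrow> \<bar>G m B\<bar> \<le> \<Gamma>" and K1: "m \<le> n \<Longrightarrow> m' \<le> n \<Longrightarrow> \<bar>K m m' B\<bar> \<le> (if m = m' then N else k * sqrt N)" for m m'
      by (auto simp del: if_split)
    have "\<bar>\<Sum>a\<le>n. (Y a B)\<^sup>2\<bar> \<le> (\<Sum>m\<le>n. \<Sum>m'\<le>n. \<bar>G m B * G m' B * K m m' B\<bar>)"
      unfolding sq by (rule order_trans[OF sum_abs], rule sum_mono, rule sum_abs)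
    also have "\<dots> \<le> (\<Sum>m\<le>n. \<Sum>m'\<le>n. \<Gamma> * \<Gamma> * (if m = m' then N else k * sqrt N))"
      unfolding abs_mult using G1 K1 \<open>0 < \<Gamma>\<close> by (intro sum_mono mult_mono) auto
    also have "\<dots> \<le> (\<Sum>m\<le>n. \<Sum>m'\<le>n. \<Gamma> * \<Gamma> * ((if m = m' then N else 0) + k * sqrt N))"
      using k \<open>0 < \<Gamma>\<close> by (intro sum_mono mult_left_mono) auto
    also have "\<dots> = \<Gamma>\<^sup>2 * (N\<^sup>2 + N\<^sup>2 * (k * sqrt N))"
      by (simp add: sum.distrib sum_distrib_left[symmetric] power2_eq_square algebra_simps)
    also have "\<dots> \<le> y"
    proof -
      have "1 * 1 \<le> k * sqrt N" using k by (intro mult_mono) auto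
      then have "N\<^sup>2 * 1 \<le> N\<^sup>2 * (k * sqrt N)" by (intro mult_left_mono) auto
      then show ?thesis unfolding y_def by (intro mult_left_mono) auto
    qed
    finally show "\<bar>\<Sum>a\<le>n. (Y a B)\<^sup>2\<bar> \<le> y" .
  qed
  have lev_Y: "lev j a (Y a)" for a
  proof (cases "a < \<mu>")
    case True
    then have "Y a = (\<lambda>B. 0)" using \<mu> by (simp add: Y_def fun_eq_iff)
    then show ?thesis by simp
  next
    case False
    then show ?thesis unfolding Y_def
      using G array_lev2[OF \<phi>] by (intro lev_sum lev_mult') (auto intro: below_mono[of j \<mu>])
  qed
  have ypos: "0 < y" using \<open>0 < \<Gamma>\<close> k by (simp add: y_def)
  have main: "tail (\<lambda>B. \<Sum>a\<le>n. Y a B) (sqrt (k * y)) (card {..n} * p + card ({..n} \<times> {..n}) * p0 + p0)"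
    using lev_Y ypos by (intro azuma[where i = j, OF _ tV]) auto
  have swap: "(\<Sum>a\<le>n. Y a B) = (\<Sum>m\<le>n. G m B * (\<Sum>a\<le>n. \<phi> m a B))" for B
    unfolding Y_def sum_distrib_left by (rule sum.swap)
  have "sqrt (k * y) \<le> 2 * k * N * sqrt (sqrt N) * \<Gamma>"
  proof (rule real_le_lsqrt)
    have "(2 * k * N * sqrt (sqrt N) * \<Gamma>)\<^sup>2 = 4 * k\<^sup>2 * N\<^sup>2 * sqrt N * \<Gamma>\<^sup>2"
      by (simp add: power_mult_distrib)
    moreover have "k * y = 2 * k\<^sup>2 * N\<^sup>2 * sqrt N * \<Gamma>\<^sup>2" by (simp add: y_def power2_eq_square)
    ultimately show "k * y \<le> (2 * k * N * sqrt (sqrt N) * \<Gamma>)\<^sup>2" by simp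
  qed (use k \<open>0 < \<Gamma>\<close> in auto)
  moreover have "card {..n} * p + card ({..n} \<times> {..n}) * p0 + p0 = N * p + (N\<^sup>2 + 1) * p0"
    by (simp add: power2_eq_square algebra_simps)
  ultimately show ?thesis using tail_mono[OF main] unfolding swap by simp
qed

text \<open>The off-diagonal part is kept ordered: the factor of \<open>u a\<close> involves earlier
  terms only, so for terms of increasing level each product is odd in its last digit.\<close>

lemma sq_sum_eq:
  fixes u :: "nat \<Rightarrow> real"
  shows "(\<Sum>a\<le>n. u a)\<^sup>2 = (\<Sum>a\<le>n. (u a)\<^sup>2) + 2 * (\<Sum>a\<le>n. u a * (\<Sum>b<a. u b))"
  by (induction n) (auto simp: power2_eq_square algebra_simps lessThan_Suc_atMost)

text \<open>Beck's gain makes the square function of a block of rows essentially deterministic. The coarse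
  blocks of length \<open>w\<close> in coordinate \<open>j\<close> are needed because the predictable factor in
  \<open>beck_gain\<close> must not vary with the column.\<close>

lemma square_function_tail:
  assumes \<phi>: "array i j l \<phi>" and rows: "\<And>m a. m \<notin> P \<Longrightarrow> \<phi> m a = (\<lambda>B. 0)"
    and P: "finite P" "real (card P) \<le> h"
    and J: "n < J * w" "0 < w"
  shows "tail (\<lambda>B. \<Sum>m\<le>n. (\<Sum>a\<le>n. \<phi> m a B)\<^sup>2)
     (h * N + 4 * real J * k\<^sup>2 * N * sqrt N * sqrt (sqrt N) + 2 * k * N * sqrt N * sqrt w) (5 * real J * N\<^sup>2 * p0)"
proof -
  \<comment> \<open>The sum over \<open>b < a\<close> is cut at the start of the coarse block of
    \<open>a\<close>. \<open>Q\<close> depends on \<open>a\<close> only through that block, so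
    Beck's gain is applied once per block; \<open>R\<close> is a remainder of at most
    \<open>w\<close> terms.\<close>
  define Q where "Q \<beta> m B = (\<Sum>b\<in>{..n} \<inter> {..<\<beta> * w}. \<phi> m b B)" for \<beta> m B
  define R where "R m a B = (\<Sum>b\<in>{..n} \<inter> {a div w * w..<a}. \<phi> m b B)" for m a B
  define \<psi> where "\<psi> \<beta> m a = (if a div w = \<beta> then \<phi> m a else (\<lambda>B. 0))" for \<beta> m a
  have J1: "1 \<le> J" using J by (cases J) auto
  have N1: "1 \<le> N" by simp
  have div_lt: "a div w < J" if "a \<le> n" for a
    using that J by (simp add: less_mult_imp_div_less)
  have prefix: "(\<Sum>b<a. \<phi> m b B) = Q (a div w) m B + R m a B" if "a \<le> n" for m a B
  proof -
    define D where "D = a div w * w"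
    have "D \<le> a" by (simp add: D_def)
    then have *: "{..<a} = ({..n} \<inter> {..<D}) \<union> ({..n} \<inter> {D..<a})"
      using that by auto
    show ?thesis unfolding Q_def R_def D_def[symmetric]
      by (subst *, subst sum.union_disjoint) auto
  qed
  define T1 where "T1 B = (\<Sum>m\<le>n. \<Sum>a\<le>n. (\<phi> m a B)\<^sup>2)" for B
  define T2 where "T2 B = (\<Sum>\<beta><J. \<Sum>m\<le>n. Q \<beta> m B * (\<Sum>a\<le>n. \<psi> \<beta> m a B))" for B
  \<comment> \<open>Beck's gain does not apply since \<open>R\<close> varies with \<open>a\<close>.
    Instead the shortness of the remainders saves a factor \<open>sqrt (w / N)\<close>, and the
    outer sum over \<open>a\<close> is treated by Azuma.\<close>
  define T3 where "T3 B = (\<Sum>a\<le>n. \<Sum>m\<le>n. R m a B * \<phi> m a B)" for B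
  have split: "(\<Sum>m\<le>n. (\<Sum>a\<le>n. \<phi> m a B)\<^sup>2) = T1 B + (2 * T2 B + 2 * T3 B)" for B
  proof -
    have T2: "T2 B = (\<Sum>m\<le>n. \<Sum>a\<le>n. \<phi> m a B * Q (a div w) m B)"
    proof -
      have "T2 B = (\<Sum>m\<le>n. \<Sum>\<beta><J. \<Sum>a\<le>n. Q \<beta> m B * \<psi> \<beta> m a B)"
        unfolding T2_def sum_distrib_left by (rule sum.swap)
      also have "\<dots> = (\<Sum>m\<le>n. \<Sum>a\<le>n. \<Sum>\<beta><J. Q \<beta> m B * \<psi> \<beta> m a B)"
        by (rule sum.cong[OF refl], rule sum.swap)
      also have "\<dots> = (\<Sum>m\<le>n. \<Sum>a\<le>n. \<Sum>\<beta><J. if a div w = \<beta> then \<phi> m a B * Q \<beta> m B else 0)"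
        by (intro sum.cong) (auto simp: \<psi>_def)
      also have "\<dots> = (\<Sum>m\<le>n. \<Sum>a\<le>n. \<phi> m a B * Q (a div w) m B)"
        using div_lt by (intro sum.cong refl) (simp add: sum.delta)
      finally show ?thesis .
    qed
    have T3: "T3 B = (\<Sum>m\<le>n. \<Sum>a\<le>n. \<phi> m a B * R m a B)"
      unfolding T3_def by (subst sum.swap) (simp add: mult.commute)
    have "(\<Sum>m\<le>n. (\<Sum>a\<le>n. \<phi> m a B)\<^sup>2)
        = T1 B + 2 * (\<Sum>m\<le>n. \<Sum>a\<le>n. \<phi> m a B * (\<Sum>b<a. \<phi> m b B))"
      unfolding sq_sum_eq T1_def by (simp add: sum.distrib sum_distrib_left)
    also have "(\<Sum>m\<le>n. \<Sum>a\<le>n. \<phi> m a B * (\<Sum>b<a. \<phi> m b B)) = T2 B + T3 B"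
      unfolding T2 T3 sum.distrib[symmetric] by (intro sum.cong refl) (simp add: prefix distrib_left)
    finally show ?thesis by simp
  qed
  have t1: "tail T1 (h * N) 0"
  proof (rule tail_sure)
    fix B
    have "T1 B = (\<Sum>m\<in>{..n} \<inter> P. \<Sum>a\<le>n. (\<phi> m a B)\<^sup>2)"
      unfolding T1_def using rows by (intro sum.mono_neutral_right) auto
    also have "\<dots> \<le> (\<Sum>m\<in>{..n} \<inter> P. \<Sum>a\<le>n. 1)" using array_sq_le1[OF \<phi>] by (intro sum_mono) auto
    also have "\<dots> = card ({..n} \<inter> P) * N" by simp
    also have "\<dots> \<le> card P * N" using P by (intro mult_right_mono) (auto intro: card_mono)
    also have "\<dots> \<le> h * N" using P by (intro mult_right_mono) auto
    finally show "\<bar>T1 B\<bar> \<le> h * N" by (simp add: T1_def sum_nonneg)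
  qed
  note kN = sqrt_k_mult_le[of N]
  have "tail (\<lambda>B. \<Sum>m\<le>n. Q \<beta> m B * (\<Sum>a\<le>n. \<psi> \<beta> m a B))
      (2 * k * N * sqrt (sqrt N) * (k * sqrt N)) (N * p0 + (N\<^sup>2 + 1) * p0)" for \<beta>
  proof (rule beck_gain[where \<mu> = "\<beta> * w"])
    show "array i j l (\<psi> \<beta>)" unfolding \<psi>_def by (rule array_restrict[OF \<phi>])
    show "below j (\<beta> * w) (Q \<beta> m)" for m
      unfolding Q_def by (intro below_sum lev_below[OF array_lev2[OF \<phi>]]) auto
    show "\<psi> \<beta> m a = (\<lambda>B. 0)" if "a < \<beta> * w" for m a
      using that less_mult_imp_div_less[OF that] by (simp add: \<psi>_def)
    have "card ({..n} \<inter> {..<\<beta> * w}) \<le> card {..n}" by (intro card_mono) auto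
    then have "tail (Q \<beta> m) (sqrt (k * N)) p0" for m
      unfolding Q_def by (intro row_tail[OF \<phi>]) auto
    then show "tail (Q \<beta> m) (k * sqrt N) p0" for m by (rule tail_mono) (use kN in auto)
    show "0 < k * sqrt N" using k by simp
  qed
  then have t2: "tail T2 (card {..<J} * (2 * k * N * sqrt (sqrt N) * (k * sqrt N))) (card {..<J} * (N * p0 + (N\<^sup>2 + 1) * p0))"
    unfolding T2_def by (intro tail_sum) auto
  have tR: "tail (R m a) (sqrt (k * w)) p0" for m a
  proof -
    have "card ({..n} \<inter> {a div w * w..<a}) \<le> card {a div w * w..<a}" by (intro card_mono) auto
    also have "\<dots> = a mod w" by (simp add: minus_div_mult_eq_mod)
    also have "\<dots> \<le> w" using J(2) by (simp add: less_imp_le)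
    finally have "real (card ({..n} \<inter> {a div w * w..<a})) \<le> real w" by simp
    then show ?thesis unfolding R_def using J(2) by (intro row_tail[OF \<phi>]) (simp_all del: of_nat_le_iff)
  qed
  have tV: "tail (\<lambda>B. \<Sum>a\<le>n. (\<Sum>m\<le>n. R m a B * \<phi> m a B)\<^sup>2) (N * (N\<^sup>2 * (k * w))) (card ({..n} \<times> {..n}) * p0)"
  proof (rule tail_dominated_family[where g = "\<lambda>x. R (fst x) (snd x)" and a = "\<lambda>x. sqrt (k * w)"])
    fix B assume "\<And>x. x \<in> {..n} \<times> {..n} \<Longrightarrow> \<bar>R (fst x) (snd x) B\<bar> \<le> sqrt (k * w)"
    then have R1: "m \<le> n \<Longrightarrow> a \<le> n \<Longrightarrow> \<bar>R m a B\<bar> \<le> sqrt (k * w)" for m a by force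
    have "(\<Sum>a\<le>n. (\<Sum>m\<le>n. R m a B * \<phi> m a B)\<^sup>2) \<le> (\<Sum>a\<le>n. N\<^sup>2 * (k * w))"
    proof (intro sum_mono)
      fix a assume a: "a \<in> {..n}"
      have "\<bar>\<Sum>m\<le>n. R m a B * \<phi> m a B\<bar> \<le> (\<Sum>m\<le>n. \<bar>R m a B\<bar> * \<bar>\<phi> m a B\<bar>)"
        unfolding abs_mult[symmetric] by (rule sum_abs)
      also have "\<dots> \<le> (\<Sum>m\<le>n. sqrt (k * w) * 1)"
        using R1 a array_le1[OF \<phi>] k by (intro sum_mono mult_mono) auto
      finally have "\<bar>\<Sum>m\<le>n. R m a B * \<phi> m a B\<bar> \<le> N * sqrt (k * w)" by (simp add: add.commute)
      then have "\<bar>\<Sum>m\<le>n. R m a B * \<phi> m a B\<bar>\<^sup>2 \<le> (N * sqrt (k * w))\<^sup>2" by (intro power_mono) auto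
      then show "(\<Sum>m\<le>n. R m a B * \<phi> m a B)\<^sup>2 \<le> N\<^sup>2 * (k * w)" using k by (simp add: power_mult_distrib)
    qed
    then show "\<bar>\<Sum>a\<le>n. (\<Sum>m\<le>n. R m a B * \<phi> m a B)\<^sup>2\<bar> \<le> N * (N\<^sup>2 * (k * w))" by (simp add: sum_nonneg add.commute)
  qed (auto simp: tR)
  have t3: "tail T3 (sqrt (k * (N * (N\<^sup>2 * (k * w))))) (card ({..n} \<times> {..n}) * p0 + p0)"
    unfolding T3_def
  proof (rule azuma[where i = j, OF _ tV])
    show "a \<le> n \<and> lev j a (\<lambda>B. \<Sum>m\<le>n. R m a B * \<phi> m a B)" if "a \<in> {..n}" for a
      unfolding R_def using that array_lev2[OF \<phi>]
      by (auto intro!: lev_sum lev_mult' below_sum lev_below[OF array_lev2[OF \<phi>]])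
  qed (use k J in auto)
  have t: "tail (\<lambda>B. T1 B + (2 * T2 B + 2 * T3 B))
    (h * N + (\<bar>2\<bar> * (card {..<J} * (2 * k * N * sqrt (sqrt N) * (k * sqrt N))) + \<bar>2\<bar> * sqrt (k * (N * (N\<^sup>2 * (k * w))))))
    (0 + (card {..<J} * (N * p0 + (N\<^sup>2 + 1) * p0) + (card ({..n} \<times> {..n}) * p0 + p0)))"
    by (intro tail_add tail_cmult t1 t2 t3)
  have "sqrt (k * (N * (N\<^sup>2 * (k * w)))) = sqrt ((k * N)\<^sup>2 * (N * w))"
    by (simp add: power2_eq_square ac_simps)
  also have "\<dots> = k * N * (sqrt N * sqrt w)"
    using k by (simp add: real_sqrt_mult)
  finally have b1: "h * N + (\<bar>2\<bar> * (card {..<J} * (2 * k * N * sqrt (sqrt N) * (k * sqrt N))) + \<bar>2\<bar> * sqrt (k * (N * (N\<^sup>2 * (k * w)))))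
    \<le> h * N + 4 * real J * k\<^sup>2 * N * sqrt N * sqrt (sqrt N) + 2 * k * N * sqrt N * sqrt w"
    by (simp add: power2_eq_square)
  have "N * 1 \<le> N * N" using N1 by (intro mult_left_mono) auto
  then have a1: "N \<le> N\<^sup>2" by (simp only: power2_eq_square mult_1_right)
  note a = a1 order_trans[OF N1 a1]
  have "real J * (N * p0 + (N\<^sup>2 + 1) * p0) \<le> real J * (3 * N\<^sup>2 * p0)"
  proof (intro mult_left_mono)
    have "N * p0 + (N\<^sup>2 + 1) * p0 = (N + N\<^sup>2 + 1) * p0" by (simp add: algebra_simps)
    also have "\<dots> \<le> (3 * N\<^sup>2) * p0" using a p0_pos by (intro mult_right_mono) auto
    finally show "N * p0 + (N\<^sup>2 + 1) * p0 \<le> 3 * N\<^sup>2 * p0" .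
  qed auto
  moreover have "N\<^sup>2 * p0 + p0 \<le> real J * (2 * N\<^sup>2 * p0)"
  proof -
    have "N\<^sup>2 * p0 + p0 = (N\<^sup>2 + 1) * p0" by (simp add: algebra_simps)
    also have "\<dots> \<le> (2 * N\<^sup>2) * p0" using a p0_pos by (intro mult_right_mono) auto
    also have "\<dots> = 1 * (2 * N\<^sup>2 * p0)" by simp
    also have "\<dots> \<le> real J * (2 * N\<^sup>2 * p0)" using J1 p0_pos by (intro mult_right_mono) auto
    finally show ?thesis .
  qed
  moreover have "real (card ({..n} \<times> {..n})) = N\<^sup>2" by (simp add: power2_eq_square algebra_simps)
  ultimately have b2: "0 + (card {..<J} * (N * p0 + (N\<^sup>2 + 1) * p0) + (card ({..n} \<times> {..n}) * p0 + p0)) \<le> 5 * real J * N\<^sup>2 * p0"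
    by simp
  show ?thesis unfolding split by (rule tail_mono[OF t b1 b2])
qed

end

section \<open>Riesz products\<close>

context cube
begin

text \<open>The exponents of the side lengths \<open>2^(- r i)\<close> of the rectangles of volume
  \<open>2^(-n)\<close>. Two entries determine the third, which leaves at most
  \<open>N\<^sup>2\<close> vectors.\<close>

definition L :: "(3 \<Rightarrow> nat) set" where "L = {r. r 1 + r 2 + r 3 = n}"

definition vec_of :: "3 \<Rightarrow> 3 \<Rightarrow> nat \<Rightarrow> nat \<Rightarrow> 3 \<Rightarrow> nat" where
  "vec_of i j m a = (\<lambda>x. if x = i then m else if x = j then a else n - m - a)"

lemma distinct3_cases:
  fixes i j l :: 3
  assumes "distinct [i, j, l]"
  shows "UNIV = {i, j, l}"
proof -
  have "card {i, j, l} = card (UNIV :: 3 set)" using assms by simp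
  then show ?thesis by (metis card_subset_eq finite top_greatest)
qed

lemma L_sum:
  assumes "distinct [i, j, l]"
  shows "r \<in> L \<longleftrightarrow> r i + r j + r l = n"
proof -
  have "r 1 + r 2 + r 3 = (\<Sum>x\<in>UNIV. r x)" by (simp only: sum_3)
  also have "\<dots> = r i + r j + r l" unfolding distinct3_cases[OF assms] using assms by simp
  finally show ?thesis by (simp add: L_def)
qed

lemma L_le: "r \<in> L \<Longrightarrow> r i \<le> n"
  using exhaust_3[of i] by (auto simp: L_def)

lemma vec_of_eq:
  assumes "distinct [i, j, l]" "r \<in> L"
  shows "vec_of i j (r i) (r j) = r"
proof
  fix x
  have "x = i \<or> x = j \<or> x = l" using distinct3_cases[OF assms(1)] by auto
  then show "vec_of i j (r i) (r j) x = r x"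
    using assms L_sum[OF assms(1), of r] by (auto simp: vec_of_def)
qed

lemma vec_of_simps [simp]: "vec_of i j m a i = m" "i \<noteq> j \<Longrightarrow> vec_of i j m a j = a"
  by (auto simp: vec_of_def)

lemma finite_L [simp]: "finite L"
proof (rule finite_subset)
  show "L \<subseteq> (\<lambda>(m, a). vec_of 1 2 m a) ` ({..n} \<times> {..n})"
  proof
    fix r assume r: "r \<in> L"
    have "vec_of 1 2 (r 1) (r 2) = r" by (rule vec_of_eq[of _ _ 3]) (use r in auto)
    then show "r \<in> (\<lambda>(m, a). vec_of 1 2 m a) ` ({..n} \<times> {..n})"
      using L_le[OF r] by (intro image_eqI[where x = "(r 1, r 2)"]) simp_all
  qed
qed auto

lemma L_eqI:
  assumes "distinct [i, j, l]" "r \<in> L" "r' \<in> L" "r i = r' i" "r j = r' j"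
  shows "r = r'"
  using vec_of_eq[OF assms(1,2)] vec_of_eq[OF assms(1,3)] assms(4,5) by metis

lemma card_subset_L:
  assumes "A \<subseteq> L"
  shows "card A \<le> N\<^sup>2"
proof -
  have "inj_on (\<lambda>r. (r 1, r 2)) A"
  proof (rule inj_onI)
    fix r r' assume "r \<in> A" "r' \<in> A" "(r 1, r 2) = (r' 1, r' 2)"
    then show "r = r'" using assms by (intro L_eqI[of 1 2 3]) auto
  qed
  then have "card A = card ((\<lambda>r. (r 1, r 2)) ` A)" by (simp add: card_image)
  also have "\<dots> \<le> card ({..n} \<times> {..n})" using assms L_le by (intro card_mono) auto
  finally have "real (card A) \<le> real (card ({..n} \<times> {..n}))" by linarith
  then show ?thesis by (simp add: power2_eq_square algebra_simps)
qed

end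

text \<open>The levels of coordinate 1 form \<open>q\<close> blocks of length \<open>h\<close>; the
  other coordinates use \<open>J\<close> coarse blocks of length \<open>w\<close>. By
  \<open>sq\<close> the square function of a block, scaled by \<open>\<rho>\<^sup>2\<close>, is at
  most \<open>\<eta>\<close> with high probability; \<open>small\<close> is the numerical input for
  the negative part in \<open>E_abs_Z\<close>. The \<open>f r\<close> are only assumed bounded by 1,
  so that vanishing coefficients are no exception.\<close>

locale riesz = cube_tail +
  fixes f :: "(3 \<Rightarrow> nat) \<Rightarrow> bits \<Rightarrow> real" and q h J w :: nat and \<rho> \<eta> :: real
  assumes f_le1: "r \<in> L \<Longrightarrow> \<bar>f r B\<bar> \<le> 1" and f_lev: "r \<in> L \<Longrightarrow> lev i (r i) (f r)"
    and qh: "n < q * h" and Jw: "n < J * w" and \<rho>: "0 < \<rho>" and \<eta>: "0 < \<eta>"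
    and sq: "real h * N + 4 * real J * k\<^sup>2 * N * sqrt N * sqrt (sqrt N) + 2 * k * N * sqrt N * sqrt w \<le> \<eta> / \<rho>\<^sup>2"
    and small: "(1 + \<eta>) ^ q * (1 + q * ((1 + \<rho> * N\<^sup>2) ^ (2 * q) * (5 * real J * N\<^sup>2 * p0))) *
       (q * (5 * real J * N\<^sup>2 * p0 + 2 * exp (- (1 / \<eta>) / 2))) \<le> 1 / 4"
begin

definition arr :: "(3 \<Rightarrow> nat) set \<Rightarrow> 3 \<Rightarrow> 3 \<Rightarrow> nat \<Rightarrow> nat \<Rightarrow> bits \<Rightarrow> real" where
  "arr A i j m a = (if vec_of i j m a \<in> A then f (vec_of i j m a) else (\<lambda>B. 0))"

definition F :: "(3 \<Rightarrow> nat) set \<Rightarrow> bits \<Rightarrow> real" where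
  "F A B = (\<Sum>r\<in>A. f r B)"

definition block :: "nat \<Rightarrow> (3 \<Rightarrow> nat) set" where
  "block t = {r \<in> L. r 1 div h = t}"

lemma h_pos: "0 < h" and w_pos: "0 < w" and q_pos: "0 < q"
  using qh Jw by (auto intro: gr0I)

lemma block_subset: "A \<subseteq> block t \<Longrightarrow> A \<subseteq> L"
  by (auto simp: block_def)

lemma array_arr:
  assumes "distinct [i, j, l]" "A \<subseteq> L"
  shows "array i j l (arr A i j)"
  unfolding array_def
proof (intro allI conjI impI)
  fix m a
  have *: "vec_of i j m a l = n - m - a" using assms(1) by (auto simp: vec_of_def)
  have ij: "i \<noteq> j" using assms(1) by auto
  show "\<bar>arr A i j m a B\<bar> \<le> 1" for B using f_le1 assms(2) by (auto simp: arr_def)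
  show "lev i m (arr A i j m a)" using f_lev[of "vec_of i j m a" i] assms(2) by (auto simp: arr_def)
  show "lev j a (arr A i j m a)" using f_lev[of "vec_of i j m a" j] assms(2) ij by (auto simp: arr_def)
  show "lev l (n - m - a) (arr A i j m a)"
    using f_lev[of "vec_of i j m a" l] assms(2) * by (auto simp: arr_def)
  assume "n < m + a"
  then have "vec_of i j m a \<notin> L" using L_sum[OF assms(1)] ij by auto
  then show "arr A i j m a = (\<lambda>B. 0)" using assms(2) by (auto simp: arr_def)
qed

lemma sum_arr:
  assumes "distinct [i, j, l]" "A \<subseteq> L" "finite P" "finite Q" "(\<lambda>r. r i) ` A \<subseteq> P" "(\<lambda>r. r j) ` A \<subseteq> Q"
  shows "(\<Sum>r\<in>A. c (r i) * f r B) = (\<Sum>m\<in>P. c m * (\<Sum>a\<in>Q. arr A i j m a B))"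
proof -
  have ij: "i \<noteq> j" using assms(1) by auto
  have "(\<Sum>m\<in>P. c m * (\<Sum>a\<in>Q. arr A i j m a B))
      = (\<Sum>x\<in>P\<times>Q. c (fst x) * arr A i j (fst x) (snd x) B)"
    by (simp add: sum_distrib_left sum.cartesian_product split_beta)
  also have "\<dots> = (\<Sum>x\<in>(\<lambda>r. (r i, r j)) ` A. c (fst x) * arr A i j (fst x) (snd x) B)"
  proof (rule sum.mono_neutral_right)
    show "\<forall>x\<in>P \<times> Q - (\<lambda>r. (r i, r j)) ` A. c (fst x) * arr A i j (fst x) (snd x) B = 0"
    proof
      fix x assume x: "x \<in> P \<times> Q - (\<lambda>r. (r i, r j)) ` A"
      have "vec_of i j (fst x) (snd x) \<notin> A"
      proof
        assume "vec_of i j (fst x) (snd x) \<in> A"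
        then have "x \<in> (\<lambda>r. (r i, r j)) ` A"
          using ij by (intro image_eqI[where x = "vec_of i j (fst x) (snd x)"]) auto
        then show False using x by blast
      qed
      then show "c (fst x) * arr A i j (fst x) (snd x) B = 0" by (simp add: arr_def)
    qed
  qed (use assms in auto)
  also have "\<dots> = (\<Sum>r\<in>A. c (r i) * arr A i j (r i) (r j) B)"
  proof (subst sum.reindex)
    show "inj_on (\<lambda>r. (r i, r j)) A"
      using L_eqI[OF assms(1)] assms(2) by (intro inj_onI) auto
  qed simp
  also have "\<dots> = (\<Sum>r\<in>A. c (r i) * f r B)"
    using vec_of_eq[OF assms(1)] assms(2) by (intro sum.cong) (auto simp: arr_def)
  finally show ?thesis by simp
qed

lemma F_arr:
  assumes "distinct [i, j, l]" "A \<subseteq> L" "finite P" "finite Q" "(\<lambda>r. r i) ` A \<subseteq> P" "(\<lambda>r. r j) ` A \<subseteq> Q"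
  shows "F A B = (\<Sum>m\<in>P. \<Sum>a\<in>Q. arr A i j m a B)"
  using sum_arr[OF assms, of "\<lambda>_. 1"] by (simp add: F_def)

text \<open>Any two coordinates may serve as rows and columns, so a restriction of the levels in one
  coordinate is rewarded by the square root of the proportion of levels that remain.\<close>

lemma F_tail:
  assumes "distinct [i, j, l]" "A \<subseteq> L" "real (card ((\<lambda>r. r i) ` A)) \<le> a" "0 < a"
    "real (card ((\<lambda>r. r j) ` A)) \<le> b" "0 < b"
  shows "tail (F A) (k * sqrt (a * b)) ((N + 1) * p0)"
proof -
  have fin: "finite A" using assms(2) finite_L by (rule finite_subset)
  have "F A = (\<lambda>B. \<Sum>m\<in>(\<lambda>r. r i) ` A. \<Sum>a\<in>(\<lambda>r. r j) ` A. arr A i j m a B)"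
    using F_arr[OF assms(1,2)] fin by auto
  then show ?thesis
    using block_tail[OF array_arr[OF assms(1,2)], of "(\<lambda>r. r i) ` A" a "(\<lambda>r. r j) ` A" b] assms L_le
    by auto
qed

lemma F_le: "A \<subseteq> L \<Longrightarrow> \<bar>F A B\<bar> \<le> N\<^sup>2"
proof -
  assume A: "A \<subseteq> L"
  have "\<bar>F A B\<bar> \<le> (\<Sum>r\<in>A. 1)" unfolding F_def
    using A f_le1 by (intro order_trans[OF sum_abs] sum_mono) auto
  then show ?thesis using card_subset_L[OF A] by simp
qed

definition row_sum :: "(3 \<Rightarrow> nat) set \<Rightarrow> nat \<Rightarrow> bits \<Rightarrow> real" where
  "row_sum A m B = (\<Sum>a\<le>n. arr A 1 2 m a B)"

text \<open>The square function in coordinate 1, the coordinate along which the blocks of the Riesz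
  product are ordered.\<close>

definition SF :: "(3 \<Rightarrow> nat) set \<Rightarrow> bits \<Rightarrow> real" where
  "SF A B = (\<Sum>m\<le>n. (row_sum A m B)\<^sup>2)"

lemma F_row_sum: "A \<subseteq> L \<Longrightarrow> F A B = (\<Sum>m\<le>n. row_sum A m B)"
  unfolding row_sum_def using L_le by (intro F_arr[of 1 2 3]) auto

lemma arr_lev1: "A \<subseteq> L \<Longrightarrow> lev 1 m (arr A 1 2 m a)"
  using array_lev1[OF array_arr[of 1 2 3 A]] by simp

lemma row_sum_lev: "A \<subseteq> L \<Longrightarrow> lev 1 m (row_sum A m)"
  unfolding row_sum_def by (intro lev_sum arr_lev1)

lemma row_sum_0: "A \<subseteq> block t \<Longrightarrow> m div h \<noteq> t \<Longrightarrow> row_sum A m B = 0"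
  by (auto simp: row_sum_def arr_def block_def intro!: sum.neutral)

lemma SF_nonneg: "0 \<le> SF A B"
  by (simp add: SF_def sum_nonneg)

lemma SF_tail:
  assumes "A \<subseteq> block t"
  shows "tail (SF A) (\<eta> / \<rho>\<^sup>2) (5 * real J * N\<^sup>2 * p0)"
proof -
  have A: "A \<subseteq> L" using block_subset[OF assms] .
  have "tail (\<lambda>B. \<Sum>m\<le>n. (\<Sum>a\<le>n. arr A 1 2 m a B)\<^sup>2)
     (h * N + 4 * real J * k\<^sup>2 * N * sqrt N * sqrt (sqrt N) + 2 * k * N * sqrt N * sqrt w) (5 * real J * N\<^sup>2 * p0)"
  proof (rule square_function_tail[where P = "{t * h..<t * h + h}"])
    show "array 1 2 3 (arr A 1 2)" by (rule array_arr) (use A in auto)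
    show "arr A 1 2 m a = (\<lambda>B. 0)" if "m \<notin> {t * h..<t * h + h}" for m a
    proof -
      have "m div h \<noteq> t"
      proof
        assume "m div h = t"
        then have "m = t * h + m mod h" by (metis div_mult_mod_eq)
        then show False using that h_pos mod_less_divisor[OF h_pos, of m] by simp
      qed
      then show ?thesis using assms by (auto simp: arr_def block_def)
    qed
  qed (use Jw w_pos in auto)
  then show ?thesis unfolding SF_def[abs_def] row_sum_def[abs_def] using sq tail_mono by blast
qed

text \<open>Azuma with variance \<open>\<eta>\<close> and exponent \<open>1 / \<eta>\<close>, chosen
  to make the threshold equal to 1: off this event the factor \<open>1 + \<rho> * F A B\<close> is
  nonnegative.\<close>

lemma F_tail1:
  assumes "A \<subseteq> block t"
  shows "tail (\<lambda>B. \<rho> * F A B) 1 (5 * real J * N\<^sup>2 * p0 + 2 * exp (- (1 / \<eta>) / 2))"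
proof -
  have A: "A \<subseteq> L" using block_subset[OF assms] .
  have "tail (\<lambda>B. \<Sum>m\<le>n. (\<rho> * row_sum A m B)\<^sup>2) \<eta> (5 * real J * N\<^sup>2 * p0)"
  proof -
    have "(\<lambda>B. \<Sum>m\<le>n. (\<rho> * row_sum A m B)\<^sup>2) = (\<lambda>B. \<rho>\<^sup>2 * SF A B)"
      by (simp add: SF_def power_mult_distrib sum_distrib_left)
    then show ?thesis using tail_cmult[OF SF_tail[OF assms], of "\<rho>\<^sup>2"] \<rho> by simp
  qed
  then have "tail (\<lambda>B. \<Sum>m\<le>n. \<rho> * row_sum A m B) (sqrt (1 / \<eta> * \<eta>)) (5 * real J * N\<^sup>2 * p0 + 2 * exp (- (1 / \<eta>) / 2))"
    using \<eta> row_sum_lev[OF A] by (intro tail_azuma[where i = 1]) (auto intro: lev_cmult)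
  then show ?thesis using \<eta> by (simp add: F_row_sum[OF A] sum_distrib_left[symmetric])
qed

section \<open>Mean, second moment and L1 norm of short Riesz products\<close>

definition Z :: "(nat \<Rightarrow> (3 \<Rightarrow> nat) set) \<Rightarrow> nat set \<Rightarrow> bits \<Rightarrow> real" where
  "Z A W B = (\<Prod>t\<in>W. 1 + \<rho> * F (A t) B)"

abbreviation M :: real where "M \<equiv> 1 + \<rho> * N\<^sup>2"

lemma M_ge1: "1 \<le> M"
  using \<rho> by simp

lemma factor_le: "A \<subseteq> L \<Longrightarrow> \<bar>1 + \<rho> * F A B\<bar> \<le> M"
proof -
  assume "A \<subseteq> L"
  then have "\<rho> * \<bar>F A B\<bar> \<le> \<rho> * N\<^sup>2" using F_le \<rho> by (intro mult_left_mono) auto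
  then have "\<bar>\<rho> * F A B\<bar> \<le> \<rho> * N\<^sup>2" using \<rho> by (simp add: abs_mult)
  then show ?thesis by linarith
qed

lemma below_block_F:
  assumes "A \<subseteq> block t" "t < t'"
  shows "below 1 (t' * h) (F A)"
  unfolding F_def
proof (rule below_sum)
  fix r assume r: "r \<in> A"
  then have "r 1 div h < t'" using assms by (auto simp: block_def)
  then have "r 1 < t' * h" using h_pos by (simp add: div_less_iff_less_mult)
  then show "below 1 (t' * h) (f r)"
    using r block_subset[OF assms(1)] by (intro lev_below[OF f_lev]) auto
qed

text \<open>A row of block \<open>t\<close> is odd in its own digit of coordinate 1, which neither
  \<open>X m\<close> nor \<open>Y\<close> sees; rows outside the block vanish, so \<open>X\<close>
  is constrained only from level \<open>t * h\<close> on.\<close>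

lemma E_row_sum_mult:
  assumes "A \<subseteq> block t" "below 1 (t * h) Y" "m \<le> n" "\<And>m. t * h \<le> m \<Longrightarrow> m \<le> n \<Longrightarrow> below 1 m (X m)"
  shows "E (\<lambda>B. row_sum A m B * (X m B * Y B)) = 0"
proof (cases "m div h = t")
  case True
  then have "t * h \<le> m" by (metis div_times_less_eq_dividend)
  then have "below 1 m (\<lambda>B. X m B * Y B)" using assms by (auto intro: below_mult below_mono)
  then show ?thesis
    by (intro E_lev[OF assms(3), where i = 1] lev_mult[OF row_sum_lev[OF block_subset[OF assms(1)]]])
next
  case False
  then show ?thesis using row_sum_0[OF assms(1)] by simp
qed

lemma E_F_mult:
  assumes "A \<subseteq> block t" "below 1 (t * h) Y"
  shows "E (\<lambda>B. F A B * Y B) = 0"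
proof -
  have "E (\<lambda>B. F A B * Y B) = (\<Sum>m\<le>n. E (\<lambda>B. row_sum A m B * (1 * Y B)))"
    unfolding E_sum[symmetric] F_row_sum[OF block_subset[OF assms(1)]] by (simp add: sum_distrib_right)
  also have "\<dots> = 0" using E_row_sum_mult[OF assms, where X = "\<lambda>_ _. 1"] by simp
  finally show ?thesis .
qed

text \<open>Against a weight built from earlier blocks, products of two different rows average out.
  The square of \<open>F A\<close> may therefore be replaced by its square function, which is under
  control off a rare event.\<close>

lemma E_F_sq_mult:
  assumes "A \<subseteq> block t" "below 1 (t * h) Y"
  shows "E (\<lambda>B. (F A B)\<^sup>2 * Y B) = E (\<lambda>B. SF A B * Y B)"
proof -
  have A: "A \<subseteq> L" using block_subset[OF assms(1)] .
  have "(F A B)\<^sup>2 * Y B = SF A B * Y B + 2 * (\<Sum>m\<le>n. row_sum A m B * ((\<Sum>m'<m. row_sum A m' B) * Y B))" for B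
    unfolding F_row_sum[OF A] sq_sum_eq SF_def by (simp add: algebra_simps sum_distrib_left sum_distrib_right)
  then have "E (\<lambda>B. (F A B)\<^sup>2 * Y B)
     = E (\<lambda>B. SF A B * Y B) + 2 * (\<Sum>m\<le>n. E (\<lambda>B. row_sum A m B * ((\<Sum>m'<m. row_sum A m' B) * Y B)))"
    unfolding E_sum[symmetric] E_cmult[symmetric] E_add[symmetric] by simp
  also have "(\<Sum>m\<le>n. E (\<lambda>B. row_sum A m B * ((\<Sum>m'<m. row_sum A m' B) * Y B))) = 0"
    using E_row_sum_mult[OF assms, where X = "\<lambda>m B. \<Sum>m'<m. row_sum A m' B"] row_sum_lev[OF A]
    by (auto intro!: sum.neutral below_sum intro: lev_below)
  finally show ?thesis by simp
qed

context
  fixes A :: "nat \<Rightarrow> (3 \<Rightarrow> nat) set"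
  assumes A: "\<And>t. A t \<subseteq> block t"
begin

lemma below_Z: "(\<And>s. s \<in> W \<Longrightarrow> s < t) \<Longrightarrow> below 1 (t * h) (Z A W)"
  unfolding Z_def using A by (intro below_prod below_add below_mult below_block_F) auto

lemma Z_le: "finite W \<Longrightarrow> \<bar>Z A W B\<bar> \<le> M ^ card W"
  unfolding Z_def abs_prod
  using prod_mono[of W "\<lambda>t. \<bar>1 + \<rho> * F (A t) B\<bar>" "\<lambda>t. M"] factor_le[OF block_subset[OF A]] by simp

lemma E_Z: "finite W \<Longrightarrow> E (Z A W) = 1"
proof (induction W rule: finite_linorder_max_induct)
  case empty
  then show ?case by (simp add: Z_def[abs_def])
next
  case (insert t W)
  have tW: "t \<notin> W" using insert.hyps by auto
  have "Z A (insert t W) B = Z A W B + \<rho> * (F (A t) B * Z A W B)" for B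
    using insert.hyps tW by (simp add: Z_def algebra_simps)
  then have "E (Z A (insert t W)) = E (Z A W) + \<rho> * E (\<lambda>B. F (A t) B * Z A W B)"
    unfolding E_add[symmetric] E_cmult[symmetric] by presburger
  also have "E (\<lambda>B. F (A t) B * Z A W B) = 0"
    using insert.hyps A by (intro E_F_mult below_Z) auto
  finally show ?case using insert.IH by simp
qed

text \<open>Removing the last block leaves the factor
  \<open>1 + \<rho>\<^sup>2 * SF (A t) B\<close>. It is at most \<open>1 + \<eta>\<close> except on
  a rare event, whose probability is small enough for the sup bound \<open>M ^ (2 * q)\<close> to be
  affordable.\<close>

lemma E_Z_sq:
  assumes "finite W" "card W \<le> q"
  shows "E (\<lambda>B. (Z A W B)\<^sup>2) \<le> (1 + \<eta>) ^ card W * (1 + card W * (M ^ (2 * q) * (5 * real J * N\<^sup>2 * p0)))"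
  using assms
proof (induction W rule: finite_linorder_max_induct)
  case empty
  then show ?case by (simp add: Z_def[abs_def])
next
  case (insert t W)
  define D where "D = M ^ (2 * q) * (5 * real J * N\<^sup>2 * p0)"
  have D: "0 \<le> D" using p0_pos \<rho> by (simp add: D_def)
  have tW: "t \<notin> W" and card: "card (insert t W) = Suc (card W)" using insert.hyps by auto
  have below_Z2: "below 1 (t * h) (\<lambda>B. (Z A W B)\<^sup>2)"
    using insert.hyps by (intro below_power below_Z) auto
  have ZI: "Z A (insert t W) B = (1 + \<rho> * F (A t) B) * Z A W B" for B
    using insert.hyps tW by (simp add: Z_def)
  have "(Z A (insert t W) B)\<^sup>2 = (Z A W B)\<^sup>2 + 2 * \<rho> * (F (A t) B * (Z A W B)\<^sup>2) + \<rho>\<^sup>2 * ((F (A t) B)\<^sup>2 * (Z A W B)\<^sup>2)" for B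
    unfolding ZI by (simp add: power2_eq_square algebra_simps)
  then have "E (\<lambda>B. (Z A (insert t W) B)\<^sup>2)
     = E (\<lambda>B. (Z A W B)\<^sup>2) + 2 * \<rho> * E (\<lambda>B. F (A t) B * (Z A W B)\<^sup>2) + \<rho>\<^sup>2 * E (\<lambda>B. (F (A t) B)\<^sup>2 * (Z A W B)\<^sup>2)"
    unfolding E_add[symmetric] E_cmult[symmetric] by presburger
  also have "\<dots> = E (\<lambda>B. (Z A W B)\<^sup>2) + \<rho>\<^sup>2 * E (\<lambda>B. SF (A t) B * (Z A W B)\<^sup>2)"
    using E_F_mult[OF A below_Z2] E_F_sq_mult[OF A below_Z2] by simp
  also have "\<dots> = E (\<lambda>B. (1 + \<rho>\<^sup>2 * SF (A t) B) * (Z A W B)\<^sup>2)"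
    unfolding E_add[symmetric] E_cmult[symmetric] by (simp add: algebra_simps)
  also have "\<dots> \<le> E (\<lambda>B. (1 + \<eta>) * (Z A W B)\<^sup>2 + M ^ (2 * q) * of_bool (\<eta> / \<rho>\<^sup>2 < \<bar>SF (A t) B\<bar>))"
  proof (rule E_mono)
    fix B
    show "(1 + \<rho>\<^sup>2 * SF (A t) B) * (Z A W B)\<^sup>2 \<le> (1 + \<eta>) * (Z A W B)\<^sup>2 + M ^ (2 * q) * of_bool (\<eta> / \<rho>\<^sup>2 < \<bar>SF (A t) B\<bar>)"
    proof (cases "\<eta> / \<rho>\<^sup>2 < \<bar>SF (A t) B\<bar>")
      case False
      then have "\<rho>\<^sup>2 * SF (A t) B \<le> \<eta>" using \<rho> SF_nonneg[of "A t" B] by (simp add: field_simps)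
      then show ?thesis using False by (simp add: mult_right_mono)
    next
      case True
      have "SF (A t) B \<le> (N\<^sup>2)\<^sup>2"
      proof -
        have "(row_sum (A t) m B)\<^sup>2 \<le> N\<^sup>2" for m
        proof -
          have "\<bar>row_sum (A t) m B\<bar> \<le> (\<Sum>a\<le>n. 1)" unfolding row_sum_def
            using array_le1[OF array_arr[of 1 2 3 "A t"]] block_subset[OF A]
            by (intro order_trans[OF sum_abs] sum_mono) auto
          then have "\<bar>row_sum (A t) m B\<bar>\<^sup>2 \<le> N\<^sup>2" by (intro power_mono) auto
          then show ?thesis by simp
        qed
        then have "SF (A t) B \<le> (\<Sum>m\<le>n. N\<^sup>2)" unfolding SF_def by (intro sum_mono)
        also have "\<dots> = N * N\<^sup>2" by simp
        also have "\<dots> \<le> N\<^sup>2 * N\<^sup>2" by (intro mult_right_mono) (auto simp: power2_eq_square)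
        finally show ?thesis by (simp add: power2_eq_square)
      qed
      then have "\<rho>\<^sup>2 * SF (A t) B \<le> \<rho>\<^sup>2 * (N\<^sup>2)\<^sup>2" by (intro mult_left_mono) auto
      then have "1 + \<rho>\<^sup>2 * SF (A t) B \<le> 1 + (\<rho> * N\<^sup>2)\<^sup>2" by (simp add: power_mult_distrib)
      also have "\<dots> \<le> M\<^sup>2" using \<rho> by (simp add: power2_sum)
      finally have "(1 + \<rho>\<^sup>2 * SF (A t) B) * (Z A W B)\<^sup>2 \<le> M\<^sup>2 * (M ^ card W)\<^sup>2"
        using Z_le[OF insert.hyps(1), of B] power_mono[of "\<bar>Z A W B\<bar>" "M ^ card W" 2]
        by (intro mult_mono) auto
      also have "\<dots> = M ^ (2 * Suc (card W))" by (simp add: power_mult[symmetric] power_add[symmetric] mult.commute)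
      also have "\<dots> \<le> M ^ (2 * q)" using insert.prems card M_ge1 by (intro power_increasing) auto
      finally have "(1 + \<rho>\<^sup>2 * SF (A t) B) * (Z A W B)\<^sup>2 \<le> M ^ (2 * q)" .
      moreover have "0 \<le> (1 + \<eta>) * (Z A W B)\<^sup>2" using \<eta> by simp
      ultimately show ?thesis using True by simp
    qed
  qed
  also have "\<dots> = (1 + \<eta>) * E (\<lambda>B. (Z A W B)\<^sup>2) + M ^ (2 * q) * Pr (\<lambda>B. \<eta> / \<rho>\<^sup>2 < \<bar>SF (A t) B\<bar>)"
    unfolding Pr_def E_add E_cmult ..
  also have "\<dots> \<le> (1 + \<eta>) * ((1 + \<eta>) ^ card W * (1 + card W * D)) + D"
  proof -
    have "E (\<lambda>B. (Z A W B)\<^sup>2) \<le> (1 + \<eta>) ^ card W * (1 + card W * D)"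
      using insert.IH insert.prems card by (simp add: D_def)
    moreover have "M ^ (2 * q) * Pr (\<lambda>B. \<eta> / \<rho>\<^sup>2 < \<bar>SF (A t) B\<bar>) \<le> D"
      using SF_tail[OF A, of t] \<rho> unfolding D_def tail_def by (intro mult_left_mono) auto
    ultimately show ?thesis using \<eta> by (intro add_mono mult_left_mono) auto
  qed
  also have "\<dots> \<le> (1 + \<eta>) ^ Suc (card W) * (1 + Suc (card W) * D)"
  proof -
    have "1 * D \<le> (1 + \<eta>) ^ Suc (card W) * D" using \<eta> D by (intro mult_right_mono one_le_power) auto
    then show ?thesis by (simp add: algebra_simps)
  qed
  finally show ?case unfolding card D_def .
qed

text \<open>The factors may be negative, but the mean is 1, so only the negative part has to be
  bounded. It lives where some \<open>\<rho> * F (A t) B\<close> exceeds 1 in absolute value;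
  Cauchy-Schwarz against the second moment bounds the mass there by 1/2.\<close>

lemma E_abs_Z:
  assumes "W \<subseteq> {..<q}"
  shows "E (\<lambda>B. \<bar>Z A W B\<bar>) \<le> 2"
proof -
  have fin: "finite W" using assms finite_subset by auto
  have card: "card W \<le> q" using card_mono[OF _ assms] by simp
  define D where "D = M ^ (2 * q) * (5 * real J * N\<^sup>2 * p0)"
  define p where "p = 5 * real J * N\<^sup>2 * p0 + 2 * exp (- (1 / \<eta>) / 2)"
  have D: "0 \<le> D" and p: "0 \<le> p" using p0_pos \<rho> by (simp_all add: D_def p_def)
  define b where "b B = (of_bool (\<exists>t\<in>W. 1 < \<bar>\<rho> * F (A t) B\<bar>) :: real)" for B
  have Eb: "E b \<le> q * p"
  proof -
    have "E b \<le> (\<Sum>t\<in>W. Pr (\<lambda>B. 1 < \<bar>\<rho> * F (A t) B\<bar>))"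
      unfolding b_def Pr_def[symmetric] by (rule Pr_bex[OF fin])
    also have "\<dots> \<le> (\<Sum>t\<in>W. p)"
      using F_tail1[OF A] by (intro sum_mono) (auto simp: tail_def p_def)
    also have "\<dots> \<le> q * p" using card p by (simp add: mult_right_mono)
    finally show ?thesis .
  qed
  have EZ2: "E (\<lambda>B. (Z A W B)\<^sup>2) \<le> (1 + \<eta>) ^ q * (1 + q * D)"
  proof -
    have "E (\<lambda>B. (Z A W B)\<^sup>2) \<le> (1 + \<eta>) ^ card W * (1 + card W * D)"
      using E_Z_sq[OF fin card] by (simp add: D_def)
    also have "\<dots> \<le> (1 + \<eta>) ^ q * (1 + q * D)"
      using card \<eta> D by (intro mult_mono power_increasing add_left_mono mult_right_mono) auto
    finally show ?thesis .
  qed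
  have "(E (\<lambda>B. \<bar>Z A W B\<bar> * b B))\<^sup>2 \<le> E (\<lambda>B. \<bar>Z A W B\<bar>\<^sup>2) * E (\<lambda>B. (b B)\<^sup>2)"
    by (rule E_cauchy_schwarz)
  also have "\<dots> = E (\<lambda>B. (Z A W B)\<^sup>2) * E b"
  proof -
    have "(\<lambda>B. (b B)\<^sup>2) = b" by (auto simp: b_def)
    then show ?thesis by simp
  qed
  also have "\<dots> \<le> ((1 + \<eta>) ^ q * (1 + q * D)) * (q * p)"
    using EZ2 Eb \<eta> D p by (intro mult_mono E_nonneg) (auto simp: b_def)
  also have "\<dots> \<le> (1 / 2)\<^sup>2" using small by (simp add: D_def p_def power2_eq_square)
  finally have half: "E (\<lambda>B. \<bar>Z A W B\<bar> * b B) \<le> 1 / 2" by (rule power2_le_imp_le) simp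
  have "E (\<lambda>B. \<bar>Z A W B\<bar>) \<le> E (\<lambda>B. Z A W B + 2 * (\<bar>Z A W B\<bar> * b B))"
  proof (rule E_mono)
    fix B
    show "\<bar>Z A W B\<bar> \<le> Z A W B + 2 * (\<bar>Z A W B\<bar> * b B)"
    proof (cases "\<exists>t\<in>W. 1 < \<bar>\<rho> * F (A t) B\<bar>")
      case True
      then show ?thesis by (simp add: b_def)
    next
      case False
      then have "0 \<le> Z A W B" unfolding Z_def by (intro prod_nonneg) force
      then show ?thesis by (simp add: b_def)
    qed
  qed
  also have "\<dots> = 1 + 2 * E (\<lambda>B. \<bar>Z A W B\<bar> * b B)"
    unfolding E_add E_cmult using E_Z[OF fin] by simp
  finally show ?thesis using half by simp
qed

text \<open>Where \<open>X\<close> is at most \<open>y\<close> it is pulled out and the L1 norm of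
  the Riesz product remains; the sup bound \<open>C\<close> for the whole product is spent only on
  the rare event.\<close>

lemma E_core_Z:
  assumes "W \<subseteq> {..<q}" "tail X y p" "\<And>B. \<bar>X B * Z A W B\<bar> \<le> C" "0 \<le> y" "0 \<le> C"
  shows "E (\<lambda>B. \<bar>X B * Z A W B\<bar>) \<le> 2 * y + C * p"
proof -
  have "E (\<lambda>B. \<bar>X B * Z A W B\<bar>) \<le> E (\<lambda>B. y * \<bar>Z A W B\<bar> + C * of_bool (y < \<bar>X B\<bar>))"
  proof (rule E_mono)
    fix B
    show "\<bar>X B * Z A W B\<bar> \<le> y * \<bar>Z A W B\<bar> + C * of_bool (y < \<bar>X B\<bar>)"
    proof (cases "y < \<bar>X B\<bar>")
      case True
      then show ?thesis using assms(3)[of B] assms(4) by (simp add: add_increasing)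
    next
      case False
      then show ?thesis by (simp add: abs_mult mult_right_mono)
    qed
  qed
  also have "\<dots> = y * E (\<lambda>B. \<bar>Z A W B\<bar>) + C * Pr (\<lambda>B. y < \<bar>X B\<bar>)"
    unfolding Pr_def E_add E_cmult ..
  also have "\<dots> \<le> y * 2 + C * p"
    using assms E_abs_Z[OF assms(1)] by (intro add_mono mult_left_mono) (auto simp: tail_def)
  finally show ?thesis by simp
qed

end

end

section \<open>Coincidences\<close>

type_synonym tuple = "nat \<Rightarrow> (3 \<Rightarrow> nat) option"

context riesz
begin

text \<open>A tuple picks at most one vector from each block, so that the sum \<open>psum\<close> over all tuples is the
  expanded Riesz product, and product sets of tuples give products again.\<close>

definition wt :: "(3 \<Rightarrow> nat) option \<Rightarrow> bits \<Rightarrow> real" where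
  "wt z B = (case z of None \<Rightarrow> 1 | Some r \<Rightarrow> \<rho> * f r B)"

definition full :: "nat \<Rightarrow> (3 \<Rightarrow> nat) option set" where
  "full t = insert None (Some ` block t)"

abbreviation Tup :: "(nat \<Rightarrow> (3 \<Rightarrow> nat) option set) \<Rightarrow> tuple set" where
  "Tup S \<equiv> Pi\<^sub>E {..<q} S"

definition prd :: "tuple \<Rightarrow> bits \<Rightarrow> real" where
  "prd T B = (\<Prod>t<q. wt (T t) B)"

definition psum :: "tuple set \<Rightarrow> bits \<Rightarrow> real" where
  "psum X B = (\<Sum>T\<in>X. prd T B)"

text \<open>\<open>V\<close> collects the blocks at which a vector is compulsory. Elsewhere
  \<open>None\<close> stays available, so the sum over choices still has the form
  \<open>1 + \<rho> * F\<close> and these blocks form a Riesz product to which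
  \<open>E_abs_Z\<close> applies.\<close>

definition admissible :: "(nat \<Rightarrow> (3 \<Rightarrow> nat) option set) \<Rightarrow> nat set \<Rightarrow> bool" where
  "admissible S V \<longleftrightarrow> V \<subseteq> {..<q} \<and> (\<forall>t. S t \<subseteq> full t) \<and> (\<forall>t<q. None \<in> S t \<longleftrightarrow> t \<notin> V)"

definition vs :: "(nat \<Rightarrow> (3 \<Rightarrow> nat) option set) \<Rightarrow> nat \<Rightarrow> (3 \<Rightarrow> nat) set" where
  "vs S t = {r. Some r \<in> S t}"

lemma finite_block [simp]: "finite (block t)"
  by (rule finite_subset[OF _ finite_L]) (auto simp: block_def)

lemma finite_full [simp]: "finite (full t)"
  by (simp add: full_def)

lemma admissible_finite: "admissible S V \<Longrightarrow> finite (S t)"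
  by (rule finite_subset[OF _ finite_full]) (auto simp: admissible_def)

lemma admissible_finite_Tup: "admissible S V \<Longrightarrow> finite (Tup S)"
  by (intro finite_PiE) (auto intro: admissible_finite)

lemma admissible_Tup_full: "admissible S V \<Longrightarrow> Tup S \<subseteq> Tup full"
  by (intro PiE_mono) (auto simp: admissible_def)

lemma admissible_finite_V: "admissible S V \<Longrightarrow> finite V"
  by (auto simp: admissible_def intro: finite_subset)

lemma admissible_card: "admissible S V \<Longrightarrow> card V \<le> q"
  using card_mono[of "{..<q}" V] by (simp add: admissible_def)

lemma vs_block: "admissible S V \<Longrightarrow> vs S t \<subseteq> block t"
  by (auto simp: vs_def admissible_def full_def)

lemma admissible_full: "admissible full {}"
  by (auto simp: admissible_def full_def)

lemma admissible_Some:
  assumes "admissible S V" "T \<in> Tup S" "t \<in> V"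
  shows "\<exists>r. T t = Some r \<and> r \<in> vs S t"
proof -
  have "t < q" "T t \<in> S t" "None \<notin> S t" using assms by (auto simp: admissible_def)
  then show ?thesis by (cases "T t") (auto simp: vs_def)
qed

lemma sum_wt:
  assumes "admissible S V" "t < q"
  shows "(\<Sum>z\<in>S t. wt z B) = (if t \<in> V then 0 else 1) + \<rho> * F (vs S t) B"
proof -
  have S: "S t = (if t \<in> V then {} else {None}) \<union> Some ` vs S t"
  proof (intro set_eqI)
    fix z
    show "z \<in> S t \<longleftrightarrow> z \<in> (if t \<in> V then {} else {None}) \<union> Some ` vs S t"
      using assms by (cases z) (auto simp: admissible_def vs_def)
  qed
  have fin: "finite (vs S t)" using vs_block[OF assms(1)] finite_block by (rule finite_subset)
  have "(\<Sum>z\<in>S t. wt z B) = (\<Sum>z\<in>(if t \<in> V then {} else {None}). wt z B) + (\<Sum>z\<in>Some ` vs S t. wt z B)"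
    using fin by (subst S, subst sum.union_disjoint) auto
  also have "(\<Sum>z\<in>Some ` vs S t. wt z B) = \<rho> * F (vs S t) B"
    by (simp add: sum.reindex wt_def F_def sum_distrib_left)
  finally show ?thesis by (simp add: wt_def)
qed

lemma psum_Tup:
  assumes "admissible S V"
  shows "psum (Tup S) B = (\<Prod>t\<in>V. \<rho> * F (vs S t) B) * Z (vs S) ({..<q} - V) B"
proof -
  have V: "V \<subseteq> {..<q}" using assms by (simp add: admissible_def)
  have "psum (Tup S) B = (\<Prod>t<q. \<Sum>z\<in>S t. wt z B)"
    unfolding psum_def prd_def using admissible_finite[OF assms] by (subst prod_sum_PiE) auto
  also have "\<dots> = (\<Prod>t<q. (if t \<in> V then 0 else 1) + \<rho> * F (vs S t) B)"
    using sum_wt[OF assms] by (intro prod.cong) auto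
  also have "\<dots> = (\<Prod>t\<in>V. (if t \<in> V then 0 else 1) + \<rho> * F (vs S t) B) *
       (\<Prod>t\<in>{..<q} - V. (if t \<in> V then 0 else 1) + \<rho> * F (vs S t) B)"
    using V by (subst prod.subset_diff[of V]) (auto simp: mult.commute)
  finally show ?thesis by (simp add: Z_def)
qed

text \<open>The crude bound spent on rare events. It is valid for every set of tuples: absolute
  values are taken first, after which the sum over all tuples factorises.\<close>

lemma psum_le:
  assumes "X \<subseteq> Tup full"
  shows "\<bar>psum X B\<bar> \<le> M ^ q"
proof -
  have "\<bar>psum X B\<bar> \<le> (\<Sum>T\<in>X. \<bar>prd T B\<bar>)" unfolding psum_def by (rule sum_abs)
  also have "\<dots> \<le> (\<Sum>T\<in>Tup full. \<bar>prd T B\<bar>)"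
    using assms admissible_finite_Tup[OF admissible_full] by (intro sum_mono2) auto
  also have "\<dots> = (\<Prod>t<q. \<Sum>z\<in>full t. \<bar>wt z B\<bar>)"
    unfolding prd_def abs_prod by (subst prod_sum_PiE) auto
  also have "\<dots> \<le> (\<Prod>t<q. M)"
  proof (intro prod_mono conjI sum_nonneg)
    fix t
    have bl: "block t \<subseteq> L" by (auto simp: block_def)
    have "(\<Sum>z\<in>full t. \<bar>wt z B\<bar>) = 1 + (\<Sum>r\<in>block t. \<bar>\<rho> * f r B\<bar>)"
      unfolding full_def by (subst sum.insert) (auto simp: sum.reindex wt_def)
    also have "(\<Sum>r\<in>block t. \<bar>\<rho> * f r B\<bar>) \<le> (\<Sum>r\<in>block t. \<rho>)"
    proof (rule sum_mono)
      fix r assume "r \<in> block t"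
      then have "\<bar>f r B\<bar> \<le> 1" using bl by (intro f_le1) auto
      then show "\<bar>\<rho> * f r B\<bar> \<le> \<rho>" using \<rho> by (simp add: abs_mult mult_left_le)
    qed
    also have "\<dots> \<le> \<rho> * N\<^sup>2" using card_subset_L[OF bl] \<rho> by (simp add: mult.commute)
    finally show "(\<Sum>z\<in>full t. \<bar>wt z B\<bar>) \<le> M" by simp
  qed auto
  finally show ?thesis by simp
qed

abbreviation nrm :: "tuple set \<Rightarrow> real" where
  "nrm X \<equiv> E (\<lambda>B. \<bar>psum X B\<bar>)"

lemma E_psum_sum_le:
  assumes "finite I" "\<And>B. \<bar>G B\<bar> \<le> (\<Sum>i\<in>I. \<bar>psum (X i) B\<bar>)" "\<And>i. i \<in> I \<Longrightarrow> nrm (X i) \<le> c i"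
  shows "E (\<lambda>B. \<bar>G B\<bar>) \<le> (\<Sum>i\<in>I. c i)"
proof -
  have "E (\<lambda>B. \<bar>G B\<bar>) \<le> E (\<lambda>B. \<Sum>i\<in>I. \<bar>psum (X i) B\<bar>)" using assms(2) by (rule E_mono)
  also have "\<dots> = (\<Sum>i\<in>I. nrm (X i))" by (rule E_sum)
  also have "\<dots> \<le> (\<Sum>i\<in>I. c i)" using assms(3) by (rule sum_mono)
  finally show ?thesis .
qed

lemma E_psum_core:
  assumes "admissible S V" "X \<subseteq> Tup full"
    "\<And>B. psum X B = core B * Z (vs S) ({..<q} - V) B" "tail core y p" "0 \<le> y"
  shows "nrm X \<le> 2 * y + M ^ q * p"
  using E_core_Z[where A = "vs S" and W = "{..<q} - V" and X = core, OF vs_block[OF assms(1)] _ assms(4) _ assms(5), of "M ^ q"]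
    psum_le[OF assms(2)] M_ge1 by (simp add: assms(3))

lemma E_psum_Tup:
  fixes p :: real
  assumes "admissible S V" "\<And>t. t \<in> V \<Longrightarrow> tail (\<lambda>B. \<rho> * F (vs S t) B) (b t) p" "\<And>t. t \<in> V \<Longrightarrow> 0 \<le> b t" "0 \<le> p"
  shows "nrm (Tup S) \<le> 2 * (\<Prod>t\<in>V. b t) + M ^ q * (q * p)"
proof (rule E_psum_core[OF assms(1) admissible_Tup_full[OF assms(1)] psum_Tup[OF assms(1)]])
  have "tail (\<lambda>B. \<Prod>t\<in>V. \<rho> * F (vs S t) B) (\<Prod>t\<in>V. b t) (card V * p)"
    using assms(2) by (intro tail_prod admissible_finite_V[OF assms(1)])
  then show "tail (\<lambda>B. \<Prod>t\<in>V. \<rho> * F (vs S t) B) (\<Prod>t\<in>V. b t) (q * p)"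
    by (rule tail_mono) (use admissible_card[OF assms(1)] assms(4) in \<open>auto intro!: mult_right_mono\<close>)
qed (use assms(3) in \<open>auto intro: prod_nonneg\<close>)

text \<open>In coordinate \<open>c\<close>, the levels are grouped into coarse blocks of length \<open>w\<close>. The set
  \<open>topset c T\<close> collects the entries of \<open>T\<close> in the highest occupied coarse block; the tuples with
  prescribed \<open>topset\<close> and prescribed highest block form a product set \<open>pat\<close>.\<close>

definition topset :: "3 \<Rightarrow> tuple \<Rightarrow> nat set" where
  "topset c T = {t. t < q \<and> T t \<noteq> None \<and> (\<forall>s<q. T s \<noteq> None \<longrightarrow> the (T s) c div w \<le> the (T t) c div w)}"

definition pat :: "3 \<Rightarrow> nat \<Rightarrow> nat set \<Rightarrow> (nat \<Rightarrow> (3 \<Rightarrow> nat) option set) \<Rightarrow> nat \<Rightarrow> (3 \<Rightarrow> nat) option set" where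
  "pat c \<beta> U S t = {z \<in> S t. case z of None \<Rightarrow> t \<notin> U | Some r \<Rightarrow> (if t \<in> U then r c div w = \<beta> else r c div w < \<beta>)}"

abbreviation pat2 :: "nat \<Rightarrow> nat set \<Rightarrow> nat \<Rightarrow> nat set \<Rightarrow> nat \<Rightarrow> (3 \<Rightarrow> nat) option set" where
  "pat2 \<beta> U \<beta>' U' \<equiv> pat 3 \<beta>' U' (pat 2 \<beta> U full)"

lemma pat_subset: "pat c \<beta> U S t \<subseteq> S t"
  by (auto simp: pat_def)

lemma admissible_pat: "admissible S V \<Longrightarrow> U \<subseteq> {..<q} \<Longrightarrow> admissible (pat c \<beta> U S) (V \<union> U)"
  unfolding admissible_def using pat_subset by (auto simp: pat_def)

lemma vs_pat: "t \<in> U \<Longrightarrow> r \<in> vs (pat c \<beta> U S) t \<Longrightarrow> r c div w = \<beta>"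
  "t \<notin> U \<Longrightarrow> r \<in> vs (pat c \<beta> U S) t \<Longrightarrow> r c div w < \<beta>"
  "vs (pat c \<beta> U S) t \<subseteq> vs S t"
  by (auto simp: vs_def pat_def)

lemma topset_subset: "topset c T \<subseteq> {..<q}"
  by (auto simp: topset_def)

lemma topset_nonempty:
  assumes "t < q" "T t \<noteq> None"
  shows "topset c T \<noteq> {}"
proof -
  define X where "X = (\<lambda>t. the (T t) c div w) ` {t. t < q \<and> T t \<noteq> None}"
  have X: "finite X" "X \<noteq> {}" using assms by (auto simp: X_def)
  then have "Max X \<in> X" by simp
  then obtain t0 where t0: "t0 < q" "T t0 \<noteq> None" "Max X = the (T t0) c div w" by (auto simp: X_def)
  have "t0 \<in> topset c T" unfolding topset_def
    using t0 Max_ge[OF X(1)] by (auto simp: X_def)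
  then show ?thesis by blast
qed

lemma Tup_pat_iff:
  assumes "U \<subseteq> {..<q}" "U \<noteq> {}"
  shows "T \<in> Tup (pat c \<beta> U S) \<longleftrightarrow> T \<in> Tup S \<and> topset c T = U \<and> (\<forall>t\<in>U. the (T t) c div w = \<beta>)"
proof
  assume T: "T \<in> Tup (pat c \<beta> U S)"
  then have T1: "T t \<in> pat c \<beta> U S t" if "t < q" for t using that by auto
  have U: "T t \<noteq> None \<and> the (T t) c div w = \<beta>" if "t \<in> U" for t
    using T1[of t] that assms by (auto simp: pat_def split: option.splits)
  have nU: "the (T t) c div w < \<beta>" if "t < q" "t \<notin> U" "T t \<noteq> None" for t
    using T1[of t] that by (auto simp: pat_def)
  have le: "the (T t) c div w \<le> \<beta>" if "t < q" "T t \<noteq> None" for t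
    using U[of t] nU[of t] that by (cases "t \<in> U") auto
  obtain u where u: "u \<in> U" using assms by auto
  have "topset c T = U"
  proof
    show "U \<subseteq> topset c T" using U le assms by (auto simp: topset_def)
    show "topset c T \<subseteq> U"
    proof
      fix t assume t: "t \<in> topset c T"
      have "the (T u) c div w \<le> the (T t) c div w"
        using t u U[OF u] assms by (auto simp: topset_def)
      then show "t \<in> U" using nU[of t] t U[OF u] by (auto simp: topset_def)
    qed
  qed
  moreover have "T \<in> Tup S" using T PiE_mono[of "{..<q}" "pat c \<beta> U S" S] pat_subset by blast
  ultimately show "T \<in> Tup S \<and> topset c T = U \<and> (\<forall>t\<in>U. the (T t) c div w = \<beta>)" using U by auto
next
  assume T: "T \<in> Tup S \<and> topset c T = U \<and> (\<forall>t\<in>U. the (T t) c div w = \<beta>)"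
  obtain u where u: "u \<in> U" using assms by auto
  have "T t \<in> pat c \<beta> U S t" if t: "t < q" for t
  proof -
    have TS: "T t \<in> S t" using T t by (simp add: PiE_iff)
    show ?thesis
    proof (cases "T t")
      case None
      then have "t \<notin> U" using T by (auto simp: topset_def)
      then show ?thesis using None TS by (simp add: pat_def)
    next
      case (Some r)
      have "r c div w < \<beta>" if "t \<notin> U"
      proof -
        have "t \<notin> topset c T" using that T by simp
        then obtain s where s: "s < q" "T s \<noteq> None" "r c div w < the (T s) c div w"
          using Some t by (auto simp: topset_def not_le)
        have "u \<in> topset c T" "the (T u) c div w = \<beta>" using u T by auto
        then show ?thesis using s by (auto simp: topset_def)
      qed
      then show ?thesis using Some T t TS by (auto simp: pat_def)
    qed
  qed
  then show "T \<in> Tup (pat c \<beta> U S)" using T by (auto simp: PiE_iff)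
qed

text \<open>The product sets \<open>Tup (pat c \<beta> U S)\<close> with nonempty \<open>U\<close>
  are disjoint, since a tuple determines its top set and top block. The extra filter
  \<open>X\<close> allows the decomposition to be repeated in another coordinate; excluding
  \<open>{}\<close> sets aside the tuple without entries, which has no top block.\<close>

lemma psum_topset:
  assumes adm: "admissible S V" and Q: "\<not> Q {}"
  shows "psum {T \<in> Tup S. Q (topset c T) \<and> X T} B =
    (\<Sum>i\<in>{U. U \<subseteq> {..<q} \<and> U \<noteq> {} \<and> Q U} \<times> {..<J}. psum {T \<in> Tup (pat c (snd i) (fst i) S). X T} B)"
proof -
  let ?I = "{U. U \<subseteq> {..<q} \<and> U \<noteq> {} \<and> Q U} \<times> {..<J}"
  have "finite {U. U \<subseteq> {..<q} \<and> U \<noteq> {} \<and> Q U}"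
    by (rule finite_subset[of _ "Pow {..<q}"]) auto
  then have fin: "finite ?I" by simp
  have finT: "finite {T \<in> Tup (pat c (snd i) (fst i) S). X T}" if "i \<in> ?I" for i
  proof -
    have "finite (Tup (pat c (snd i) (fst i) S))"
      using that by (intro admissible_finite_Tup[OF admissible_pat[OF adm]]) auto
    then show ?thesis by simp
  qed
  have eq: "{T \<in> Tup S. Q (topset c T) \<and> X T} = (\<Union>i\<in>?I. {T \<in> Tup (pat c (snd i) (fst i) S). X T})"
  proof (intro set_eqI iffI)
    fix T assume T: "T \<in> {T \<in> Tup S. Q (topset c T) \<and> X T}"
    define U where "U = topset c T"
    have U: "U \<subseteq> {..<q}" "U \<noteq> {}" "Q U" using T Q topset_subset by (auto simp: U_def)
    then obtain u where u: "u \<in> U" by auto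
    define \<beta> where "\<beta> = the (T u) c div w"
    have same: "the (T t) c div w = \<beta>" if "t \<in> U" for t
    proof (rule antisym)
      show "the (T t) c div w \<le> \<beta>" "\<beta> \<le> the (T t) c div w"
        using that u by (simp_all add: U_def \<beta>_def topset_def)
    qed
    have "u < q" "T \<in> Tup S" using u U T by auto
    then have "T u \<in> S u" by (auto elim: PiE_mem)
    moreover have "T u \<noteq> None" using u by (simp add: U_def topset_def)
    ultimately
    obtain r where r: "T u = Some r" "r \<in> vs S u" by (auto simp: vs_def)
    then have "r \<in> L" using vs_block[OF adm] by (auto simp: block_def)
    then have "r c < J * w" using L_le[of r c] Jw by linarith
    then have "\<beta> < J" using r by (simp add: \<beta>_def less_mult_imp_div_less)
    then have "(U, \<beta>) \<in> ?I" using U by simp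
    moreover have "T \<in> Tup (pat c \<beta> U S)"
      using T same by (subst Tup_pat_iff[OF U(1,2)]) (auto simp: U_def)
    ultimately show "T \<in> (\<Union>i\<in>?I. {T \<in> Tup (pat c (snd i) (fst i) S). X T})"
      using T by (intro UN_I[of "(U, \<beta>)"]) simp_all
  next
    fix T assume "T \<in> (\<Union>i\<in>?I. {T \<in> Tup (pat c (snd i) (fst i) S). X T})"
    then obtain i where i: "i \<in> ?I" "T \<in> {T \<in> Tup (pat c (snd i) (fst i) S). X T}" by (rule UN_E)
    then have i: "i \<in> ?I" "T \<in> Tup (pat c (snd i) (fst i) S)" "X T" by simp_all
    then have fi: "fst i \<subseteq> {..<q}" "fst i \<noteq> {}" "Q (fst i)" by (simp_all add: mem_Times_iff)
    have "T \<in> Tup S" "topset c T = fst i"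
      using i(2) unfolding Tup_pat_iff[OF fi(1,2)] by simp_all
    then show "T \<in> {T \<in> Tup S. Q (topset c T) \<and> X T}" using fi(3) i(3) by simp
  qed
  show ?thesis unfolding psum_def eq
  proof (rule sum.UNION_disjoint[OF fin])
    show "\<forall>i\<in>?I. finite {T \<in> Tup (pat c (snd i) (fst i) S). X T}" using finT by blast
    show "\<forall>i\<in>?I. \<forall>j\<in>?I. i \<noteq> j \<longrightarrow> {T \<in> Tup (pat c (snd i) (fst i) S). X T} \<inter> {T \<in> Tup (pat c (snd j) (fst j) S). X T} = {}"
    proof (intro ballI impI)
      fix i j assume i: "i \<in> ?I" and j: "j \<in> ?I" and ij: "i \<noteq> j"
      have "i = j" if "T \<in> Tup (pat c (snd i) (fst i) S)" "T \<in> Tup (pat c (snd j) (fst j) S)" for T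
      proof -
        have fi: "fst i \<subseteq> {..<q}" "fst i \<noteq> {}" and fj: "fst j \<subseteq> {..<q}" "fst j \<noteq> {}"
          using i j by (simp_all add: mem_Times_iff)
        have Ti: "topset c T = fst i" "\<forall>t\<in>fst i. the (T t) c div w = snd i"
          using that(1) unfolding Tup_pat_iff[OF fi] by blast+
        have Tj: "topset c T = fst j" "\<forall>t\<in>fst j. the (T t) c div w = snd j"
          using that(2) unfolding Tup_pat_iff[OF fj] by blast+
        have "fst i = fst j" using Ti Tj by simp
        moreover obtain t where "t \<in> fst i" using fi by blast
        ultimately have "snd i = snd j" using Ti(2) Tj(2) by fastforce
        then show ?thesis using \<open>fst i = fst j\<close> by (rule prod_eqI[rotated])
      qed
      then show "{T \<in> Tup (pat c (snd i) (fst i) S). X T} \<inter> {T \<in> Tup (pat c (snd j) (fst j) S). X T} = {}"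
        using ij by blast
    qed
  qed
qed

section \<open>Tail bounds for entries in one coarse block\<close>

definition xb :: real where "xb = \<rho> * k * sqrt (w * N)"

text \<open>Four factors of the trivial size \<open>\<rho> * k * N\<close>, times Beck's gain in the
  form \<open>N^(1/4) / N^(1/2)\<close>; the 2 comes from \<open>beck_gain\<close>. Four is the
  largest number of blocks in two top sets of at most two elements.\<close>

definition yb :: real where "yb = 2 * (\<rho> * k * N) ^ 4 * sqrt (sqrt N) / sqrt N"

lemma xb_nonneg: "0 \<le> xb" and yb_nonneg: "0 \<le> yb"
  using \<rho> k by (simp_all add: xb_def yb_def)

lemma card_coarse: "finite X \<Longrightarrow> (\<And>m. m \<in> X \<Longrightarrow> m div w = \<beta>) \<Longrightarrow> card X \<le> w"
proof -
  assume X: "finite X" "\<And>m. m \<in> X \<Longrightarrow> m div w = \<beta>"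
  have "X \<subseteq> {\<beta> * w..<\<beta> * w + w}"
  proof
    fix m assume "m \<in> X"
    then have "m = \<beta> * w + m mod w" using X(2) by (metis div_mult_mod_eq)
    then show "m \<in> {\<beta> * w..<\<beta> * w + w}" using mod_less_divisor[OF w_pos, of m] by simp
  qed
  then have "card X \<le> card {\<beta> * w..<\<beta> * w + w}" by (intro card_mono) auto
  then show ?thesis by simp
qed

lemma card_coord: "A \<subseteq> L \<Longrightarrow> real (card ((\<lambda>r. r i) ` A)) \<le> N"
proof -
  assume "A \<subseteq> L"
  then have "card ((\<lambda>r. r i) ` A) \<le> card {..n}" using L_le by (intro card_mono) auto
  then show ?thesis by simp
qed

lemma tail_coarse1:
  assumes "A \<subseteq> L" "c \<noteq> 1" "\<And>r. r \<in> A \<Longrightarrow> r c div w = \<beta>"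
  shows "tail (\<lambda>B. \<rho> * F A B) xb ((N + 1) * p0)"
proof -
  have fin: "finite A" using assms(1) finite_L by (rule finite_subset)
  obtain l where l: "distinct [c, 1, l]"
    using assms(2) exhaust_3[of c] that[of 2] that[of 3] by auto
  have "card ((\<lambda>r. r c) ` A) \<le> w" using fin assms(3) by (intro card_coarse) auto
  then have "tail (F A) (k * sqrt (w * N)) ((N + 1) * p0)"
    using card_coord[OF assms(1)] w_pos by (intro F_tail[OF l assms(1)]) auto
  moreover have "\<bar>\<rho>\<bar> * (k * sqrt (w * N)) = xb" using \<rho> by (simp add: xb_def)
  ultimately show ?thesis using tail_cmult[of "F A" "k * sqrt (w * N)" "(N + 1) * p0" \<rho>] by (simp only:)
qed

text \<open>A block lying in both top sets has to count twice. Restricting both coordinates yields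
  \<open>\<rho> * (k * w)\<close>, and \<open>big\<close> converts this into \<open>xb * xb\<close>,
  which lets the bounds multiply as if the top sets were disjoint.\<close>

lemma tail_coarse2:
  assumes "A \<subseteq> L" "distinct [c, c', 1]" "\<And>r. r \<in> A \<Longrightarrow> r c div w = \<beta>" "\<And>r. r \<in> A \<Longrightarrow> r c' div w = \<beta>'"
    and big: "1 \<le> \<rho> * k * N"
  shows "tail (\<lambda>B. \<rho> * F A B) (xb * xb) ((N + 1) * p0)"
proof -
  have fin: "finite A" using assms(1) finite_L by (rule finite_subset)
  have "card ((\<lambda>r. r c) ` A) \<le> w" "card ((\<lambda>r. r c') ` A) \<le> w"
    using fin assms by (auto intro!: card_coarse)
  then have "tail (F A) (k * sqrt (real w * w)) ((N + 1) * p0)"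
    using w_pos by (intro F_tail[OF assms(2,1)]) auto
  then have "tail (\<lambda>B. \<rho> * F A B) (\<rho> * (k * w)) ((N + 1) * p0)"
    using tail_cmult[of "F A" _ _ \<rho>] \<rho> by simp
  moreover have "\<rho> * (k * w) \<le> xb * xb"
  proof -
    have "\<rho> * (k * w) * 1 \<le> \<rho> * (k * w) * (\<rho> * k * N)"
      using big \<rho> k by (intro mult_left_mono) auto
    also have "\<dots> = (\<rho> * k) * (\<rho> * k) * (sqrt (w * N) * sqrt (w * N))" by simp
    also have "\<dots> = xb * xb" unfolding xb_def by (simp only: ac_simps)
    finally show ?thesis by simp
  qed
  ultimately show ?thesis using tail_mono by blast
qed

lemma E_pat1:
  assumes "U \<subseteq> {..<q}" "c \<noteq> 1"
  shows "nrm (Tup (pat c \<beta> U full)) \<le> 2 * xb ^ card U + M ^ q * (q * ((N + 1) * p0))"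
proof -
  have adm: "admissible (pat c \<beta> U full) U" using admissible_pat[OF admissible_full assms(1)] by simp
  have "nrm (Tup (pat c \<beta> U full)) \<le> 2 * (\<Prod>t\<in>U. xb) + M ^ q * (q * ((N + 1) * p0))"
  proof (rule E_psum_Tup[OF adm])
    show "tail (\<lambda>B. \<rho> * F (vs (pat c \<beta> U full) t) B) xb ((N + 1) * p0)" if "t \<in> U" for t
      by (rule tail_coarse1[OF block_subset[OF vs_block[OF adm]] assms(2)]) (erule vs_pat(1)[OF that])
  qed (use xb_nonneg p0_pos in auto)
  then show ?thesis by simp
qed

lemma E_pat2:
  assumes "U \<subseteq> {..<q}" "U' \<subseteq> {..<q}" and big: "1 \<le> \<rho> * k * N"
  shows "nrm (Tup (pat2 \<beta> U \<beta>' U'))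
    \<le> 2 * (xb ^ card U * xb ^ card U') + M ^ q * (q * ((N + 1) * p0))"
proof -
  let ?S = "pat2 \<beta> U \<beta>' U'"
  have adm: "admissible ?S (U \<union> U')"
    using admissible_pat[OF admissible_pat[OF admissible_full assms(1)] assms(2)] by simp
  define b where "b t = (if t \<in> U then xb else 1) * (if t \<in> U' then xb else 1)" for t
  have fin: "finite U" "finite U'" using assms finite_subset by auto
  have "nrm (Tup ?S) \<le> 2 * (\<Prod>t\<in>U \<union> U'. b t) + M ^ q * (q * ((N + 1) * p0))"
  proof (rule E_psum_Tup[OF adm])
    fix t assume t: "t \<in> U \<union> U'"
    have U: "r 2 div w = \<beta>" if "t \<in> U" "r \<in> vs ?S t" for r
      using that(2) vs_pat(3)[of 3 \<beta>' U' "pat 2 \<beta> U full" t] by (intro vs_pat(1)[OF that(1)]) (rule subsetD)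
    have U': "r 3 div w = \<beta>'" if "t \<in> U'" "r \<in> vs ?S t" for r
      by (rule vs_pat(1)[OF that])
    note L = block_subset[OF vs_block[OF adm, of t]]
    show "tail (\<lambda>B. \<rho> * F (vs ?S t) B) (b t) ((N + 1) * p0)"
    proof (cases "t \<in> U \<and> t \<in> U'")
      case True
      then show ?thesis using tail_coarse2[OF L, of 2 3 \<beta> \<beta>'] U U' big by (simp add: b_def)
    next
      case False
      then show ?thesis
        using t tail_coarse1[OF L, of 2 \<beta>] tail_coarse1[OF L, of 3 \<beta>'] U U' by (auto simp: b_def)
    qed
  qed (use xb_nonneg p0_pos in \<open>auto simp: b_def\<close>)
  moreover have "(\<Prod>t\<in>U \<union> U'. b t) = xb ^ card U * xb ^ card U'"
    unfolding b_def prod.distrib using fin by (simp add: prod.If_cases Int_absorb1 Int_absorb2)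
  ultimately show ?thesis by simp
qed

section \<open>Entries with exactly equal levels\<close>

definition eqs :: "3 \<Rightarrow> nat set \<Rightarrow> tuple \<Rightarrow> bool" where
  "eqs c U T \<longleftrightarrow> (\<forall>s\<in>U. \<forall>t\<in>U. the (T s) c = the (T t) c)"

definition fixc :: "3 \<Rightarrow> nat \<Rightarrow> (3 \<Rightarrow> nat) set \<Rightarrow> (3 \<Rightarrow> nat) set" where
  "fixc c m A = {r \<in> A. r c = m}"

definition fixS :: "nat set \<Rightarrow> 3 \<Rightarrow> nat \<Rightarrow> (nat \<Rightarrow> (3 \<Rightarrow> nat) option set) \<Rightarrow> nat \<Rightarrow> (3 \<Rightarrow> nat) option set" where
  "fixS U c m S t = {z \<in> S t. t \<in> U \<longrightarrow> the z c = m}"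

lemma admissible_fixS: "admissible S V \<Longrightarrow> U \<subseteq> V \<Longrightarrow> admissible (fixS U c m S) V"
  by (auto simp: admissible_def fixS_def)

lemma vs_fixS: "vs (fixS U c m S) t = (if t \<in> U then fixc c m (vs S t) else vs S t)"
  by (auto simp: vs_def fixS_def fixc_def)

lemma Tup_fixS_iff:
  assumes "U \<subseteq> {..<q}"
  shows "T \<in> Tup (fixS U c m S) \<longleftrightarrow> T \<in> Tup S \<and> (\<forall>t\<in>U. the (T t) c = m)"
proof -
  have "t < q" if "t \<in> U" for t using assms that by auto
  then show ?thesis by (auto simp: PiE_iff fixS_def)
qed

text \<open>The common level \<open>m\<close> is summed exactly and not with absolute values,
  because cancellation between different \<open>m\<close> is what Beck's gain exploits.\<close>

lemma psum_eqs:
  assumes adm: "admissible S V" and U: "U \<subseteq> V" "U \<noteq> {}"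
  shows "psum {T \<in> Tup S. eqs c U T \<and> X T} B = (\<Sum>m\<le>n. psum {T \<in> Tup (fixS U c m S). X T} B)"
proof -
  have Uq: "U \<subseteq> {..<q}" using adm U by (auto simp: admissible_def)
  obtain u where u: "u \<in> U" using U by auto
  have eq: "{T \<in> Tup S. eqs c U T \<and> X T} = (\<Union>m\<in>{..n}. {T \<in> Tup (fixS U c m S). X T})"
  proof (intro set_eqI iffI)
    fix T assume T: "T \<in> {T \<in> Tup S. eqs c U T \<and> X T}"
    have "u \<in> V" using u U by auto
    then obtain r where r: "T u = Some r" "r \<in> vs S u" using admissible_Some[OF adm, of T u] T by auto
    have "r \<in> L" using r vs_block[OF adm] block_subset by blast
    then have "r c \<in> {..n}" using L_le by simp
    moreover have "\<forall>t\<in>U. the (T t) c = r c"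
      using T u r unfolding eqs_def by (metis (mono_tags, lifting) mem_Collect_eq option.sel)
    then have "T \<in> Tup (fixS U c (r c) S)" using T unfolding Tup_fixS_iff[OF Uq] by simp
    ultimately show "T \<in> (\<Union>m\<in>{..n}. {T \<in> Tup (fixS U c m S). X T})"
      using T by (intro UN_I[of "r c"]) simp_all
  next
    fix T assume "T \<in> (\<Union>m\<in>{..n}. {T \<in> Tup (fixS U c m S). X T})"
    then obtain m where "T \<in> {T \<in> Tup (fixS U c m S). X T}" by (rule UN_E)
    then have "T \<in> Tup (fixS U c m S)" "X T" by simp_all
    then show "T \<in> {T \<in> Tup S. eqs c U T \<and> X T}" unfolding Tup_fixS_iff[OF Uq] by (simp add: eqs_def)
  qed
  show ?thesis unfolding psum_def eq
  proof (rule sum.UNION_disjoint)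
    show "\<forall>m\<in>{..n}. finite {T \<in> Tup (fixS U c m S). X T}"
      using admissible_finite_Tup[OF admissible_fixS[OF adm U(1)]] by simp
    show "\<forall>m\<in>{..n}. \<forall>m'\<in>{..n}. m \<noteq> m' \<longrightarrow> {T \<in> Tup (fixS U c m S). X T} \<inter> {T \<in> Tup (fixS U c m' S). X T} = {}"
      unfolding Tup_fixS_iff[OF Uq] using u by auto
  qed simp
qed

lemma tail_fix1:
  assumes "A \<subseteq> L" "c \<noteq> 1" "\<And>r. r \<in> A \<Longrightarrow> r c = m"
  shows "tail (\<lambda>B. \<rho> * F A B) (\<rho> * (k * sqrt N)) ((N + 1) * p0)"
proof -
  obtain l where l: "distinct [c, 1, l]"
    using assms(2) exhaust_3[of c] that[of 2] that[of 3] by auto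
  have "card ((\<lambda>r. r c) ` A) \<le> card {m}" using assms(3) by (intro card_mono) auto
  then have "tail (F A) (k * sqrt (1 * N)) ((N + 1) * p0)"
    using card_coord[OF assms(1)] by (intro F_tail[OF l assms(1)]) auto
  then show ?thesis using tail_cmult[of "F A" "k * sqrt N" "(N + 1) * p0" \<rho>] \<rho> by simp
qed

lemma tail_fix2:
  assumes "A \<subseteq> L" "distinct [c, c', 1]" "\<And>r. r \<in> A \<Longrightarrow> r c = m" "\<And>r. r \<in> A \<Longrightarrow> r c' = m'"
  shows "tail (\<lambda>B. \<rho> * F A B) (\<rho> * k) ((N + 1) * p0)"
proof -
  have "card ((\<lambda>r. r c) ` A) \<le> card {m}" using assms(3) by (intro card_mono) auto
  moreover have "card ((\<lambda>r. r c') ` A) \<le> card {m'}" using assms(4) by (intro card_mono) auto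
  ultimately have "tail (F A) (k * sqrt (1 * 1)) ((N + 1) * p0)"
    by (intro F_tail[OF assms(2,1)]) auto
  then show ?thesis using tail_cmult[of "F A" k "(N + 1) * p0" \<rho>] \<rho> by simp
qed

lemma tail_any:
  assumes "A \<subseteq> L"
  shows "tail (\<lambda>B. \<rho> * F A B) (\<rho> * k * N) ((N + 1) * p0)"
proof -
  have "tail (F A) (k * sqrt (N * N)) ((N + 1) * p0)"
    using card_coord[OF assms] by (intro F_tail[of 2 3 1, OF _ assms]) auto
  then show ?thesis using tail_cmult[of "F A" "k * N" "(N + 1) * p0" \<rho>] \<rho> by (simp add: mult.assoc)
qed

text \<open>Beck's gain with rows indexed by the coincidence coordinate \<open>c\<close> and columns
  by coordinate 1. The columns of block \<open>t\<close> start at \<open>t * h\<close>, so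
  everything built from earlier blocks qualifies as a predictable factor.\<close>

lemma tail_beck_block:
  assumes A: "A \<subseteq> block t" and c: "c \<noteq> 1"
    and G: "\<And>m. m \<le> n \<Longrightarrow> below 1 (t * h) (G m)" "\<And>m. m \<le> n \<Longrightarrow> tail (G m) \<Gamma> p" and "0 < \<Gamma>"
  shows "tail (\<lambda>B. \<Sum>m\<le>n. G m B * (\<rho> * F (fixc c m A) B)) (\<rho> * (2 * k * N * sqrt (sqrt N) * \<Gamma>))
    (N * p + (N\<^sup>2 + 1) * p0)"
proof -
  obtain l where l: "distinct [c, 1, l]"
    using c exhaust_3[of c] that[of 2] that[of 3] by auto
  have AL: "A \<subseteq> L" using block_subset[OF A] .
  have Fm: "F (fixc c m A) B = (\<Sum>a\<le>n. arr A c 1 m a B)" for m B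
  proof -
    have "F (fixc c m A) B = (\<Sum>m'\<in>{m}. \<Sum>a\<le>n. arr (fixc c m A) c 1 m' a B)"
      using AL L_le by (intro F_arr[OF l]) (auto simp: fixc_def)
    also have "\<dots> = (\<Sum>a\<le>n. arr A c 1 m a B)" by (simp add: arr_def fixc_def)
    finally show ?thesis .
  qed
  have "tail (\<lambda>B. \<Sum>m\<le>n. G m B * (\<Sum>a\<le>n. arr A c 1 m a B)) (2 * k * N * sqrt (sqrt N) * \<Gamma>) (N * p + (N\<^sup>2 + 1) * p0)"
  proof (rule beck_gain[OF array_arr[OF l AL] _ _ _ \<open>0 < \<Gamma>\<close>, where \<mu> = "t * h"])
    show "arr A c 1 m a = (\<lambda>B. 0)" if "a < t * h" for m a
    proof -
      have "a div h < t" using that h_pos by (simp add: div_less_iff_less_mult)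
      then have "vec_of c 1 m a \<notin> A" using A c by (auto simp: block_def)
      then show ?thesis by (simp add: arr_def)
    qed
  qed (use G in auto)
  then have "tail (\<lambda>B. \<rho> * (\<Sum>m\<le>n. G m B * (\<Sum>a\<le>n. arr A c 1 m a B))) (\<bar>\<rho>\<bar> * (2 * k * N * sqrt (sqrt N) * \<Gamma>)) (N * p + (N\<^sup>2 + 1) * p0)"
    by (rule tail_cmult)
  then show ?thesis using \<rho> by (simp add: Fm sum_distrib_left mult.left_commute)
qed

lemma N2_bounds: "1 \<le> N" "N \<le> N ^ 2" "1 \<le> N ^ 2" "N ^ 2 \<le> N ^ 3" "N \<le> N ^ 3" "1 \<le> N ^ 3"
proof -
  have *: "N ^ i \<le> N ^ j" if "i \<le> j" for i j using that by (intro power_increasing) auto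
  show "1 \<le> N" "N \<le> N ^ 2" "1 \<le> N ^ 2" "N ^ 2 \<le> N ^ 3" "N \<le> N ^ 3" "1 \<le> N ^ 3"
    using *[of 0 1] *[of 1 2] *[of 0 2] *[of 2 3] *[of 1 3] *[of 0 3] by simp_all
qed

lemma N2_bound1: "2 * N ^ 2 + 3 * N + 3 \<le> 8 * N ^ 3" and N2_bound2: "3 * N ^ 3 + 4 * N ^ 2 + 1 \<le> 8 * N ^ 3"
proof -
  have "2 * b + 3 * a + 3 \<le> 8 * c \<and> 3 * c + 4 * b + 1 \<le> 8 * c" if "b \<le> c" "a \<le> c" "1 \<le> c" for a b c :: real
    using that by linarith
  from this[OF N2_bounds(4,5,6)]
  show "2 * N ^ 2 + 3 * N + 3 \<le> 8 * N ^ 3" "3 * N ^ 3 + 4 * N ^ 2 + 1 \<le> 8 * N ^ 3" by blast+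
qed

lemma yb_eq: "yb = \<rho> * (2 * k * N * sqrt (sqrt N) * (\<rho> * (k * sqrt N))) * (\<rho> * k * N)\<^sup>2"
proof -
  have "sqrt N * sqrt N = N" by simp
  then have "N / sqrt N = sqrt N" by (simp add: field_simps)
  moreover have "yb = \<rho> * (2 * k * N * sqrt (sqrt N) * (\<rho> * (k * (N / sqrt N)))) * (\<rho> * k * N)\<^sup>2"
    by (simp add: yb_def power2_eq_square power4_eq_xxxx)
  ultimately show ?thesis by simp
qed

text \<open>The earlier block \<open>s\<close> supplies the predictable factor, of size
  \<open>\<rho> * (k * sqrt N)\<close> once its level in \<open>c\<close> is fixed, and the later
  block \<open>t\<close> the columns. The at most two other blocks of \<open>V\<close> are bounded
  trivially, and \<open>big\<close> pads their number to two.\<close>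

lemma E_eqs1:
  assumes adm: "admissible S V" and U: "{s, t} \<subseteq> V" "s < t" and V: "card V \<le> 4" and c: "c \<noteq> 1"
    and big: "1 \<le> \<rho> * k * N"
  shows "nrm {T \<in> Tup S. eqs c {s, t} T} \<le> 2 * yb + M ^ q * (8 * N ^ 3 * p0)"
proof -
  let ?U = "{s, t}"
  have finV: "finite V" using admissible_finite_V[OF adm] .
  define G where "G m B = \<rho> * F (fixc c m (vs S s)) B" for m B
  define H where "H B = (\<Prod>v\<in>V - ?U. \<rho> * F (vs S v) B)" for B
  define core where "core B = (\<Sum>m\<le>n. G m B * (\<rho> * F (fixc c m (vs S t)) B)) * H B" for B
  have st: "vs S s \<subseteq> block s" "vs S t \<subseteq> block t" using vs_block[OF adm] by auto
  have "psum {T \<in> Tup S. eqs c ?U T} B = core B * Z (vs S) ({..<q} - V) B" for B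
  proof -
    have "psum {T \<in> Tup S. eqs c ?U T} B = (\<Sum>m\<le>n. psum (Tup (fixS ?U c m S)) B)"
      using psum_eqs[OF adm U(1), of c "\<lambda>_. True"] by simp
    also have "\<dots> = (\<Sum>m\<le>n. (G m B * (\<rho> * F (fixc c m (vs S t)) B) * H B) * Z (vs S) ({..<q} - V) B)"
    proof (rule sum.cong[OF refl])
      fix m
      have "Z (vs (fixS ?U c m S)) ({..<q} - V) B = Z (vs S) ({..<q} - V) B"
        unfolding Z_def using U by (intro prod.cong) (auto simp: vs_fixS)
      moreover have "(\<Prod>v\<in>V. \<rho> * F (vs (fixS ?U c m S) v) B) = (\<Prod>v\<in>V - ?U. \<rho> * F (vs (fixS ?U c m S) v) B) * (\<Prod>v\<in>?U. \<rho> * F (vs (fixS ?U c m S) v) B)"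
        by (rule prod.subset_diff[OF U(1) finV])
      moreover have "(\<Prod>v\<in>V - ?U. \<rho> * F (vs (fixS ?U c m S) v) B) = H B"
        unfolding H_def by (intro prod.cong) (auto simp: vs_fixS)
      moreover have "(\<Prod>v\<in>?U. \<rho> * F (vs (fixS ?U c m S) v) B) = G m B * (\<rho> * F (fixc c m (vs S t)) B)"
        using U(2) by (simp add: vs_fixS G_def)
      ultimately show "psum (Tup (fixS ?U c m S)) B = (G m B * (\<rho> * F (fixc c m (vs S t)) B) * H B) * Z (vs S) ({..<q} - V) B"
        unfolding psum_Tup[OF admissible_fixS[OF adm U(1)]] by simp
    qed
    finally show ?thesis by (simp add: core_def sum_distrib_right)
  qed
  moreover have "tail core yb (8 * N ^ 3 * p0)"
  proof -
    have "tail (\<lambda>B. \<Sum>m\<le>n. G m B * (\<rho> * F (fixc c m (vs S t)) B))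
       (\<rho> * (2 * k * N * sqrt (sqrt N) * (\<rho> * (k * sqrt N)))) (N * ((N + 1) * p0) + (N\<^sup>2 + 1) * p0)"
    proof (rule tail_beck_block[OF st(2) c])
      fix m
      have sub: "fixc c m (vs S s) \<subseteq> block s" using st(1) by (auto simp: fixc_def)
      show "below 1 (t * h) (G m)" unfolding G_def
        by (intro below_mult below_const below_block_F[OF sub U(2)])
      show "tail (G m) (\<rho> * (k * sqrt N)) ((N + 1) * p0)" unfolding G_def
        by (rule tail_fix1[OF block_subset[OF sub] c]) (simp add: fixc_def)
    qed (use \<rho> k in auto)
    moreover have "tail H (\<Prod>v\<in>V - ?U. \<rho> * k * N) (card (V - ?U) * ((N + 1) * p0))"
      unfolding H_def using finV block_subset[OF vs_block[OF adm]] by (intro tail_prod tail_any) auto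
    ultimately have "tail core (\<rho> * (2 * k * N * sqrt (sqrt N) * (\<rho> * (k * sqrt N))) * (\<Prod>v\<in>V - ?U. \<rho> * k * N))
       (N * ((N + 1) * p0) + (N\<^sup>2 + 1) * p0 + card (V - ?U) * ((N + 1) * p0))"
      unfolding core_def using \<rho> k by (intro tail_mult) auto
    moreover have card2: "card (V - ?U) \<le> 2" using V U finV by (simp add: card_Diff_subset)
    moreover have "\<rho> * (2 * k * N * sqrt (sqrt N) * (\<rho> * (k * sqrt N))) * (\<Prod>v\<in>V - ?U. \<rho> * k * N) \<le> yb"
    proof -
      have "(\<rho> * k * N) ^ card (V - ?U) \<le> (\<rho> * k * N)\<^sup>2" using big card2 by (intro power_increasing)
      then show ?thesis unfolding yb_eq using \<rho> k by (simp add: mult_left_mono)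
    qed
    moreover have "N * ((N + 1) * p0) + (N\<^sup>2 + 1) * p0 + card (V - ?U) * ((N + 1) * p0) \<le> 8 * N ^ 3 * p0"
    proof -
      have "card (V - ?U) * ((N + 1) * p0) \<le> 2 * ((N + 1) * p0)"
        using card2 p0_pos by (intro mult_right_mono) auto
      then have "N * ((N + 1) * p0) + (N\<^sup>2 + 1) * p0 + card (V - ?U) * ((N + 1) * p0) \<le> (2 * N ^ 2 + 3 * N + 3) * p0"
        by (simp add: power2_eq_square algebra_simps)
      also have "\<dots> \<le> (8 * N ^ 3) * p0"
        using N2_bound1 p0_pos by (intro mult_right_mono) simp_all
      finally show ?thesis .
    qed
    ultimately show ?thesis using tail_mono by blast
  qed
  ultimately show ?thesis
    using admissible_Tup_full[OF adm] yb_nonneg by (intro E_psum_core[OF adm]) auto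
qed

text \<open>Beck's gain is used for one coincidence only, the one that contains the largest index
  \<open>t\<close>. The level \<open>m'\<close> of the other coincidence is summed by the triangle
  inequality inside the predictable factor; the factor \<open>N\<close> lost there is regained
  because every block involved has a fixed level.\<close>

lemma E_eqs2:
  assumes adm: "admissible S (U \<union> U')" and U: "U = {s, t}" "s < t" and U': "card U' = 2" "\<And>v. v \<in> U' \<Longrightarrow> v < t"
    and c: "distinct [c, c', 1]" and big: "1 \<le> \<rho> * k * N"
  shows "nrm {T \<in> Tup S. eqs c U T \<and> eqs c' U' T} \<le> 2 * yb + M ^ q * (8 * N ^ 3 * p0)"
proof -
  let ?V = "U \<union> U'"
  have finU': "finite U'" "U' \<noteq> {}" using U'(1) card.infinite by fastforce+
  have tU': "t \<notin> U'" using U'(2) by blast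
  have V: "?V - {t} = insert s U'" using U tU' by auto
  have finV: "finite ?V" using U finU' by simp
  define S2 where "S2 m m' = fixS U' c' m' (fixS U c m S)" for m m'
  define G where "G m B = (\<Sum>m'\<le>n. \<Prod>v\<in>?V - {t}. \<rho> * F (vs (S2 m m') v) B)" for m B
  define core where "core B = (\<Sum>m\<le>n. G m B * (\<rho> * F (fixc c m (vs S t)) B))" for B
  have adm1: "admissible (fixS U c m S) ?V" for m by (rule admissible_fixS[OF adm]) auto
  have adm2: "admissible (S2 m m') ?V" for m m' unfolding S2_def by (rule admissible_fixS[OF adm1]) auto
  have "psum {T \<in> Tup S. eqs c U T \<and> eqs c' U' T} B = core B * Z (vs S) ({..<q} - ?V) B" for B
  proof -
    have "psum {T \<in> Tup S. eqs c U T \<and> eqs c' U' T} B = (\<Sum>m\<le>n. psum {T \<in> Tup (fixS U c m S). eqs c' U' T} B)"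
      using U by (intro psum_eqs[OF adm]) auto
    also have "\<dots> = (\<Sum>m\<le>n. \<Sum>m'\<le>n. psum (Tup (S2 m m')) B)"
      unfolding S2_def using psum_eqs[OF adm1 _ finU'(2), of _ c' "\<lambda>_. True"] by simp
    also have "\<dots> = (\<Sum>m\<le>n. \<Sum>m'\<le>n. ((\<Prod>v\<in>?V - {t}. \<rho> * F (vs (S2 m m') v) B) * (\<rho> * F (fixc c m (vs S t)) B)) * Z (vs S) ({..<q} - ?V) B)"
    proof (intro sum.cong refl)
      fix m m'
      have "Z (vs (S2 m m')) ({..<q} - ?V) B = Z (vs S) ({..<q} - ?V) B"
        unfolding Z_def S2_def by (intro prod.cong) (auto simp: vs_fixS)
      moreover have "(\<Prod>v\<in>?V. \<rho> * F (vs (S2 m m') v) B) = \<rho> * F (vs (S2 m m') t) B * (\<Prod>v\<in>?V - {t}. \<rho> * F (vs (S2 m m') v) B)"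
        using U by (intro prod.remove[OF finV]) auto
      moreover have "vs (S2 m m') t = fixc c m (vs S t)" using U tU' by (simp add: S2_def vs_fixS)
      ultimately show "psum (Tup (S2 m m')) B = ((\<Prod>v\<in>?V - {t}. \<rho> * F (vs (S2 m m') v) B) * (\<rho> * F (fixc c m (vs S t)) B)) * Z (vs S) ({..<q} - ?V) B"
        unfolding psum_Tup[OF adm2] by simp
    qed
    finally show ?thesis by (simp add: core_def G_def sum_distrib_right)
  qed
  moreover have "tail core yb (8 * N ^ 3 * p0)"
  proof -
    define b where "b v = (if v \<in> U \<and> v \<in> U' then \<rho> * k else \<rho> * (k * sqrt N))" for v
    have tv: "tail (\<lambda>B. \<rho> * F (vs (S2 m m') v) B) (b v) ((N + 1) * p0)" if v: "v \<in> ?V" for v m m'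
    proof -
      have sub: "vs (S2 m m') v \<subseteq> L" using block_subset[OF vs_block[OF adm2]] .
      have 1: "r c = m" if "v \<in> U" "r \<in> vs (S2 m m') v" for r
        using that by (auto simp: S2_def vs_fixS fixc_def split: if_splits)
      have 2: "r c' = m'" if "v \<in> U'" "r \<in> vs (S2 m m') v" for r
        using that by (auto simp: S2_def vs_fixS fixc_def split: if_splits)
      show ?thesis
      proof (cases "v \<in> U \<and> v \<in> U'")
        case True
        then have "tail (\<lambda>B. \<rho> * F (vs (S2 m m') v) B) (\<rho> * k) ((N + 1) * p0)"
          using 1 2 by (intro tail_fix2[OF sub c, of m m']) blast+
        then show ?thesis using True by (simp add: b_def)
      next
        case False
        then show ?thesis using v c tail_fix1[OF sub, of c m] tail_fix1[OF sub, of c' m'] 1 2 by (auto simp: b_def)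
      qed
    qed
    have cardV: "card (?V - {t}) \<le> 3" using U'(1) finU' unfolding V by (simp add: card_insert_if)
    \<comment> \<open>If \<open>s\<close> is outside \<open>U'\<close>, three factors of size
      \<open>\<rho> * (k * sqrt N)\<close> occur. Otherwise the block \<open>s\<close> has two fixed
      levels and size \<open>\<rho> * k\<close>, one further factor remains, and \<open>big\<close>
      raises the exponent from 2 to 3.\<close>
    have prodb: "N * (\<Prod>v\<in>?V - {t}. b v) \<le> (\<rho> * k * N) ^ 3 / sqrt N"
    proof (cases "s \<in> U'")
      case True
      then have "?V - {t} = insert s (U' - {s})" using V by auto
      moreover have "card (U' - {s}) = 1" using U'(1) True by simp
      then obtain u where "U' - {s} = {u}" by (auto simp: card_1_singleton_iff)
      moreover from this have "u \<noteq> s" "u \<noteq> t" using tU' by auto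
      ultimately have "(\<Prod>v\<in>?V - {t}. b v) = (\<rho> * k) * (\<rho> * (k * sqrt N))"
        using True U by (simp add: b_def)
      moreover have "N * ((\<rho> * k) * (\<rho> * (k * sqrt N))) = (\<rho> * k * N)\<^sup>2 / sqrt N"
      proof -
        have "sqrt N * sqrt N = N" by simp
        then have "sqrt N = N / sqrt N" by (simp add: field_simps)
        then have "N * ((\<rho> * k) * (\<rho> * (k * sqrt N))) = N * ((\<rho> * k) * (\<rho> * (k * (N / sqrt N))))" by simp
        then show ?thesis by (simp add: power2_eq_square)
      qed
      moreover have "(\<rho> * k * N)\<^sup>2 / sqrt N \<le> (\<rho> * k * N) ^ 3 / sqrt N"
        using big by (intro divide_right_mono power_increasing) auto
      ultimately show ?thesis by simp
    next
      case False
      have "(\<Prod>v\<in>?V - {t}. b v) = (\<Prod>v\<in>?V - {t}. \<rho> * (k * sqrt N))"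
        using False U tU' by (intro prod.cong) (auto simp: b_def)
      also have "\<dots> = (\<rho> * (k * sqrt N)) ^ 3"
        using False finU' U'(1) unfolding V by simp
      finally have "N * (\<Prod>v\<in>?V - {t}. b v) = N * (\<rho> * (k * sqrt N)) ^ 3" by simp
      also have "\<dots> = (\<rho> * k * N) ^ 3 / sqrt N"
      proof -
        have sN: "sqrt N * sqrt N = N" by simp
        have "N * (\<rho> * (k * sqrt N)) ^ 3 * sqrt N = N * (\<rho> * k) ^ 3 * ((sqrt N * sqrt N) * (sqrt N * sqrt N))"
          by (simp only: power3_eq_cube ac_simps)
        also have "\<dots> = (\<rho> * k * N) ^ 3" unfolding sN by (simp only: power3_eq_cube ac_simps)
        finally show ?thesis by (simp add: eq_divide_eq)
      qed
      finally show ?thesis by simp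
    qed
    have "tail core (\<rho> * (2 * k * N * sqrt (sqrt N) * ((\<rho> * k * N) ^ 3 / sqrt N))) (N * (N * (3 * ((N + 1) * p0))) + (N\<^sup>2 + 1) * p0)"
      unfolding core_def
    proof (rule tail_beck_block)
      show "vs S t \<subseteq> block t" by (rule vs_block[OF adm])
      show "c \<noteq> 1" using c by auto
      fix m
      show "below 1 (t * h) (G m)" unfolding G_def
      proof (intro below_sum below_prod below_mult below_const)
        fix m' v assume "v \<in> ?V - {t}"
        then have "v < t" using V U U'(2) by auto
        then show "below 1 (t * h) (F (vs (S2 m m') v))" by (rule below_block_F[OF vs_block[OF adm2]])
      qed
      have "tail (G m) (card {..n} * (\<Prod>v\<in>?V - {t}. b v)) (card {..n} * (card (?V - {t}) * ((N + 1) * p0)))"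
        unfolding G_def using finV tv by (intro tail_sum tail_prod) auto
      then show "tail (G m) ((\<rho> * k * N) ^ 3 / sqrt N) (N * (3 * ((N + 1) * p0)))"
      proof (rule tail_mono)
        show "card {..n} * (\<Prod>v\<in>?V - {t}. b v) \<le> (\<rho> * k * N) ^ 3 / sqrt N" using prodb by (simp add: add.commute)
        have "card (?V - {t}) * ((N + 1) * p0) \<le> 3 * ((N + 1) * p0)"
          using cardV p0_pos by (intro mult_right_mono) auto
        then have "N * (card (?V - {t}) * ((N + 1) * p0)) \<le> N * (3 * ((N + 1) * p0))"
          by (intro mult_left_mono) auto
        then show "card {..n} * (card (?V - {t}) * ((N + 1) * p0)) \<le> N * (3 * ((N + 1) * p0))"
          by (simp add: add.commute)
      qed
    qed (use big in auto)
    then show ?thesis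
    proof (rule tail_mono)
      show "\<rho> * (2 * k * N * sqrt (sqrt N) * ((\<rho> * k * N) ^ 3 / sqrt N)) \<le> yb"
        unfolding yb_def power4_eq_xxxx power3_eq_cube by (simp only: times_divide_eq_left times_divide_eq_right ac_simps)
      have "N * (N * (3 * ((N + 1) * p0))) + (N\<^sup>2 + 1) * p0 = (3 * N ^ 3 + 4 * N\<^sup>2 + 1) * p0"
        by (simp add: power2_eq_square power3_eq_cube algebra_simps)
      also have "\<dots> \<le> (8 * N ^ 3) * p0" using N2_bound2 p0_pos by (intro mult_right_mono) simp_all
      finally show "N * (N * (3 * ((N + 1) * p0))) + (N\<^sup>2 + 1) * p0 \<le> 8 * N ^ 3 * p0" .
    qed
  qed
  ultimately show ?thesis
    using admissible_Tup_full[OF adm] yb_nonneg by (intro E_psum_core[OF adm]) auto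
qed

text \<open>A coarse substitute for "some maximal level is attained twice". Three entries in the top
  coarse block count as bad even when their levels differ, since their contribution is small by size
  alone; two entries are bad only if their levels agree. Coordinate 1 is absent because entries of
  different blocks have different levels there.\<close>

definition bad :: "tuple \<Rightarrow> bool" where
  "bad T \<longleftrightarrow> (\<exists>c\<in>{2, 3}. 3 \<le> card (topset c T) \<or> card (topset c T) = 2 \<and> eqs c (topset c T) T)"

text \<open>One majorant for all contributions of rare events: the crude sup norm times the largest
  failure probability that occurs.\<close>

definition err :: real where "err = M ^ q * (8 * real q * N ^ 3 * p0)"

lemma M_pow_nonneg: "0 \<le> M ^ q"
  using M_ge1 by (intro zero_le_power) linarith

lemma err_nonneg: "0 \<le> err"
  using M_pow_nonneg p0_pos unfolding err_def by (intro mult_nonneg_nonneg) auto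

lemma err_ge1: "M ^ q * (q * ((N + 1) * p0)) \<le> err"
proof -
  have "N + 1 \<le> 8 * N ^ 3" using N2_bounds(5,6) by linarith
  then have "(N + 1) * p0 \<le> (8 * N ^ 3) * p0" using p0_pos by (intro mult_right_mono) auto
  then have "q * ((N + 1) * p0) \<le> q * ((8 * N ^ 3) * p0)" by (intro mult_left_mono) auto
  then have "M ^ q * (q * ((N + 1) * p0)) \<le> M ^ q * (q * ((8 * N ^ 3) * p0))"
    using M_pow_nonneg by (rule mult_left_mono)
  then show ?thesis by (simp only: err_def ac_simps)
qed

lemma err_ge2: "M ^ q * (8 * N ^ 3 * p0) \<le> err"
proof -
  have "1 * (8 * N ^ 3 * p0) \<le> q * (8 * N ^ 3 * p0)"
    using q_pos p0_pos by (intro mult_right_mono) auto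
  then have "M ^ q * (1 * (8 * N ^ 3 * p0)) \<le> M ^ q * (q * (8 * N ^ 3 * p0))"
    using M_pow_nonneg by (rule mult_left_mono)
  then show ?thesis by (simp only: err_def ac_simps mult_1_left)
qed

section \<open>Summation over top sets and top blocks\<close>

definition index_sets :: "(nat set \<Rightarrow> bool) \<Rightarrow> nat set set" where
  "index_sets Q = {U. U \<subseteq> {..<q} \<and> U \<noteq> {} \<and> Q U}"

lemma finite_index_sets [simp]: "finite (index_sets Q)"
  by (rule finite_subset[of _ "Pow {..<q}"]) (auto simp: index_sets_def)

lemma card_index_sets_le: "card (index_sets Q) \<le> 2 ^ q"
proof -
  have "card (index_sets Q) \<le> card (Pow {..<q})" by (rule card_mono) (auto simp: index_sets_def)
  then show ?thesis by (simp add: card_Pow)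
qed

lemma card_small_sets:
  assumes "\<And>U. Q U \<Longrightarrow> card U \<le> 2"
  shows "card (index_sets Q) \<le> q\<^sup>2"
proof -
  have "index_sets Q \<subseteq> (\<lambda>(s, t). {s, t}) ` ({..<q} \<times> {..<q})"
  proof
    fix U assume U: "U \<in> index_sets Q"
    then have "finite U" by (auto simp: index_sets_def intro: finite_subset)
    then have "card U = 1 \<or> card U = 2" using U assms[of U] by (cases "card U") (auto simp: index_sets_def le_Suc_eq)
    then obtain s t where st: "U = {s, t}" by (auto simp: card_1_singleton_iff card_2_iff)
    then have "s < q" "t < q" using U by (auto simp: index_sets_def)
    then show "U \<in> (\<lambda>(s, t). {s, t}) ` ({..<q} \<times> {..<q})" unfolding st by (intro image_eqI[of _ _ "(s, t)"]) auto
  qed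
  then have "card (index_sets Q) \<le> card ({..<q} \<times> {..<q})"
    by (intro order_trans[OF card_mono card_image_le]) auto
  then show ?thesis by (simp add: power2_eq_square)
qed

text \<open>Writing \<open>xb = (q * xb) * (1 / q)\<close> and keeping only the third power of the
  first factor leaves the weights \<open>(1 / q) ^ card U\<close>. Over all \<open>U\<close> they
  add up to \<open>(1 + 1/q)^q\<close>, at most 3, so the exponential number of sets costs nothing
  in the main term.\<close>

lemma sum_xb:
  assumes "q * xb \<le> 1"
  shows "(\<Sum>U\<in>index_sets (\<lambda>U. 3 \<le> card U). xb ^ card U) \<le> 3 * (q * xb) ^ 3"
proof -
  have q: "0 < real q" using q_pos by simp
  have "(\<Sum>U\<in>index_sets (\<lambda>U. 3 \<le> card U). xb ^ card U) \<le> (\<Sum>U\<in>index_sets (\<lambda>U. 3 \<le> card U). (q * xb) ^ 3 * (1 / q) ^ card U)"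
  proof (rule sum_mono)
    fix U assume "U \<in> index_sets (\<lambda>U. 3 \<le> card U)"
    then have "(q * xb) ^ card U \<le> (q * xb) ^ 3"
      using assms xb_nonneg q by (intro power_decreasing) (auto simp: index_sets_def)
    then have "(q * xb) ^ card U * (1 / q) ^ card U \<le> (q * xb) ^ 3 * (1 / q) ^ card U"
      by (intro mult_right_mono) auto
    moreover have "(q * xb) ^ card U * (1 / q) ^ card U = xb ^ card U"
      unfolding power_mult_distrib[symmetric] using q by simp
    ultimately show "xb ^ card U \<le> (q * xb) ^ 3 * (1 / q) ^ card U" by simp
  qed
  also have "\<dots> = (q * xb) ^ 3 * (\<Sum>U\<in>index_sets (\<lambda>U. 3 \<le> card U). (1 / q) ^ card U)"
    by (simp add: sum_distrib_left)
  also have "\<dots> \<le> (q * xb) ^ 3 * 3"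
  proof (rule mult_left_mono)
    have "(\<Sum>U\<in>index_sets (\<lambda>U. 3 \<le> card U). (1 / q) ^ card U) \<le> (\<Sum>U\<in>Pow {..<q}. (1 / real q) ^ card U)"
      by (intro sum_mono2) (auto simp: index_sets_def)
    also have "\<dots> = (1 / real q + 1) ^ q"
      using prod_add[of "{..<q}" "\<lambda>_. 1 / real q" "\<lambda>_. 1"] by simp
    also have "\<dots> \<le> exp (1 / q) ^ q"
      using exp_ge_add_one_self[of "1 / real q"] by (intro power_mono) (auto simp: add.commute)
    also have "\<dots> = exp 1" using q by (simp add: exp_of_nat_mult[symmetric])
    also have "\<dots> \<le> 3" by (rule exp_le)
    finally show "(\<Sum>U\<in>index_sets (\<lambda>U. 3 \<le> card U). (1 / q) ^ card U) \<le> 3" .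
  qed (use xb_nonneg in auto)
  finally show ?thesis by simp
qed

lemma E_large1:
  assumes c: "c \<noteq> 1" and "q * xb \<le> 1"
  shows "nrm {T \<in> Tup full. 3 \<le> card (topset c T)} \<le> J * (6 * (q * xb) ^ 3 + 2 ^ q * err)"
proof -
  let ?Q = "\<lambda>U. 3 \<le> card U"
  have "nrm {T \<in> Tup full. 3 \<le> card (topset c T)} \<le> (\<Sum>i\<in>index_sets ?Q \<times> {..<J}. 2 * xb ^ card (fst i) + err)"
  proof (rule E_psum_sum_le)
    fix B
    have "psum {T \<in> Tup full. 3 \<le> card (topset c T)} B = (\<Sum>i\<in>index_sets ?Q \<times> {..<J}. psum (Tup (pat c (snd i) (fst i) full)) B)"
      using psum_topset[OF admissible_full, of ?Q c "\<lambda>_. True" B] by (simp add: index_sets_def)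
    then show "\<bar>psum {T \<in> Tup full. 3 \<le> card (topset c T)} B\<bar> \<le> (\<Sum>i\<in>index_sets ?Q \<times> {..<J}. \<bar>psum (Tup (pat c (snd i) (fst i) full)) B\<bar>)"
      by (simp only: sum_abs)
  next
    fix i assume "i \<in> index_sets ?Q \<times> {..<J}"
    then have "fst i \<subseteq> {..<q}" by (auto simp: index_sets_def)
    then show "nrm (Tup (pat c (snd i) (fst i) full)) \<le> 2 * xb ^ card (fst i) + err"
      using E_pat1[OF _ c, of "fst i" "snd i"] err_ge1 by linarith
  qed simp
  also have "\<dots> = J * (2 * (\<Sum>U\<in>index_sets ?Q. xb ^ card U) + card (index_sets ?Q) * err)"
    by (simp add: sum.cartesian_product' sum.distrib sum_distrib_left[symmetric] algebra_simps)
  also have "\<dots> \<le> J * (6 * (q * xb) ^ 3 + 2 ^ q * err)"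
  proof (intro mult_left_mono add_mono mult_right_mono)
    show "real (card (index_sets ?Q)) \<le> 2 ^ q" using card_index_sets_le[of ?Q] by (metis of_nat_le_iff of_nat_numeral of_nat_power)
    show "2 * (\<Sum>U\<in>index_sets ?Q. xb ^ card U) \<le> 6 * (q * xb) ^ 3" using sum_xb[OF assms(2)] by linarith
  qed (use err_nonneg in auto)
  finally show ?thesis .
qed

lemma psum_topset2:
  assumes "\<not> Q {}" "\<not> Q' {}"
  shows "psum {T \<in> Tup full. Q (topset 2 T) \<and> Q' (topset 3 T) \<and> X T} B =
    (\<Sum>i\<in>index_sets Q \<times> {..<J}. \<Sum>i'\<in>index_sets Q' \<times> {..<J}.
       psum {T \<in> Tup (pat 3 (snd i') (fst i') (pat 2 (snd i) (fst i) full)). X T} B)"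
proof -
  have "psum {T \<in> Tup full. Q (topset 2 T) \<and> Q' (topset 3 T) \<and> X T} B =
    (\<Sum>i\<in>index_sets Q \<times> {..<J}. psum {T \<in> Tup (pat 2 (snd i) (fst i) full). Q' (topset 3 T) \<and> X T} B)"
    using psum_topset[where Q = Q, OF admissible_full assms(1), of 2 "\<lambda>T. Q' (topset 3 T) \<and> X T" B] by (simp add: index_sets_def)
  also have "\<dots> = (\<Sum>i\<in>index_sets Q \<times> {..<J}. \<Sum>i'\<in>index_sets Q' \<times> {..<J}.
       psum {T \<in> Tup (pat 3 (snd i') (fst i') (pat 2 (snd i) (fst i) full)). X T} B)"
  proof (rule sum.cong[OF refl])
    fix i assume "i \<in> index_sets Q \<times> {..<J}"
    then have "fst i \<subseteq> {..<q}" by (auto simp: index_sets_def)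
    then show "psum {T \<in> Tup (pat 2 (snd i) (fst i) full). Q' (topset 3 T) \<and> X T} B =
      (\<Sum>i'\<in>index_sets Q' \<times> {..<J}. psum {T \<in> Tup (pat 3 (snd i') (fst i') (pat 2 (snd i) (fst i) full)). X T} B)"
      using psum_topset[where Q = Q', OF admissible_pat[OF admissible_full] assms(2), of "fst i" 2 "snd i" 3 X B] by (simp add: index_sets_def)
  qed
  finally show ?thesis .
qed

lemma E_topset2:
  fixes b :: "nat set \<Rightarrow> nat set \<Rightarrow> real"
  assumes "\<not> Q {}" "\<not> Q' {}"
    and b: "\<And>U U' \<beta> \<beta>'. U \<subseteq> {..<q} \<Longrightarrow> U' \<subseteq> {..<q} \<Longrightarrow> U \<noteq> {} \<Longrightarrow> U' \<noteq> {} \<Longrightarrow> Q U \<Longrightarrow> Q' U' \<Longrightarrow>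
      nrm {T \<in> Tup (pat2 \<beta> U \<beta>' U'). X T} \<le> b U U'"
  shows "nrm {T \<in> Tup full. Q (topset 2 T) \<and> Q' (topset 3 T) \<and> X T} \<le> (real J)\<^sup>2 * (\<Sum>U\<in>index_sets Q. \<Sum>U'\<in>index_sets Q'. b U U')"
proof -
  let ?I = "index_sets Q \<times> {..<J}" and ?I' = "index_sets Q' \<times> {..<J}"
  have "nrm {T \<in> Tup full. Q (topset 2 T) \<and> Q' (topset 3 T) \<and> X T} \<le> (\<Sum>z\<in>?I \<times> ?I'. b (fst (fst z)) (fst (snd z)))"
  proof (rule E_psum_sum_le)
    fix B
    have "psum {T \<in> Tup full. Q (topset 2 T) \<and> Q' (topset 3 T) \<and> X T} B =
      (\<Sum>z\<in>?I \<times> ?I'. psum {T \<in> Tup (pat 3 (snd (snd z)) (fst (snd z)) (pat 2 (snd (fst z)) (fst (fst z)) full)). X T} B)"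
      unfolding psum_topset2[where Q = Q and Q' = Q', OF assms(1,2)] by (simp add: sum.cartesian_product split_beta)
    then show "\<bar>psum {T \<in> Tup full. Q (topset 2 T) \<and> Q' (topset 3 T) \<and> X T} B\<bar> \<le>
      (\<Sum>z\<in>?I \<times> ?I'. \<bar>psum {T \<in> Tup (pat 3 (snd (snd z)) (fst (snd z)) (pat 2 (snd (fst z)) (fst (fst z)) full)). X T} B\<bar>)"
      by (simp only: sum_abs)
  next
    fix z assume "z \<in> ?I \<times> ?I'"
    then show "nrm {T \<in> Tup (pat 3 (snd (snd z)) (fst (snd z)) (pat 2 (snd (fst z)) (fst (fst z)) full)). X T} \<le> b (fst (fst z)) (fst (snd z))"
      by (intro b) (auto simp: index_sets_def)
  qed simp
  also have "\<dots> = (\<Sum>i\<in>?I. \<Sum>i'\<in>?I'. b (fst i) (fst i'))"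
    by (simp add: sum.cartesian_product split_beta)
  also have "\<dots> = (\<Sum>U\<in>index_sets Q. \<Sum>\<beta><J. \<Sum>U'\<in>index_sets Q'. \<Sum>\<beta>'<J. b U U')"
    by (simp add: sum.cartesian_product')
  also have "\<dots> = (real J)\<^sup>2 * (\<Sum>U\<in>index_sets Q. \<Sum>U'\<in>index_sets Q'. b U U')"
    by (simp add: sum_distrib_left power2_eq_square ac_simps)
  finally show ?thesis .
qed

text \<open>The intersection term of the later inclusion and exclusion. Two choices of a coarse
  block cost the square of \<open>J\<close>, for which the sixth power of \<open>q * xb\<close>
  pays.\<close>

lemma E_large2:
  assumes big: "1 \<le> \<rho> * k * N" and "q * xb \<le> 1"
  shows "nrm {T \<in> Tup full. 3 \<le> card (topset 2 T) \<and> 3 \<le> card (topset 3 T)} \<le> (real J)\<^sup>2 * (18 * (q * xb) ^ 6 + 4 ^ q * err)"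
proof -
  let ?Q = "\<lambda>U :: nat set. 3 \<le> card U"
  have "nrm {T \<in> Tup full. ?Q (topset 2 T) \<and> ?Q (topset 3 T) \<and> True}
     \<le> (real J)\<^sup>2 * (\<Sum>U\<in>index_sets ?Q. \<Sum>U'\<in>index_sets ?Q. 2 * (xb ^ card U * xb ^ card U') + err)"
  proof (rule E_topset2)
    fix U U' :: "nat set" and \<beta> \<beta>' :: nat assume "U \<subseteq> {..<q}" "U' \<subseteq> {..<q}"
    from E_pat2[OF this big, of \<beta>' \<beta>] err_ge1
    show "nrm {T \<in> Tup (pat2 \<beta> U \<beta>' U'). True} \<le> 2 * (xb ^ card U * xb ^ card U') + err"
      by simp
  qed auto
  also have "\<dots> = (real J)\<^sup>2 * (2 * ((\<Sum>U\<in>index_sets ?Q. xb ^ card U) * (\<Sum>U\<in>index_sets ?Q. xb ^ card U)) + (card (index_sets ?Q) * card (index_sets ?Q)) * err)"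
  proof -
    have "(\<Sum>U\<in>index_sets ?Q. \<Sum>U'\<in>index_sets ?Q. 2 * (xb ^ card U * xb ^ card U')) = 2 * ((\<Sum>U\<in>index_sets ?Q. xb ^ card U) * (\<Sum>U\<in>index_sets ?Q. xb ^ card U))"
      unfolding sum_product by (simp only: sum_distrib_left)
    moreover have "(\<Sum>U\<in>index_sets ?Q. \<Sum>U'\<in>index_sets ?Q. err) = (card (index_sets ?Q) * card (index_sets ?Q)) * err"
      by (simp add: mult.assoc)
    ultimately show ?thesis by (simp only: sum.distrib)
  qed
  also have "\<dots> \<le> (real J)\<^sup>2 * (18 * (q * xb) ^ 6 + 4 ^ q * err)"
  proof (intro mult_left_mono add_mono mult_right_mono)
    have "card (index_sets ?Q) * card (index_sets ?Q) \<le> 2 ^ q * 2 ^ q" by (intro mult_mono card_index_sets_le) auto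
    also have "\<dots> = (4::nat) ^ q" by (simp add: power_mult_distrib[symmetric])
    finally show "real (card (index_sets ?Q) * card (index_sets ?Q)) \<le> 4 ^ q" by (metis of_nat_le_iff of_nat_numeral of_nat_power)
    have "(\<Sum>U\<in>index_sets ?Q. xb ^ card U) * (\<Sum>U\<in>index_sets ?Q. xb ^ card U) \<le> (3 * (q * xb) ^ 3) * (3 * (q * xb) ^ 3)"
      using sum_xb[OF assms(2)] xb_nonneg by (intro mult_mono sum_nonneg) auto
    also have "\<dots> = 9 * (q * xb) ^ 6" by (simp add: power_add[symmetric] del: power_mult_distrib)
    finally show "2 * ((\<Sum>U\<in>index_sets ?Q. xb ^ card U) * (\<Sum>U\<in>index_sets ?Q. xb ^ card U)) \<le> 18 * (q * xb) ^ 6" by linarith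
  qed (use err_nonneg in auto)
  finally show ?thesis by simp
qed

lemma E_small:
  assumes "\<And>U. Q U \<Longrightarrow> U \<noteq> {} \<and> card U \<le> 2" "\<And>U. Q' U \<Longrightarrow> U \<noteq> {} \<and> card U \<le> 2"
    and b: "\<And>U U' \<beta> \<beta>'. U \<subseteq> {..<q} \<Longrightarrow> U' \<subseteq> {..<q} \<Longrightarrow> Q U \<Longrightarrow> Q' U' \<Longrightarrow>
      nrm {T \<in> Tup (pat2 \<beta> U \<beta>' U'). X T} \<le> 2 * yb + err"
  shows "nrm {T \<in> Tup full. Q (topset 2 T) \<and> Q' (topset 3 T) \<and> X T} \<le> (real J)\<^sup>2 * (real q ^ 4 * (2 * yb + err))"
proof -
  have "nrm {T \<in> Tup full. Q (topset 2 T) \<and> Q' (topset 3 T) \<and> X T}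
     \<le> (real J)\<^sup>2 * (\<Sum>U\<in>index_sets Q. \<Sum>U'\<in>index_sets Q'. 2 * yb + err)"
    by (rule E_topset2) (use assms in blast)+
  also have "\<dots> = (real J)\<^sup>2 * ((card (index_sets Q) * card (index_sets Q')) * (2 * yb + err))" by (simp add: mult.assoc)
  also have "\<dots> \<le> (real J)\<^sup>2 * (real q ^ 4 * (2 * yb + err))"
  proof (intro mult_left_mono mult_right_mono)
    have "card (index_sets Q) * card (index_sets Q') \<le> q\<^sup>2 * q\<^sup>2"
      using assms(1,2) by (intro mult_mono card_small_sets) auto
    then have "card (index_sets Q) * card (index_sets Q') \<le> q ^ 4" by (simp add: power_add[symmetric])
    then show "real (card (index_sets Q) * card (index_sets Q')) \<le> real q ^ 4" by (metis of_nat_le_iff of_nat_power)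
  qed (use yb_nonneg err_nonneg in auto)
  finally show ?thesis .
qed

lemma topset_pat2:
  assumes "U \<subseteq> {..<q}" "U' \<subseteq> {..<q}" "U \<noteq> {}" "U' \<noteq> {}" "T \<in> Tup (pat2 \<beta> U \<beta>' U')"
  shows "topset 2 T = U" "topset 3 T = U'"
  using assms(5) unfolding Tup_pat_iff[OF assms(2,4)] Tup_pat_iff[OF assms(1,3)] by blast+

lemma admissible_pat2:
  assumes "U \<subseteq> {..<q}" "U' \<subseteq> {..<q}"
  shows "admissible (pat2 \<beta> U \<beta>' U') (U \<union> U')"
  using admissible_pat[OF admissible_pat[OF admissible_full assms(1)] assms(2)] by simp

lemma card_2_lessE:
  fixes U :: "nat set"
  assumes "card U = 2"
  obtains s t where "U = {s, t}" "s < t"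
proof -
  obtain s t where "U = {s, t}" "s \<noteq> t" using assms by (auto simp: card_2_iff)
  then show ?thesis using that[of s t] that[of t s] by (cases "s < t") (auto simp: insert_commute)
qed

lemma E_small_eqs:
  assumes big: "1 \<le> \<rho> * k * N" and U: "U \<subseteq> {..<q}" "U' \<subseteq> {..<q}" "U \<noteq> {}" "U' \<noteq> {}" "card U \<le> 2" "card U' \<le> 2"
    and c: "c \<noteq> 1" and W: "card W = 2" "W \<subseteq> U \<union> U'"
  shows "nrm {T \<in> Tup (pat2 \<beta> U \<beta>' U'). eqs c W T} \<le> 2 * yb + err"
proof -
  obtain s t where st: "W = {s, t}" "s < t" using W(1) by (rule card_2_lessE)
  have "card (U \<union> U') \<le> 4" using card_Un_le[of U U'] U by linarith
  then have "nrm {T \<in> Tup (pat2 \<beta> U \<beta>' U'). eqs c W T} \<le> 2 * yb + M ^ q * (8 * N ^ 3 * p0)"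
    unfolding st(1) using W(2) st by (intro E_eqs1[OF admissible_pat2[OF U(1,2)] _ _ _ c big]) auto
  then show ?thesis using err_ge2 by linarith
qed

text \<open>An index occurring in both top blocks cannot be the largest one: the other vector of an
  pair agreeing in coordinate 2 has no larger third, hence no smaller first coordinate.\<close>

lemma eqs_Max_False:
  assumes U: "U \<subseteq> {..<q}" "U' \<subseteq> {..<q}" "card U = 2" "card U' = 2"
    and T: "T \<in> Tup (pat2 \<beta> U \<beta>' U')" "eqs 2 U T" "eqs 3 U' T"
    and t: "t \<in> U" "t \<in> U'" "\<And>v. v \<in> U \<Longrightarrow> v \<le> t"
  shows False
proof -
  have ne: "U \<noteq> {}" "U' \<noteq> {}" using U by auto
  note adm = admissible_pat2[OF U(1,2), of \<beta>' \<beta>]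
  obtain a b where ab: "U = {a, b}" "a < b" using U(3) by (rule card_2_lessE)
  define s where "s = a"
  have s: "s \<in> U" "s < t" using t(1) t(3)[of b] ab by (auto simp: s_def)
  obtain r where r: "T s = Some r" "r \<in> block s"
    using admissible_Some[OF adm T(1), of s] s(1) vs_block[OF adm, of s] by blast
  obtain r' where r': "T t = Some r'" "r' \<in> block t"
    using admissible_Some[OF adm T(1), of t] t(1) vs_block[OF adm, of t] by blast
  have "the (T s) 2 = the (T t) 2" using T(2) s(1) t(1) unfolding eqs_def by blast
  then have 2: "r 2 = r' 2" using r(1) r'(1) by simp
  \<comment> \<open>If \<open>s\<close> is not in \<open>U'\<close>, its entry lies in a strictly
    lower coarse block of coordinate 3 than the top entry at \<open>t\<close>.\<close>
  have 3: "r 3 \<le> r' 3"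
  proof (cases "s \<in> U'")
    case True
    then have "the (T s) 3 = the (T t) 3" using T(3) t(2) unfolding eqs_def by blast
    then show ?thesis using r(1) r'(1) by simp
  next
    case False
    have top: "topset 3 T = U'" by (rule topset_pat2(2)[OF U(1,2) ne T(1)])
    have "r' 3 div w = \<beta>'" using T(1) r'(1) t(2) unfolding Tup_pat_iff[OF U(2) ne(2)] by auto
    moreover have "s < q" using s(1) U(1) by auto
    then have "T s \<in> pat2 \<beta> U \<beta>' U' s" using T(1) by (auto elim: PiE_mem)
    then have "r 3 div w < \<beta>'" using r(1) False by (simp add: pat_def)
    ultimately have "r 3 div w < r' 3 div w" by simp
    then show ?thesis by (meson div_le_mono leI le_trans less_le_not_le nat_le_linear)
  qed
  have "r' 1 \<le> r 1" using 2 3 r(2) r'(2) by (simp add: block_def L_def)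
  then have "r' 1 div h \<le> r 1 div h" by (rule div_le_mono)
  then show False using r(2) r'(2) s(2) by (simp add: block_def)
qed

text \<open>The largest index lies in exactly one of the two top sets, since lying in both is
  contradictory. All other indices are then smaller, as \<open>E_eqs2\<close> demands, and the roles
  of the coordinates are exchanged if necessary.\<close>

lemma E_small_eqs2:
  assumes big: "1 \<le> \<rho> * k * N" and U: "U \<subseteq> {..<q}" "U' \<subseteq> {..<q}" "card U = 2" "card U' = 2"
  shows "nrm {T \<in> Tup (pat2 \<beta> U \<beta>' U'). eqs 2 U T \<and> eqs 3 U' T} \<le> 2 * yb + err"
proof -
  let ?S = "pat2 \<beta> U \<beta>' U'"
  have ne: "U \<noteq> {}" "finite U" "finite U'" using U by (auto intro: finite_subset)
  note adm = admissible_pat2[OF U(1,2), of \<beta>' \<beta>]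
  define t where "t = Max (U \<union> U')"
  have t: "t \<in> U \<union> U'" and tmax: "\<And>v. v \<in> U \<union> U' \<Longrightarrow> v \<le> t"
    using ne unfolding t_def by (auto simp del: Un_iff intro!: Max_in)
  obtain a b where ab: "U = {a, b}" "a < b" using U(3) by (rule card_2_lessE)
  obtain a' b' where ab': "U' = {a', b'}" "a' < b'" using U(4) by (rule card_2_lessE)
  consider "t \<in> U" "t \<in> U'" | "t \<in> U" "t \<notin> U'" | "t \<notin> U" "t \<in> U'" using t by blast
  then have "nrm {T \<in> Tup ?S. eqs 2 U T \<and> eqs 3 U' T} \<le> 2 * yb + M ^ q * (8 * N ^ 3 * p0)"
  proof cases
    case 1
    then have empty: "{T \<in> Tup ?S. eqs 2 U T \<and> eqs 3 U' T} = {}"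
      using eqs_Max_False[OF U, of _ \<beta>' \<beta> t] tmax by blast
    have "nrm {T \<in> Tup ?S. eqs 2 U T \<and> eqs 3 U' T} = 0"
      unfolding empty by (simp add: psum_def)
    moreover have "0 \<le> M ^ q * (8 * N ^ 3 * p0)" using M_pow_nonneg p0_pos by (intro mult_nonneg_nonneg) auto
    ultimately show ?thesis using yb_nonneg by linarith
  next
    case 2
    then have bt: "b = t" using ab tmax[of b] by auto
    have "v < t" if "v \<in> U'" for v using tmax[of v] that 2(2) by (cases "v = t") auto
    then show ?thesis using ab bt by (intro E_eqs2[OF adm _ _ U(4) _ _ big, of a t]) auto
  next
    case 3
    then have bt: "b' = t" using ab' tmax[of b'] by auto
    have adm': "admissible ?S (U' \<union> U)" using adm by (simp add: Un_commute)
    have "v < t" if "v \<in> U" for v using tmax[of v] that 3(1) by (cases "v = t") auto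
    then have "nrm {T \<in> Tup ?S. eqs 3 U' T \<and> eqs 2 U T} \<le> 2 * yb + M ^ q * (8 * N ^ 3 * p0)"
      using ab' bt by (intro E_eqs2[OF adm' _ _ U(3) _ _ big, of a' t]) auto
    moreover have "{T \<in> Tup ?S. eqs 2 U T \<and> eqs 3 U' T} = {T \<in> Tup ?S. eqs 3 U' T \<and> eqs 2 U T}" by blast
    ultimately show ?thesis by simp
  qed
  then show ?thesis using err_ge2 by linarith
qed

lemma psum_filter: "finite X \<Longrightarrow> psum {T \<in> X. P T} B = (\<Sum>T\<in>X. of_bool (P T) * prd T B)"
proof -
  have "(\<Sum>T\<in>X. of_bool (P T) * prd T B) = (\<Sum>T\<in>X. if P T then prd T B else 0)"
    by (rule sum.cong[OF refl]) simp
  then show "finite X \<Longrightarrow> psum {T \<in> X. P T} B = (\<Sum>T\<in>X. of_bool (P T) * prd T B)"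
    by (simp only: psum_def sum.inter_filter)
qed

text \<open>A sum over bad tuples is not dominated by sums over larger sets, as cancellation may be
  lost by adding or dropping terms. The indicator of \<open>bad\<close> is therefore written exactly
  as a signed combination of six indicators, each of a form that splits into products by top
  sets.\<close>

lemma E_bad:
  assumes big: "1 \<le> \<rho> * k * N" and qx: "q * xb \<le> 1"
  shows "nrm {T \<in> Tup full. bad T} \<le>
    2 * (J * (6 * (q * xb) ^ 3 + 2 ^ q * err)) + (real J)\<^sup>2 * (18 * (q * xb) ^ 6 + 4 ^ q * err) + 3 * ((real J)\<^sup>2 * (real q ^ 4 * (2 * yb + err)))"
proof -
  let ?a = "\<lambda>c T. 3 \<le> card (topset c T)"
  let ?e = "\<lambda>c T. eqs c (topset c T) T"
  let ?two = "\<lambda>U :: nat set. card U = 2" and ?sm = "\<lambda>U :: nat set. U \<noteq> {} \<and> card U \<le> 2"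
  define P1 where "P1 T \<longleftrightarrow> ?a 2 T \<and> ?a 3 T" for T
  define P2 where "P2 T \<longleftrightarrow> ?two (topset 2 T) \<and> ?sm (topset 3 T) \<and> ?e 2 T" for T
  define P3 where "P3 T \<longleftrightarrow> ?sm (topset 2 T) \<and> ?two (topset 3 T) \<and> ?e 3 T" for T
  define P4 where "P4 T \<longleftrightarrow> ?two (topset 2 T) \<and> ?two (topset 3 T) \<and> ?e 2 T \<and> ?e 3 T" for T
  have fin: "finite (Tup full)" by (rule admissible_finite_Tup[OF admissible_full])
  have ind: "of_bool (bad T) = (of_bool (?a 2 T) + of_bool (?a 3 T) - of_bool (P1 T) + of_bool (P2 T) + of_bool (P3 T) - of_bool (P4 T) :: real)"
    if "T \<in> Tup full" for T
  proof -
    \<comment> \<open>As the top sets are empty simultaneously, a top set of two elements in one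
      coordinate forces the other to be nonempty; if it is not large either, it satisfies
      \<open>?sm\<close>.\<close>
    have ne: "topset 2 T = {} \<longleftrightarrow> topset 3 T = {}"
    proof (cases "\<exists>t<q. T t \<noteq> None")
      case True
      then obtain t where "t < q" "T t \<noteq> None" by blast
      then show ?thesis using topset_nonempty[of t T 2] topset_nonempty[of t T 3] by simp
    next
      case False
      then show ?thesis by (auto simp: topset_def)
    qed
    have "finite (topset c T)" for c using topset_subset by (rule finite_subset) simp
    then have z: "card (topset c T) = 0 \<longleftrightarrow> topset c T = {}" for c by simp
    consider "?a 2 T" "?a 3 T" | "?a 2 T" "\<not> ?a 3 T" | "\<not> ?a 2 T" "?a 3 T" | "\<not> ?a 2 T" "\<not> ?a 3 T" by blast
    then show ?thesis
    proof cases
      case 4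
      then have "card (topset 2 T) \<le> 2" "card (topset 3 T) \<le> 2" by linarith+
      then show ?thesis using 4 ne z[of 2] z[of 3] unfolding bad_def P1_def P2_def P3_def P4_def
        by (cases "?e 2 T"; cases "?e 3 T"; cases "card (topset 2 T) = 2"; cases "card (topset 3 T) = 2") auto
    qed (auto simp: bad_def P1_def P2_def P3_def P4_def)
  qed
  have dec: "psum {T \<in> Tup full. bad T} B = psum {T \<in> Tup full. ?a 2 T} B + psum {T \<in> Tup full. ?a 3 T} B
     - psum {T \<in> Tup full. P1 T} B + psum {T \<in> Tup full. P2 T} B + psum {T \<in> Tup full. P3 T} B - psum {T \<in> Tup full. P4 T} B" for B
    unfolding psum_filter[OF fin] sum.distrib[symmetric] sum_subtractf[symmetric]
    by (rule sum.cong[OF refl]) (simp only: ind ring_distribs)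
  have "nrm {T \<in> Tup full. bad T} \<le> E (\<lambda>B. \<bar>psum {T \<in> Tup full. ?a 2 T} B\<bar> + \<bar>psum {T \<in> Tup full. ?a 3 T} B\<bar>
     + \<bar>psum {T \<in> Tup full. P1 T} B\<bar> + \<bar>psum {T \<in> Tup full. P2 T} B\<bar> + \<bar>psum {T \<in> Tup full. P3 T} B\<bar> + \<bar>psum {T \<in> Tup full. P4 T} B\<bar>)"
    unfolding dec by (rule E_mono) linarith
  also have "\<dots> = nrm {T \<in> Tup full. ?a 2 T} + nrm {T \<in> Tup full. ?a 3 T}
     + nrm {T \<in> Tup full. P1 T} + nrm {T \<in> Tup full. P2 T}
     + nrm {T \<in> Tup full. P3 T} + nrm {T \<in> Tup full. P4 T}"
    by (simp only: E_add)
  also have "\<dots> \<le> J * (6 * (q * xb) ^ 3 + 2 ^ q * err) + J * (6 * (q * xb) ^ 3 + 2 ^ q * err) + (real J)\<^sup>2 * (18 * (q * xb) ^ 6 + 4 ^ q * err)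
     + (real J)\<^sup>2 * (real q ^ 4 * (2 * yb + err)) + (real J)\<^sup>2 * (real q ^ 4 * (2 * yb + err)) + (real J)\<^sup>2 * (real q ^ 4 * (2 * yb + err))"
  proof (intro add_mono E_large1 qx)
    show "nrm {T \<in> Tup full. P1 T} \<le> (real J)\<^sup>2 * (18 * (q * xb) ^ 6 + 4 ^ q * err)"
      unfolding P1_def by (rule E_large2[OF big qx])
    show "nrm {T \<in> Tup full. P2 T} \<le> (real J)\<^sup>2 * (real q ^ 4 * (2 * yb + err))"
      unfolding P2_def
    proof (rule E_small)
      fix U U' :: "nat set" and \<beta> \<beta>' assume U: "U \<subseteq> {..<q}" "U' \<subseteq> {..<q}" "card U = 2" "?sm U'"
      then have ne: "U \<noteq> {}" "U' \<noteq> {}" by auto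
      have "{T \<in> Tup (pat2 \<beta> U \<beta>' U'). ?e 2 T} = {T \<in> Tup (pat2 \<beta> U \<beta>' U'). eqs 2 U T}"
        using topset_pat2(1)[OF U(1,2) ne] by auto
      then show "nrm {T \<in> Tup (pat2 \<beta> U \<beta>' U'). ?e 2 T} \<le> 2 * yb + err"
        using E_small_eqs[OF big U(1,2) ne, of 2 U] U by simp
    qed auto
    show "nrm {T \<in> Tup full. P3 T} \<le> (real J)\<^sup>2 * (real q ^ 4 * (2 * yb + err))"
      unfolding P3_def
    proof (rule E_small)
      fix U U' :: "nat set" and \<beta> \<beta>' assume U: "U \<subseteq> {..<q}" "U' \<subseteq> {..<q}" "?sm U" "card U' = 2"
      then have ne: "U \<noteq> {}" "U' \<noteq> {}" by auto
      have "{T \<in> Tup (pat2 \<beta> U \<beta>' U'). ?e 3 T} = {T \<in> Tup (pat2 \<beta> U \<beta>' U'). eqs 3 U' T}"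
        using topset_pat2(2)[OF U(1,2) ne] by auto
      then show "nrm {T \<in> Tup (pat2 \<beta> U \<beta>' U'). ?e 3 T} \<le> 2 * yb + err"
        using E_small_eqs[OF big U(1,2) ne, of 3 U'] U by simp
    qed auto
    show "nrm {T \<in> Tup full. P4 T} \<le> (real J)\<^sup>2 * (real q ^ 4 * (2 * yb + err))"
      unfolding P4_def
    proof (rule E_small)
      fix U U' :: "nat set" and \<beta> \<beta>' assume U: "U \<subseteq> {..<q}" "U' \<subseteq> {..<q}" "card U = 2" "card U' = 2"
      then have ne: "U \<noteq> {}" "U' \<noteq> {}" by auto
      have "{T \<in> Tup (pat2 \<beta> U \<beta>' U'). ?e 2 T \<and> ?e 3 T} = {T \<in> Tup (pat2 \<beta> U \<beta>' U'). eqs 2 U T \<and> eqs 3 U' T}"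
        using topset_pat2[OF U(1,2) ne] by auto
      then show "nrm {T \<in> Tup (pat2 \<beta> U \<beta>' U'). ?e 2 T \<and> ?e 3 T} \<le> 2 * yb + err"
        using E_small_eqs2[OF big U] by simp
    qed auto
  qed auto
  finally show ?thesis by simp
qed

end

section \<open>Orthogonality of good tuples and the duality estimate\<close>

context cube
begin

lemma E_lev_neq:
  assumes "lev c m f" "lev c m' g" "m \<noteq> m'" "m \<le> n" "m' \<le> n"
  shows "E (\<lambda>B. f B * g B) = 0"
proof (cases "m < m'")
  case True
  then show ?thesis using assms by (intro E_lev[of m' c] lev_mult' lev_below[of c m]) auto
next
  case False
  then show ?thesis using assms by (intro E_lev[of m c] lev_mult lev_below[of c m']) auto
qed

end

context riesz
begin

lemma Tup_full_Some:
  assumes "T \<in> Tup full" "t < q" "T t = Some r"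
  shows "r \<in> block t" "r \<in> L"
proof -
  have "T t \<in> full t" using assms(1,2) by (auto elim: PiE_mem)
  then show "r \<in> block t" using assms(3) by (auto simp: full_def)
  then show "r \<in> L" by (simp add: block_def)
qed

lemma lev_prd:
  assumes "T \<in> Tup full" "t < q" "T t = Some r"
    and less: "\<And>s r'. s < q \<Longrightarrow> s \<noteq> t \<Longrightarrow> T s = Some r' \<Longrightarrow> r' c < r c"
  shows "lev c (r c) (prd T)"
proof -
  have "prd T B = wt (T t) B * (\<Prod>s\<in>{..<q} - {t}. wt (T s) B)" for B
    unfolding prd_def using assms(2) by (intro prod.remove) auto
  then have eq: "prd T = (\<lambda>B. (\<rho> * f r B) * (\<Prod>s\<in>{..<q} - {t}. wt (T s) B))"
    using assms(3) by (auto simp: wt_def)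
  have "below c (r c) (wt (T s))" if s: "s < q" "s \<noteq> t" for s
  proof (cases "T s")
    case None
    then show ?thesis by (simp add: wt_def[abs_def])
  next
    case (Some r')
    have "below c (r c) (f r')"
      using less[OF s Some] Tup_full_Some[OF assms(1) s(1) Some] by (intro lev_below[OF f_lev])
    then show ?thesis using Some by (simp add: wt_def[abs_def] below_mult)
  qed
  then show ?thesis unfolding eq
    using Tup_full_Some[OF assms(1,2,3)] by (intro lev_mult below_prod lev_cmult f_lev) auto
qed

text \<open>The blocks are ordered by coordinate 1, so the entry with the largest index has the
  strictly largest first level, bad tuple or not.\<close>

lemma top_level1:
  assumes "T \<in> Tup full" "t0 < q" "T t0 \<noteq> None"
  shows "\<exists>t r. t < q \<and> T t = Some r \<and> (\<forall>s r'. s < q \<longrightarrow> s \<noteq> t \<longrightarrow> T s = Some r' \<longrightarrow> r' 1 < r 1)"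
proof -
  define D where "D = {t. t < q \<and> T t \<noteq> None}"
  have D: "finite D" "D \<noteq> {}" using assms by (auto simp: D_def)
  define t where "t = Max D"
  have "t \<in> D" using D by (simp add: t_def)
  then obtain r where t: "t < q" "T t = Some r" by (auto simp: D_def)
  have "r' 1 < r 1" if s: "s < q" "s \<noteq> t" "T s = Some r'" for s r'
  proof (rule ccontr)
    assume "\<not> r' 1 < r 1"
    then have "r 1 div h \<le> r' 1 div h" by (intro div_le_mono) simp
    moreover have "r' 1 div h = s" "r 1 div h = t"
      using Tup_full_Some[OF assms(1) s(1,3)] Tup_full_Some[OF assms(1) t] by (auto simp: block_def)
    moreover have "s \<le> t" unfolding t_def using s D by (intro Max_ge) (auto simp: D_def)
    ultimately show False using s(2) by simp
  qed
  then show ?thesis using t by blast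
qed

text \<open>At most two entries share the top coarse block, and if there are two their exact levels
  differ; all other entries lie in lower coarse blocks and hence at lower levels.\<close>

lemma top_level23:
  assumes "t0 < q" "T t0 \<noteq> None" "c \<noteq> 1" "\<not> bad T"
  shows "\<exists>t r. t < q \<and> T t = Some r \<and> (\<forall>s r'. s < q \<longrightarrow> s \<noteq> t \<longrightarrow> T s = Some r' \<longrightarrow> r' c < r c)"
proof -
  have c: "c \<in> {2, 3}" using assms(3) exhaust_3[of c] by auto
  define U where "U = topset c T"
  have U: "finite U" "U \<noteq> {}" using topset_subset[of c T] topset_nonempty[of t0 T c] assms(1,2)
    by (auto simp: U_def intro: finite_subset)
  have U2: "\<not> 3 \<le> card U" "card U = 2 \<Longrightarrow> \<not> eqs c U T" using assms(4) c unfolding bad_def U_def by blast+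
  define X where "X = (\<lambda>t. the (T t) c) ` U"
  have X: "finite X" "X \<noteq> {}" using U by (auto simp: X_def)
  then have "Max X \<in> X" by simp
  then obtain t where t: "t \<in> U" "Max X = the (T t) c" by (auto simp: X_def)
  have tmax: "the (T s) c \<le> the (T t) c" if "s \<in> U" for s
    using Max_ge[OF X(1), of "the (T s) c"] that unfolding t(2) by (auto simp: X_def)
  obtain r where r: "t < q" "T t = Some r" using t(1) by (auto simp: U_def topset_def)
  have "r' c < r c" if s: "s < q" "s \<noteq> t" "T s = Some r'" for s r'
  proof (cases "s \<in> U")
    case True
    have "card {s, t} \<le> card U" using True t(1) U(1) by (intro card_mono) auto
    then have "card U = 2" using s(2) U2(1) by simp
    moreover have "{s, t} = U" using calculation True t(1) U(1) s(2) by (intro card_subset_eq) auto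
    ultimately have "\<not> eqs c {s, t} T" using U2(2) by blast
    then have "the (T s) c \<noteq> the (T t) c" by (auto simp: eqs_def)
    then show ?thesis using tmax[OF True] s(3) r(2) by simp
  next
    case False
    then obtain s' where s': "s' < q" "T s' \<noteq> None" "r' c div w < the (T s') c div w"
      using s by (auto simp: U_def topset_def not_le)
    have "the (T s') c div w \<le> r c div w" using t(1) s' r by (auto simp: U_def topset_def)
    then have "r' c div w < r c div w" using s'(3) by simp
    then show ?thesis by (meson div_le_mono not_le)
  qed
  then show ?thesis using r by blast
qed

text \<open>If the correlation did not vanish, \<open>r\<close> would agree in every coordinate with
  the strict maximum of the tuple, so every entry would be coordinatewise at most \<open>r\<close>.
  All vectors have the same coordinate sum \<open>n\<close>, so every entry would equal
  \<open>r\<close>, which is impossible for two entries from disjoint blocks.\<close>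

lemma E_good:
  assumes T: "T \<in> Tup full" "\<not> bad T" and st: "s < t" "t < q" "T s \<noteq> None" "T t \<noteq> None"
    and g: "r \<in> L" "\<And>c. lev c (r c) g"
  shows "E (\<lambda>B. g B * prd T B) = 0"
proof (rule ccontr)
  assume E: "E (\<lambda>B. g B * prd T B) \<noteq> 0"
  have top: "\<exists>t r. t < q \<and> T t = Some r \<and> (\<forall>s r'. s < q \<longrightarrow> s \<noteq> t \<longrightarrow> T s = Some r' \<longrightarrow> r' c < r c)" for c
    using top_level1[OF T(1) st(2,4)] top_level23[OF st(2,4) _ T(2), of c] by (cases "c = 1") auto
  have le: "r' c \<le> r c" if v: "v < q" "T v = Some r'" for v r' c
  proof -
    obtain u r0 where u: "u < q" "T u = Some r0" "\<And>s r'. s < q \<Longrightarrow> s \<noteq> u \<Longrightarrow> T s = Some r' \<Longrightarrow> r' c < r0 c"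
      using top[of c] by blast
    have "lev c (r0 c) (prd T)" using u by (intro lev_prd[OF T(1)]) auto
    moreover have "r0 \<in> L" using Tup_full_Some[OF T(1) u(1,2)] by simp
    ultimately have "r c = r0 c" using E E_lev_neq[OF g(2)[of c], of "r0 c" "prd T"] L_le g(1) by blast
    then show ?thesis using u(3)[of v r'] v u(2) by (cases "v = u") (auto simp: less_imp_le)
  qed
  have eq: "r' = r" if "v < q" "T v = Some r'" for v r'
  proof (rule ext)
    fix c
    have "r' 1 + r' 2 + r' 3 = r 1 + r 2 + r 3"
      using Tup_full_Some[OF T(1) that] g(1) by (simp add: L_def)
    then show "r' c = r c"
      using le[OF that, of 1] le[OF that, of 2] le[OF that, of 3] exhaust_3[of c] by auto
  qed
  obtain r1 r2 where r12: "T s = Some r1" "T t = Some r2" using st by auto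
  have "r1 = r2" using eq[of s r1] eq[of t r2] r12 st by simp
  moreover have "r1 \<in> block s" "r2 \<in> block t"
    using Tup_full_Some[OF T(1) _ r12(1)] Tup_full_Some[OF T(1) _ r12(2)] st by auto
  ultimately show False using st(1) by (simp add: block_def)
qed

definition single :: "(3 \<Rightarrow> nat) \<Rightarrow> tuple" where
  "single r = (\<lambda>t\<in>{..<q}. if t = r 1 div h then Some r else None)"

lemma block_lt: "r \<in> L \<Longrightarrow> r 1 div h < q"
  using L_le[of r 1] qh by (simp add: less_mult_imp_div_less)

lemma single_Tup: "r \<in> L \<Longrightarrow> single r \<in> Tup full"
  by (auto simp: single_def full_def block_def)

lemma not_bad_single: "\<not> bad (single r)"
proof -
  have sub: "topset c (single r) \<subseteq> {r 1 div h}" for c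
    by (auto simp: topset_def single_def split: if_splits)
  have "card (topset c (single r)) \<le> 1" for c using card_mono[OF _ sub[of c]] by simp
  then have "\<not> 3 \<le> card (topset c (single r))" "card (topset c (single r)) \<noteq> 2" for c
    by (metis One_nat_def not_less_eq_eq numeral_3_eq_3 Suc_leD le_trans, metis Suc_1 Suc_n_not_le_n One_nat_def)
  then show ?thesis by (simp add: bad_def)
qed

lemma not_bad_empty: "\<not> bad (\<lambda>t\<in>{..<q}. None)"
proof -
  have "topset c (\<lambda>t\<in>{..<q}. None) = {}" for c by (auto simp: topset_def)
  then show ?thesis by (simp add: bad_def)
qed

lemma prd_single:
  assumes "r \<in> L"
  shows "prd (single r) B = \<rho> * f r B"
proof -
  have "prd (single r) B = (\<Prod>t<q. if t = r 1 div h then \<rho> * f r B else 1)"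
    unfolding prd_def by (intro prod.cong) (auto simp: single_def wt_def)
  then show ?thesis using block_lt[OF assms] by simp
qed

lemma inj_single: "inj_on single L"
proof (rule inj_onI)
  fix r r' assume r: "r \<in> L" "r' \<in> L" "single r = single r'"
  have "single r (r 1 div h) = Some r" using block_lt[OF r(1)] by (simp add: single_def)
  then have "(if r 1 div h = r' 1 div h then Some r' else None) = Some r"
    unfolding r(3) using block_lt[OF r(1)] by (simp add: single_def)
  then show "r = r'" by (cases "r 1 div h = r' 1 div h") simp_all
qed

lemma few_entries:
  assumes T: "T \<in> Tup full" and no: "\<And>s t. s < t \<Longrightarrow> t < q \<Longrightarrow> T s \<noteq> None \<Longrightarrow> T t \<noteq> None \<Longrightarrow> False"
  shows "T \<in> insert (\<lambda>t\<in>{..<q}. None) (single ` L)"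
proof (cases "\<exists>t<q. T t \<noteq> None")
  case False
  have "T = (\<lambda>t\<in>{..<q}. None)"
  proof
    fix s
    show "T s = (\<lambda>t\<in>{..<q}. None) s" using False PiE_arb[OF T, of s] by (cases "s < q") auto
  qed
  then show ?thesis by simp
next
  case True
  then obtain t r where t: "t < q" "T t = Some r" by auto
  have r: "r \<in> block t" "r \<in> L" using Tup_full_Some[OF T t] by auto
  then have td: "t = r 1 div h" by (simp add: block_def)
  have "T = single r"
  proof
    fix s
    show "T s = single r s"
    proof (cases "s < q")
      case True
      have "T s = None" if "s \<noteq> t"
        using no[of s t] no[of t s] t True that by (cases "s < t"; cases "T s") auto
      then show ?thesis using True t td by (auto simp: single_def)
    next
      case False
      then show ?thesis using PiE_arb[OF T, of s] by (simp add: single_def)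
    qed
  qed
  then show ?thesis using r by simp
qed

text \<open>The good tuples, tested against the sum of the \<open>g r\<close>, leave the linear term
  alone. They are all tuples minus the bad ones, so the test function has L1 norm at most 2 + 1,
  whence the 3.\<close>

lemma riesz_bound:
  assumes g: "\<And>r c. r \<in> L \<Longrightarrow> lev c (r c) (g r)" and C: "\<And>B. \<bar>\<Sum>r\<in>L. g r B\<bar> \<le> C"
    and bd: "nrm {T \<in> Tup full. bad T} \<le> 1"
  shows "\<rho> * \<bar>\<Sum>r\<in>L. E (\<lambda>B. f r B * g r B)\<bar> \<le> 3 * C"
proof -
  define G where "G B = (\<Sum>r\<in>L. g r B)" for B
  define \<phi> where "\<phi> T = E (\<lambda>B. G B * prd T B)" for T
  let ?good = "{T \<in> Tup full. \<not> bad T}" and ?few = "insert (\<lambda>t\<in>{..<q}. None) (single ` L)"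
  have fin: "finite (Tup full)" by (rule admissible_finite_Tup[OF admissible_full])
  have C0: "0 \<le> C" using C[of "{}"] by linarith
  have E_G: "E (\<lambda>B. G B * X B) = (\<Sum>r\<in>L. E (\<lambda>B. g r B * X B))" for X
    unfolding G_def sum_distrib_right by (rule E_sum)
  have G_le: "E (\<lambda>B. \<bar>G B * X B\<bar>) \<le> C * E (\<lambda>B. \<bar>X B\<bar>)" for X
    unfolding E_cmult[symmetric] abs_mult using C by (intro E_mono mult_right_mono) (auto simp: G_def)
  have "(\<Sum>T\<in>?good. \<phi> T) = (\<Sum>T\<in>?few. \<phi> T)"
  proof (rule sum.mono_neutral_right)
    show "finite ?good" using fin by simp
    have "(\<lambda>t\<in>{..<q}. None) \<in> Tup full" by (auto simp: full_def)
    then show "?few \<subseteq> ?good" using not_bad_empty not_bad_single single_Tup by auto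
    show "\<forall>T\<in>?good - ?few. \<phi> T = 0"
    proof
      fix T assume T: "T \<in> ?good - ?few"
      then obtain s t where "s < t" "t < q" "T s \<noteq> None" "T t \<noteq> None" using few_entries[of T] by blast
      then show "\<phi> T = 0" unfolding \<phi>_def E_G
        using T E_good[of T s t] g by (intro sum.neutral ballI) auto
    qed
  qed
  also have "\<dots> = \<phi> (\<lambda>t\<in>{..<q}. None) + (\<Sum>T\<in>single ` L. \<phi> T)"
  proof (rule sum.insert)
    show "(\<lambda>t\<in>{..<q}. None) \<notin> single ` L"
    proof
      assume "(\<lambda>t\<in>{..<q}. None) \<in> single ` L"
      then obtain r where r: "r \<in> L" "(\<lambda>t\<in>{..<q}. None) = single r" by blast
      then have "(\<lambda>t\<in>{..<q}. None) (r 1 div h) = single r (r 1 div h)" by simp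
      then show False using block_lt[OF r(1)] by (simp add: single_def)
    qed
  qed simp
  also have "\<phi> (\<lambda>t\<in>{..<q}. None) = 0"
  proof -
    have "prd (\<lambda>t\<in>{..<q}. None) B = 1" for B by (simp add: prd_def wt_def)
    then have "\<phi> (\<lambda>t\<in>{..<q}. None) = (\<Sum>r\<in>L. E (g r))" unfolding \<phi>_def E_G by simp
    also have "\<dots> = 0" using g L_le E_lev[of _ 1] by (intro sum.neutral ballI) blast
    finally show ?thesis .
  qed
  also have "(\<Sum>T\<in>single ` L. \<phi> T) = (\<Sum>r\<in>L. \<rho> * E (\<lambda>B. f r B * g r B))"
  proof (subst sum.reindex[OF inj_single], rule sum.cong[OF refl])
    fix r assume r: "r \<in> L"
    have "\<phi> (single r) = (\<Sum>r'\<in>L. E (\<lambda>B. g r' B * (\<rho> * f r B)))"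
      unfolding \<phi>_def E_G by (simp add: prd_single[OF r])
    also have "\<dots> = (\<Sum>r'\<in>{r}. E (\<lambda>B. g r' B * (\<rho> * f r B)))"
    proof (rule sum.mono_neutral_right)
      show "\<forall>r'\<in>L - {r}. E (\<lambda>B. g r' B * (\<rho> * f r B)) = 0"
      proof
        fix r' assume r': "r' \<in> L - {r}"
        then obtain c where "r' c \<noteq> r c" by (auto simp: fun_eq_iff)
        then show "E (\<lambda>B. g r' B * (\<rho> * f r B)) = 0"
          using r r' g L_le by (intro E_lev_neq[of c "r' c" _ "r c"] lev_cmult f_lev) auto
      qed
    qed (use r in auto)
    also have "\<dots> = \<rho> * E (\<lambda>B. f r B * g r B)" unfolding E_cmult[symmetric] by (simp add: ac_simps)
    finally show "(\<phi> \<circ> single) r = \<rho> * E (\<lambda>B. f r B * g r B)" by simp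
  qed
  finally have good: "(\<Sum>T\<in>?good. \<phi> T) = \<rho> * (\<Sum>r\<in>L. E (\<lambda>B. f r B * g r B))"
    by (simp add: sum_distrib_left)
  have \<phi>_sum: "(\<Sum>T\<in>X. \<phi> T) = E (\<lambda>B. G B * psum X B)" for X
    unfolding \<phi>_def psum_def sum_distrib_left by (rule E_sum[symmetric])
  have "(\<Sum>T\<in>Tup full. \<phi> T) = (\<Sum>T\<in>?good. \<phi> T) + (\<Sum>T\<in>{T \<in> Tup full. bad T}. \<phi> T)"
    using fin by (subst sum.union_disjoint[symmetric]) (auto intro!: sum.cong)
  then have "\<rho> * (\<Sum>r\<in>L. E (\<lambda>B. f r B * g r B)) = E (\<lambda>B. G B * psum (Tup full) B) - E (\<lambda>B. G B * psum {T \<in> Tup full. bad T} B)"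
    using good unfolding \<phi>_sum by linarith
  moreover have "\<bar>E (\<lambda>B. G B * psum (Tup full) B)\<bar> \<le> C * 2"
  proof -
    have "nrm (Tup full) \<le> 2"
      using E_abs_Z[of "vs full" "{..<q}"] vs_block[OF admissible_full] by (simp add: psum_Tup[OF admissible_full])
    then have "C * nrm (Tup full) \<le> C * 2" using C0 by (rule mult_left_mono)
    then show ?thesis using E_abs[of "\<lambda>B. G B * psum (Tup full) B"] G_le[of "psum (Tup full)"] by linarith
  qed
  moreover have "\<bar>E (\<lambda>B. G B * psum {T \<in> Tup full. bad T} B)\<bar> \<le> C * 1"
  proof -
    have "C * nrm {T \<in> Tup full. bad T} \<le> C * 1" using bd C0 by (rule mult_left_mono)
    then show ?thesis using E_abs[of "\<lambda>B. G B * psum {T \<in> Tup full. bad T} B"] G_le[of "psum {T \<in> Tup full. bad T}"] by linarith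
  qed
  ultimately have "\<bar>\<rho> * (\<Sum>r\<in>L. E (\<lambda>B. f r B * g r B))\<bar> \<le> 3 * C" by linarith
  then show ?thesis using \<rho> by (simp add: abs_mult)
qed

end

section \<open>Choice of parameters\<close>

text \<open>The gain over the trivial bound is the factor \<open>g \<approx> N\<^sup>1\<^sup>/\<^sup>2\<^sup>4\<^sup>0\<^sup>0\<close> in \<open>\<rho> = g / (2 N)\<close>; the exponent is far from optimal, it
  only has to dominate all powers of \<open>q\<close>, \<open>k\<close> and \<open>J\<close> lost in the coincidence estimates.\<close>

locale parameters = cube +
  fixes g :: nat and f :: "(3 \<Rightarrow> nat) \<Rightarrow> bits \<Rightarrow> real"
  assumes g100: "100 \<le> g" and g_le: "real g ^ 2400 \<le> N" and g_gt: "N < (real g + 1) ^ 2400"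
    and f: "\<And>r B. r \<in> L \<Longrightarrow> \<bar>f r B\<bar> \<le> 1" "\<And>r i. r \<in> L \<Longrightarrow> lev i (r i) (f r)"
begin

abbreviation G :: real where "G \<equiv> real g"
abbreviation u :: real where "u \<equiv> sqrt (sqrt N)"
text \<open>With \<open>h\<close> about \<open>N / q\<close> the scaled square function is of order
  \<open>G\<^sup>2 / q\<close>, which is \<open>\<eta>\<close>. The second moment may grow to
  \<open>exp (G\<^sup>2)\<close>, while a negative factor occurs with probability about
  \<open>exp (- q / (2 * G\<^sup>2))\<close>; the latter wins if \<open>q\<close> exceeds
  \<open>G ^ 4\<close> sufficiently. \<open>J\<close> must exceed \<open>G ^ 150\<close> for triples
  in a coarse block to be summable.\<close>

abbreviation q :: nat where "q \<equiv> g ^ 8"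
abbreviation J :: nat where "J \<equiv> g ^ 200"
abbreviation h :: nat where "h \<equiv> n div q + 1"
abbreviation w :: nat where "w \<equiv> n div J + 1"
abbreviation \<rho> :: real where "\<rho> \<equiv> G / (2 * N)"
abbreviation \<eta> :: real where "\<eta> \<equiv> 1 / G ^ 6"

lemma G100: "100 \<le> G" and G_pos: "0 < G"
  using g100 by simp_all

lemma G_pow_mono: "i \<le> j \<Longrightarrow> G ^ i \<le> G ^ j"
  using G100 by (intro power_increasing) auto

lemma G_pow_diff: "i \<le> j \<Longrightarrow> G ^ j / G ^ i = G ^ (j - i)"
  using G_pos by (simp add: power_diff)

lemma G_pow_diff2: "i \<le> j \<Longrightarrow> G ^ i / G ^ j = 1 / G ^ (j - i)"
  using G_pos by (simp add: power_diff)

lemma G_le_pow: "1 \<le> i \<Longrightarrow> G \<le> G ^ i"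
  using G_pow_mono[of 1 i] by simp

lemma G_le_N: "i \<le> 2400 \<Longrightarrow> G ^ i \<le> N"
  using G_pow_mono[of i 2400] g_le by linarith

lemma u_pow: "u ^ 4 = N" "u ^ 2 = sqrt N" and u_pos: "0 < u"
proof -
  have "u ^ 4 = (u ^ 2) ^ 2" by (simp only: power_mult[symmetric]) simp
  then show "u ^ 4 = N" "u ^ 2 = sqrt N" "0 < u" by simp_all
qed

lemma u_ge: "G ^ 600 \<le> u"
proof -
  have "(G ^ 600) ^ 4 \<le> u ^ 4" using g_le unfolding u_pow(1) by (simp add: power_mult[symmetric])
  then show ?thesis using power_mono_iff[of "G ^ 600" u 4] u_pos by simp
qed

lemma N_le_exp: "N \<le> exp (2400 * G)"
proof -
  have "N \<le> (G + 1) ^ 2400" using g_gt by simp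
  also have "\<dots> \<le> exp G ^ 2400"
    using exp_ge_add_one_self[of G] G_pos by (intro power_mono) (auto simp: add.commute)
  also have "\<dots> = exp (2400 * G)" by (simp add: exp_of_nat_mult[symmetric])
  finally show ?thesis .
qed

text \<open>All crude sup norms are at most \<open>N\<close> to a power that is linear in
  \<open>q\<close>, hence at most the exponential of a multiple of \<open>G ^ 9\<close>; this is
  what fixes \<open>k = G ^ 16\<close>. The bound \<open>13 * q\<close> is a round majorant of the
  exponents that occur.\<close>

lemma tiny:
  assumes "m \<le> 13 * q"
  shows "N ^ m * exp (- (G ^ 16) / 2) \<le> exp (- (G ^ 9))"
proof -
  have "N ^ m \<le> exp (2400 * G) ^ m" using N_le_exp by (intro power_mono) auto
  also have "\<dots> \<le> exp (2400 * G) ^ (13 * q)" using assms G_pos by (intro power_increasing) auto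
  also have "\<dots> = exp (real (13 * q) * (2400 * G))" by (rule exp_of_nat_mult[symmetric])
  also have "real (13 * q) * (2400 * G) = 31200 * G ^ 9" by (simp add: eval_nat_numeral)
  finally have "N ^ m * exp (- (G ^ 16) / 2) \<le> exp (31200 * G ^ 9) * exp (- (G ^ 16) / 2)"
    by (intro mult_right_mono) auto
  also have "\<dots> = exp (31200 * G ^ 9 - G ^ 16 / 2)" by (simp add: exp_add[symmetric])
  also have "\<dots> \<le> exp (- (G ^ 9))"
  proof -
    have "100 ^ 7 \<le> G ^ 7" using G100 by (intro power_mono) auto
    \<comment> \<open>The constant is twice \<open>31200 + 1\<close>, where
      \<open>31200 = 13 * 2400\<close>.\<close>
    then have "62402 * G ^ 9 \<le> G ^ 7 * G ^ 9" using G_pos by (intro mult_right_mono) auto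
    also have "\<dots> = G ^ 16" by (simp add: power_add[symmetric])
    finally show ?thesis by simp
  qed
  finally show ?thesis .
qed

lemma h_le: "real h \<le> 2 * N / G ^ 8"
proof -
  have "real (n div q) \<le> real n / G ^ 8" using of_nat_div_le_of_nat[of n q, where 'a = real] by simp
  moreover have "1 \<le> N / G ^ 8" using G_le_N[of 8] G_pos by simp
  moreover have "real n / G ^ 8 \<le> N / G ^ 8" by (intro divide_right_mono) auto
  moreover have "2 * N / G ^ 8 = N / G ^ 8 + N / G ^ 8" by (simp add: add_divide_distrib)
  ultimately show ?thesis unfolding of_nat_add of_nat_1 by linarith
qed

lemma w_le: "real w \<le> 2 * N / G ^ 200"
proof -
  have "real (n div J) \<le> real n / G ^ 200" using of_nat_div_le_of_nat[of n J, where 'a = real] by simp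
  moreover have "1 \<le> N / G ^ 200" using G_le_N[of 200] G_pos by simp
  moreover have "real n / G ^ 200 \<le> N / G ^ 200" by (intro divide_right_mono) auto
  moreover have "2 * N / G ^ 200 = N / G ^ 200 + N / G ^ 200" by (simp add: add_divide_distrib)
  ultimately show ?thesis unfolding of_nat_add of_nat_1 by linarith
qed

lemma sqrt_w: "sqrt w \<le> 2 * sqrt N / G ^ 100"
proof (rule real_le_lsqrt)
  have "(2 * sqrt N / G ^ 100)\<^sup>2 = 4 * N / G ^ 200"
    by (simp add: power_divide power_mult_distrib power_mult[symmetric])
  moreover have "2 * N / G ^ 200 \<le> 4 * N / G ^ 200" using G_pos by (intro divide_right_mono) auto
  ultimately show "real w \<le> (2 * sqrt N / G ^ 100)\<^sup>2" using w_le by simp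
qed (use G_pos in auto)

text \<open>The right side equals \<open>4 * N\<^sup>2 / G ^ 8\<close>. The diagonal uses up half of
  it; the Beck term and the remainder term a quarter each.\<close>

lemma sq_ineq: "real h * N + 4 * real J * (G ^ 16)\<^sup>2 * N * sqrt N * u + 2 * G ^ 16 * N * sqrt N * sqrt w \<le> \<eta> / \<rho>\<^sup>2"
proof -
  have "real h * N \<le> 2 * N / G ^ 8 * N" using h_le by (rule mult_right_mono) simp
  also have "\<dots> = 2 * (N\<^sup>2 / G ^ 8)" by (simp add: power2_eq_square)
  finally have 1: "real h * N \<le> 2 * (N\<^sup>2 / G ^ 8)" .
  have 2: "4 * real J * (G ^ 16)\<^sup>2 * N * sqrt N * u \<le> N\<^sup>2 / G ^ 8"
  proof -
    have "4 * G ^ 240 \<le> G * G ^ 240" using G100 by (intro mult_right_mono) auto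
    also have "\<dots> = G ^ 241" by (simp flip: power_Suc)
    also have "\<dots> \<le> u" using G_pow_mono[of 241 600] u_ge by linarith
    finally have "(4 * G ^ 240) * (N * sqrt N * u) \<le> u * (N * sqrt N * u)"
      using u_pos by (intro mult_right_mono) auto
    also have "\<dots> = N\<^sup>2"
    proof -
      have "u * (N * sqrt N * u) = N * (sqrt N * u ^ 2)" by (simp only: power2_eq_square ac_simps)
      also have "\<dots> = N\<^sup>2" unfolding u_pow(2) by (simp add: power2_eq_square)
      finally show ?thesis .
    qed
    finally have "(4 * G ^ 240) * (N * sqrt N * u) / G ^ 8 \<le> N\<^sup>2 / G ^ 8" by (intro divide_right_mono) auto
    moreover have "(4 * G ^ 240) * (N * sqrt N * u) / G ^ 8 = 4 * real J * (G ^ 16)\<^sup>2 * N * sqrt N * u"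
    proof -
      have "(4 * G ^ 240) * (N * sqrt N * u) / G ^ 8 = 4 * (G ^ 240 / G ^ 8) * (N * sqrt N * u)" by simp
      also have "G ^ 240 / G ^ 8 = G ^ 200 * (G ^ 16)\<^sup>2"
        using G_pow_diff[of 8 240] by (simp add: power_add[symmetric] power_mult[symmetric])
      finally show ?thesis by simp
    qed
    ultimately show ?thesis by simp
  qed
  have 3: "2 * G ^ 16 * N * sqrt N * sqrt w \<le> N\<^sup>2 / G ^ 8"
  proof -
    have "2 * G ^ 16 * N * sqrt N * sqrt w \<le> 2 * G ^ 16 * N * sqrt N * (2 * sqrt N / G ^ 100)"
      using sqrt_w by (intro mult_left_mono) auto
    also have "\<dots> = 4 * N * (sqrt N * sqrt N) * (G ^ 16 / G ^ 100)" by simp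
    also have "\<dots> = 4 * N\<^sup>2 * (G ^ 16 / G ^ 100)" by (simp add: power2_eq_square)
    also have "G ^ 16 / G ^ 100 = 1 / G ^ 84"
      using G_pow_diff2[of 16 100] by simp
    also have "4 * N\<^sup>2 * (1 / G ^ 84) \<le> N\<^sup>2 / G ^ 8"
    proof -
      have "4 * G ^ 8 \<le> G * G ^ 8" using G100 by (intro mult_right_mono) auto
      also have "\<dots> = G ^ 9" by (simp flip: power_Suc)
      also have "\<dots> \<le> G ^ 84" by (rule G_pow_mono) simp
      finally have "4 * G ^ 8 / G ^ 84 \<le> 1" using G_pos by (simp add: divide_le_eq)
      then have "4 / G ^ 84 \<le> 1 / G ^ 8" using G_pos by (simp add: field_simps)
      then have "N\<^sup>2 * (4 / G ^ 84) \<le> N\<^sup>2 * (1 / G ^ 8)" by (intro mult_left_mono) auto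
      then show ?thesis by (simp add: ac_simps)
    qed
    finally show ?thesis .
  qed
  have "\<eta> / (G / (2 * x))\<^sup>2 = 4 * (x\<^sup>2 / G ^ 8)" for x
  proof -
    have "G ^ 8 = G ^ 6 * G\<^sup>2" by (simp add: power_add[symmetric])
    then show ?thesis by (simp add: power_divide power_mult_distrib)
  qed
  then have "\<eta> / \<rho>\<^sup>2 = 4 * (N\<^sup>2 / G ^ 8)" .
  then show ?thesis using 1 2 3 by linarith
qed

lemma M_le: "1 + \<rho> * N\<^sup>2 \<le> N\<^sup>2"
proof -
  have *: "G / (2 * x) * x\<^sup>2 = G * x / 2" if "0 < x" for x
    using that by (simp add: power2_eq_square)
  have "\<rho> * N\<^sup>2 = G * N / 2" by (rule *) simp
  also have "\<dots> \<le> N * N / 2" using G_le_N[of 1] by (intro divide_right_mono mult_right_mono) auto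
  finally have "\<rho> * N\<^sup>2 \<le> N\<^sup>2 / 2" by (simp add: power2_eq_square)
  moreover have "2 \<le> N\<^sup>2"
  proof -
    have "100 * 1 \<le> N * N" using G_le_N[of 1] G100 by (intro mult_mono) auto
    then show ?thesis by (simp add: power2_eq_square)
  qed
  ultimately show ?thesis by linarith
qed

lemma M_ge: "1 \<le> 1 + \<rho> * N\<^sup>2"
  using G_pos by simp

lemma M_pow: "(1 + \<rho> * N\<^sup>2) ^ i \<le> N ^ (2 * i)"
  using M_le M_ge power_mono[of "1 + \<rho> * N\<^sup>2" "N\<^sup>2" i] by (simp add: power_mult)

lemma q_ge4: "4 \<le> q"
proof -
  have "100 ^ 1 \<le> g ^ 1" using g100 by simp
  also have "\<dots> \<le> g ^ 8" using g100 by (intro power_increasing) auto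
  finally show ?thesis by simp
qed

lemma small_ineq1: "q * ((1 + \<rho> * N\<^sup>2) ^ (2 * q) * (5 * J * N\<^sup>2 * (2 * exp (- (G ^ 16) / 2)))) \<le> 10 * exp (- (G ^ 9))"
proof -
  have qN: "real q \<le> N" "real J \<le> N" using G_le_N[of 8] G_le_N[of 200] by simp_all
  have "q * ((1 + \<rho> * N\<^sup>2) ^ (2 * q) * (5 * J * N\<^sup>2 * (2 * exp (- (G ^ 16) / 2))))
     = 10 * (real q * (1 + \<rho> * N\<^sup>2) ^ (2 * q) * real J * N\<^sup>2) * exp (- (G ^ 16) / 2)" by simp
  also have "\<dots> \<le> 10 * (N * N ^ (2 * (2 * q)) * N * N\<^sup>2) * exp (- (G ^ 16) / 2)"
    using qN M_pow[of "2 * q"] M_ge by (intro mult_right_mono mult_left_mono mult_mono) auto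
  also have "N * N ^ (2 * (2 * q)) * N * N\<^sup>2 = N ^ (4 * q + 4)"
  proof -
    have eq: "4 * q + 4 = 1 + 2 * (2 * q) + 1 + 2" by simp
    show ?thesis unfolding eq by (simp only: power_add power_one_right)
  qed
  also have "10 * N ^ (4 * q + 4) * exp (- (G ^ 16) / 2) \<le> 10 * exp (- (G ^ 9))"
    using tiny[of "4 * q + 4"] q_ge4 by simp
  finally show ?thesis .
qed

lemma small_ineq2: "5 * J * N\<^sup>2 * (2 * exp (- (G ^ 16) / 2)) \<le> 10 * exp (- (G ^ 9))"
proof -
  have "real J \<le> N" using G_le_N[of 200] by simp
  then have "5 * J * N\<^sup>2 * (2 * exp (- (G ^ 16) / 2)) \<le> 5 * N * N\<^sup>2 * (2 * exp (- (G ^ 16) / 2))"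
    by (intro mult_right_mono mult_left_mono) auto
  also have "\<dots> = 10 * (N ^ 3 * exp (- (G ^ 16) / 2))" by (simp add: power2_eq_square power3_eq_cube)
  also have "\<dots> \<le> 10 * exp (- (G ^ 9))" using tiny[of 3] q_ge4 by (intro mult_left_mono) auto
  finally show ?thesis .
qed

lemma exp_neg_le: "12 \<le> x \<Longrightarrow> exp (- x) \<le> (1 / 4096 :: real)"
proof -
  assume "12 \<le> x"
  then have "exp (- x) \<le> exp (- 12)" by simp
  also have "\<dots> = (exp (- 1)) ^ 12" by (simp add: exp_of_nat_mult[symmetric])
  also have "\<dots> \<le> (1 / 2) ^ 12"
  proof (rule power_mono)
    have "(2::real) \<le> exp 1" using exp_ge_add_one_self[of 1] by simp
    then show "exp (- 1) \<le> (1 / 2 :: real)" by (simp add: exp_minus field_simps)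
  qed simp
  also have "\<dots> = (1 / 4096 :: real)" by (simp add: power_divide)
  finally show ?thesis .
qed

text \<open>The three factors are at most \<open>exp (G\<^sup>2)\<close>, 2 and
  \<open>12 * exp (8 * G - G ^ 6 / 2)\<close>; the last exponent dominates.\<close>

lemma small_ineq:
  "(1 + \<eta>) ^ q * (1 + q * ((1 + \<rho> * N\<^sup>2) ^ (2 * q) * (5 * real J * N\<^sup>2 * (2 * exp (- (G ^ 16) / 2))))) *
       (q * (5 * real J * N\<^sup>2 * (2 * exp (- (G ^ 16) / 2)) + 2 * exp (- (1 / \<eta>) / 2))) \<le> 1 / 4"
proof -
  have G9: "12 \<le> G ^ 9" using G_le_pow[of 9] G100 by linarith
  have "(1 + \<eta>) ^ q \<le> exp (\<eta>) ^ q" using exp_ge_add_one_self[of \<eta>] G_pos by (intro power_mono) auto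
  also have "\<dots> = exp (q * \<eta>)" by (rule exp_of_nat_mult[symmetric])
  also have "q * \<eta> = G\<^sup>2"
  proof -
    show ?thesis using G_pow_diff[of 6 8] by simp
  qed
  finally have 1: "(1 + \<eta>) ^ q \<le> exp (G\<^sup>2)" .
  have 2: "1 + q * ((1 + \<rho> * N\<^sup>2) ^ (2 * q) * (5 * real J * N\<^sup>2 * (2 * exp (- (G ^ 16) / 2)))) \<le> 2"
    using small_ineq1 exp_neg_le[OF G9] by simp
  have e9: "exp (- (G ^ 9)) \<le> exp (- (G ^ 6) / 2)"
  proof -
    have "G ^ 6 \<le> G ^ 9" by (rule G_pow_mono) simp
    moreover have "0 \<le> G ^ 6" by simp
    ultimately have "G ^ 6 / 2 \<le> G ^ 9" by linarith
    then show ?thesis by simp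
  qed
  have "1 / \<eta> = G ^ 6" by simp
  then have "exp (- (1 / \<eta>) / 2) = exp (- (G ^ 6) / 2)" by simp
  then have "5 * real J * N\<^sup>2 * (2 * exp (- (G ^ 16) / 2)) + 2 * exp (- (1 / \<eta>) / 2) \<le> 12 * exp (- (G ^ 6) / 2)"
    using small_ineq2 e9 unfolding of_nat_mult of_nat_numeral by linarith
  then have "q * (5 * real J * N\<^sup>2 * (2 * exp (- (G ^ 16) / 2)) + 2 * exp (- (1 / \<eta>) / 2)) \<le> q * (12 * exp (- (G ^ 6) / 2))"
    by (intro mult_left_mono) auto
  also have "\<dots> \<le> exp (8 * G) * (12 * exp (- (G ^ 6) / 2))"
  proof (rule mult_right_mono)
    have "G \<le> exp G" using exp_ge_add_one_self[of G] by linarith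
    then have "G ^ 8 \<le> exp G ^ 8" using G_pos by (intro power_mono) auto
    then show "real q \<le> exp (8 * G)" by (simp add: exp_of_nat_mult[symmetric])
  qed simp
  finally have 3: "q * (5 * real J * N\<^sup>2 * (2 * exp (- (G ^ 16) / 2)) + 2 * exp (- (1 / \<eta>) / 2)) \<le> exp (8 * G) * (12 * exp (- (G ^ 6) / 2))" .
  have "(1 + \<eta>) ^ q * (1 + q * ((1 + \<rho> * N\<^sup>2) ^ (2 * q) * (5 * real J * N\<^sup>2 * (2 * exp (- (G ^ 16) / 2))))) *
       (q * (5 * real J * N\<^sup>2 * (2 * exp (- (G ^ 16) / 2)) + 2 * exp (- (1 / \<eta>) / 2)))
     \<le> exp (G\<^sup>2) * 2 * (exp (8 * G) * (12 * exp (- (G ^ 6) / 2)))"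
    using G_pos by (intro mult_mono 1 2 3) auto
  also have "\<dots> = 24 * exp (- (G ^ 6 / 2 - G\<^sup>2 - 8 * G))" by (simp add: exp_add[symmetric] algebra_simps)
  also have "\<dots> \<le> 24 * (1 / 4096)"
  proof (intro mult_left_mono exp_neg_le)
    have a: "100 ^ 4 \<le> G ^ 4" using G100 by (intro power_mono) auto
    have "100000000 * G\<^sup>2 \<le> G ^ 4 * G\<^sup>2" using a by (intro mult_right_mono) auto
    moreover have "G ^ 4 * G\<^sup>2 = G ^ 6" by (simp add: power_add[symmetric])
    moreover have "100 * G \<le> G\<^sup>2" using G100 by (simp add: power2_eq_square)
    ultimately show "12 \<le> G ^ 6 / 2 - G\<^sup>2 - 8 * G" using G100 by linarith
  qed simp
  finally show ?thesis by simp
qed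

sublocale riesz n "G ^ 16" f q h J w \<rho> \<eta>
proof (unfold_locales)
  have G16: "1 \<le> G ^ 16" using G100 by (intro one_le_power) simp
  then show "1 \<le> G ^ 16" .
  show "n < q * h" "n < J * w"
  proof -
    have "0 < q" "0 < J" using g100 by auto
    then show "n < q * h" "n < J * w" using dividend_less_times_div by (simp_all add: algebra_simps)
  qed
  show "0 < \<rho>" "0 < \<eta>" using G_pos by auto
  show "real h * N + 4 * real J * (G ^ 16)\<^sup>2 * N * sqrt N * u + 2 * G ^ 16 * N * sqrt N * sqrt w \<le> \<eta> / \<rho>\<^sup>2"
    by (rule sq_ineq)
  interpret cube_tail n "G ^ 16" by unfold_locales (rule G16)
  show "(1 + \<eta>) ^ q * (1 + q * ((1 + \<rho> * N\<^sup>2) ^ (2 * q) * (5 * real J * N\<^sup>2 * p0))) *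
       (q * (5 * real J * N\<^sup>2 * p0 + 2 * exp (- (1 / \<eta>) / 2))) \<le> 1 / 4"
    unfolding p0_def by (rule small_ineq)
qed (use f in auto)

lemma rkN: "\<rho> * G ^ 16 * N = G ^ 17 / 2"
proof -
  have *: "G / (2 * x) * y * x = G * y / 2" if "0 < x" for x y
    using that by simp
  have "\<rho> * G ^ 16 * N = G * G ^ 16 / 2" by (rule *) simp
  also have "G * G ^ 16 = G ^ 17" by (simp flip: power_Suc)
  finally show ?thesis .
qed

lemma big: "1 \<le> \<rho> * G ^ 16 * N"
  unfolding rkN using G_le_pow[of 17] G100 by linarith

lemma q_xb: "q * xb \<le> 1 / G ^ 75"
proof -
  have *: "a * (2 * b / c) = 2 * (a * b) / c" for a b c :: real by simp
  have "sqrt (w * N) \<le> 2 * sqrt N / G ^ 100 * sqrt N"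
    unfolding real_sqrt_mult using sqrt_w by (intro mult_right_mono) auto
  also have "\<dots> = 2 * (sqrt N * sqrt N) / G ^ 100" by (simp only: times_divide_eq_left mult.assoc)
  also have "\<dots> = 2 * N / G ^ 100" by simp
  finally have "xb \<le> \<rho> * G ^ 16 * (2 * N / G ^ 100)"
    unfolding xb_def using G_pos by (intro mult_left_mono) auto
  also have "\<dots> = 2 * (\<rho> * G ^ 16 * N) / G ^ 100" by (rule *)
  also have "\<dots> = G ^ 17 / G ^ 100" unfolding rkN by simp
  finally have "q * xb \<le> q * (G ^ 17 / G ^ 100)" by (intro mult_left_mono) auto
  also have "\<dots> = G ^ 25 / G ^ 100" by (simp add: power_add[symmetric])
  also have "\<dots> = 1 / G ^ 75" using G_pow_diff2[of 25 100] by simp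
  finally show ?thesis .
qed

lemma err_tiny: "J\<^sup>2 * 4 ^ q * q ^ 4 * err \<le> 16 * exp (- (G ^ 9))"
proof -
  have qN: "real q \<le> N" "real J \<le> N" "4 \<le> N" using G_le_N[of 8] G_le_N[of 200] G_le_N[of 1] G100 by simp_all
  have "real J ^ 2 * 4 ^ q * real q ^ 4 * err
    = 16 * (real J ^ 2 * 4 ^ q * real q ^ 4 * (1 + \<rho> * N\<^sup>2) ^ q * real q * N ^ 3) * exp (- (G ^ 16) / 2)"
    unfolding err_def p0_def by simp
  also have "\<dots> \<le> 16 * (N ^ 2 * N ^ q * N ^ 4 * N ^ (2 * q) * N * N ^ 3) * exp (- (G ^ 16) / 2)"
    using qN M_pow[of q] M_ge by (intro mult_right_mono mult_left_mono mult_mono power_mono) auto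
  also have "N ^ 2 * N ^ q * N ^ 4 * N ^ (2 * q) * N * N ^ 3 = N ^ (2 + q + 4 + 2 * q + 1 + 3)"
    by (simp only: power_add power_one_right)
  also have "16 * N ^ (2 + q + 4 + 2 * q + 1 + 3) * exp (- (G ^ 16) / 2) \<le> 16 * exp (- (G ^ 9))"
    using tiny[of "2 + q + 4 + 2 * q + 1 + 3"] q_ge4 by simp
  finally show ?thesis by simp
qed

text \<open>Counting exponents of \<open>G\<close>: triples give \<open>200 - 3 * 75 = -25\<close>.
  Exact coincidences give 400 from the coarse blocks, 32 from the index sets and 68 from four
  trivial factors, against the 600 of \<open>u_ge\<close>. The latter is the source of
  \<open>2400 = 4 * 600\<close>, as Beck's gain is only a fourth root of \<open>N\<close>.\<close>

lemma E_bad_le_1: "nrm {T \<in> Tup full. bad T} \<le> 1"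
proof -
  have G75: "1 / G ^ 75 \<le> 1" using G_pow_mono[of 0 75] G_pos by (simp add: divide_le_eq)
  have qx: "q * xb \<le> 1" "0 \<le> q * xb" using q_xb G75 xb_nonneg by auto
  have J0: "0 \<le> real J" by simp
  have "(q * xb) ^ 3 \<le> (1 / G ^ 75) ^ 3" using q_xb qx by (intro power_mono)
  then have "J * (q * xb) ^ 3 \<le> J * (1 / G ^ 75) ^ 3" by (intro mult_left_mono) auto
  also have "\<dots> = G ^ 200 / G ^ 225" by (simp add: power_divide power_mult[symmetric])
  also have "\<dots> = 1 / G ^ 25" using G_pow_diff2[of 200 225] by simp
  also have "\<dots> \<le> 1 / G" using G_le_pow[of 25] G_pos by (intro divide_left_mono) auto
  also have "\<dots> \<le> 1 / 100" using G100 by (intro divide_left_mono) auto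
  finally have a: "J * (q * xb) ^ 3 \<le> 1 / 100" .
  have "(real J)\<^sup>2 * (q * xb) ^ 6 = (J * (q * xb) ^ 3) ^ 2" by (simp add: power_mult_distrib power_mult[symmetric])
  also have "\<dots> \<le> (1 / 100) ^ 2" using a qx by (intro power_mono) auto
  finally have b: "(real J)\<^sup>2 * (q * xb) ^ 6 \<le> 1 / 1000" by (simp add: power2_eq_square)
  have "(real J)\<^sup>2 * real q ^ 4 * yb \<le> 1 / 100"
  proof -
    have "x / x\<^sup>2 = 1 / x" for x :: real by (simp add: power2_eq_square)
    from this[of u] have "u / sqrt N = 1 / u" unfolding u_pow(2) .
    then have "yb = 2 * (G ^ 17 / 2) ^ 4 * (1 / u)" unfolding yb_def rkN by (metis times_divide_eq_right)
    also have "\<dots> = G ^ 68 / (8 * u)" by (simp add: power_divide power_mult[symmetric])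
    finally have "(real J)\<^sup>2 * real q ^ 4 * yb = G ^ 500 / (8 * u)"
      by (simp add: power_mult[symmetric] power_add[symmetric])
    also have "\<dots> \<le> G ^ 500 / G ^ 600"
    proof (rule divide_left_mono)
      show "G ^ 600 \<le> 8 * u" using u_ge u_pos by linarith
    qed (use G_pos u_pos in auto)
    also have "\<dots> = 1 / G ^ 100" using G_pow_diff2[of 500 600] by simp
    also have "\<dots> \<le> 1 / G" using G_le_pow[of 100] G_pos by (intro divide_left_mono) auto
    also have "\<dots> \<le> 1 / 100" using G100 by (intro divide_left_mono) auto
    finally show ?thesis .
  qed
  note c = this
  define e where "e = (real J)\<^sup>2 * 4 ^ q * real q ^ 4 * err"
  have G9: "12 \<le> G ^ 9" using G_le_pow[of 9] G100 by linarith
  have e: "e \<le> 1 / 100" using err_tiny exp_neg_le[OF G9] by (simp add: e_def)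
  have J1: "1 \<le> real J" "1 \<le> real q ^ 4" using G_pow_mono[of 0] by simp_all
  have JJ: "real J \<le> (real J)\<^sup>2"
    unfolding power2_eq_square using mult_left_mono[OF J1(1) J0] by (simp only: mult_1_right)
  have "real J * 2 ^ q * 1 \<le> (real J)\<^sup>2 * 4 ^ q * real q ^ 4"
    using JJ J1 by (intro mult_mono power_mono) auto
  then have e1: "real J * 2 ^ q * err \<le> e" unfolding e_def using err_nonneg by (intro mult_right_mono) auto
  have "(real J)\<^sup>2 * 4 ^ q * 1 \<le> (real J)\<^sup>2 * 4 ^ q * real q ^ 4"
    using J1 by (intro mult_left_mono) auto
  then have e2: "(real J)\<^sup>2 * 4 ^ q * err \<le> e" unfolding e_def using err_nonneg by (intro mult_right_mono) auto
  have "(real J)\<^sup>2 * 1 * real q ^ 4 \<le> (real J)\<^sup>2 * 4 ^ q * real q ^ 4"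
    by (intro mult_right_mono mult_left_mono) auto
  from mult_right_mono[OF this err_nonneg]
  have e3: "(real J)\<^sup>2 * real q ^ 4 * err \<le> e" unfolding e_def by (simp only: mult_1_right)
  have "2 * (J * (6 * (q * xb) ^ 3 + 2 ^ q * err)) + (real J)\<^sup>2 * (18 * (q * xb) ^ 6 + 4 ^ q * err) + 3 * ((real J)\<^sup>2 * (real q ^ 4 * (2 * yb + err)))
     = 12 * (J * (q * xb) ^ 3) + 18 * ((real J)\<^sup>2 * (q * xb) ^ 6) + 6 * ((real J)\<^sup>2 * real q ^ 4 * yb)
      + (2 * (real J * 2 ^ q * err) + (real J)\<^sup>2 * 4 ^ q * err + 3 * ((real J)\<^sup>2 * real q ^ 4 * err))"
    by (simp add: ring_distribs)
  also have "\<dots> \<le> 1" using a b c e e1 e2 e3 by linarith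
  finally show ?thesis using E_bad[OF big qx(1)] by linarith
qed

lemma large_bound:
  assumes "\<And>r c. r \<in> L \<Longrightarrow> lev c (r c) (g' r)" "\<And>B. \<bar>\<Sum>r\<in>L. g' r B\<bar> \<le> C"
  shows "\<bar>\<Sum>r\<in>L. E (\<lambda>B. f r B * g' r B)\<bar> \<le> 6 * N * C / G"
proof -
  have "\<rho> * \<bar>\<Sum>r\<in>L. E (\<lambda>B. f r B * g' r B)\<bar> \<le> 3 * C"
    by (rule riesz_bound[OF assms E_bad_le_1])
  then show ?thesis using G_pos by (simp add: field_simps)
qed

end

section \<open>From large parameters to all n\<close>

lemma (in cube) trivial_bound:
  assumes f: "\<And>r B. r \<in> L \<Longrightarrow> \<bar>f r B\<bar> \<le> 1" "\<And>r i. r \<in> L \<Longrightarrow> lev i (r i) (f r)"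
    and g: "\<And>r c. r \<in> L \<Longrightarrow> lev c (r c) (g r)" and C: "\<And>B. \<bar>\<Sum>r\<in>L. g r B\<bar> \<le> C"
  shows "\<bar>\<Sum>r\<in>L. E (\<lambda>B. f r B * g r B)\<bar> \<le> N\<^sup>2 * C"
proof -
  have C0: "0 \<le> C" using C[of "{}"] by linarith
  have "\<bar>E (\<lambda>B. f r B * g r B)\<bar> \<le> C" if r: "r \<in> L" for r
  proof -
    \<comment> \<open>Distinct vectors differ in some level, so \<open>f r\<close> is orthogonal to
      every \<open>g r'\<close> except \<open>g r\<close> and may be tested against the whole
      sum.\<close>
    have "E (\<lambda>B. f r B * (\<Sum>r'\<in>L. g r' B)) = (\<Sum>r'\<in>L. E (\<lambda>B. f r B * g r' B))"
      unfolding sum_distrib_left by (rule E_sum)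
    also have "\<dots> = (\<Sum>r'\<in>{r}. E (\<lambda>B. f r B * g r' B))"
    proof (rule sum.mono_neutral_right)
      show "\<forall>r'\<in>L - {r}. E (\<lambda>B. f r B * g r' B) = 0"
      proof
        fix r' assume r': "r' \<in> L - {r}"
        then obtain c where c: "r' c \<noteq> r c" by (auto simp: fun_eq_iff)
        show "E (\<lambda>B. f r B * g r' B) = 0"
          using r r' f g L_le by (intro E_lev_neq[OF _ _ c[symmetric]]) auto
      qed
    qed (use r in auto)
    finally have "E (\<lambda>B. f r B * g r B) = E (\<lambda>B. f r B * (\<Sum>r'\<in>L. g r' B))" by simp
    also have "\<bar>\<dots>\<bar> \<le> E (\<lambda>B. \<bar>f r B * (\<Sum>r'\<in>L. g r' B)\<bar>)" by (rule E_abs)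
    also have "\<dots> \<le> E (\<lambda>B. 1 * C)"
      unfolding abs_mult using f(1)[OF r] C by (intro E_mono mult_mono) auto
    finally show ?thesis by simp
  qed
  then have "(\<Sum>r\<in>L. \<bar>E (\<lambda>B. f r B * g r B)\<bar>) \<le> (\<Sum>r\<in>L. C)" by (intro sum_mono)
  also have "\<dots> = card L * C" by simp
  also have "\<dots> \<le> N\<^sup>2 * C" using card_subset_L[of L] C0 by (intro mult_right_mono) auto
  finally show ?thesis using sum_abs[of "\<lambda>r. E (\<lambda>B. f r B * g r B)" L] by linarith
qed

text \<open>24 is the factor 6 of \<open>large_bound\<close>, doubled for rounding the root of
  \<open>N\<close> down and doubled again for passing from \<open>n + 1\<close> to \<open>n\<close>.
  The power of 100 covers the \<open>n\<close> with \<open>g < 100\<close>, where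
  \<open>N\<^sup>2\<close> is at most \<open>100 ^ 4800\<close>.\<close>

definition small_ball_const :: real where
  "small_ball_const = 24 + 100 ^ 4800"

lemma small_ball_const: "24 \<le> small_ball_const" "(100 ^ 2400)\<^sup>2 \<le> small_ball_const"
proof -
  have eq: "(100 ^ 2400)\<^sup>2 = (100 ^ (2400 * 2) :: real)" by (rule power_mult[symmetric])
  have "(0::real) \<le> 100 ^ 4800" by (rule zero_le_power) linarith
  then show "24 \<le> small_ball_const" unfolding small_ball_const_def by linarith
  have "2400 * 2 = (4800 :: nat)" by simp
  then show "(100 ^ 2400)\<^sup>2 \<le> small_ball_const" unfolding eq small_ball_const_def by (simp only: le_add_same_cancel2)
qed

lemma (in cube) hyperbolic_bound:
  assumes n: "1 \<le> n"
    and f: "\<And>r B. r \<in> L \<Longrightarrow> \<bar>f r B\<bar> \<le> 1" "\<And>r i. r \<in> L \<Longrightarrow> lev i (r i) (f r)"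
    and g: "\<And>r c. r \<in> L \<Longrightarrow> lev c (r c) (g r)" and C: "\<And>B. \<bar>\<Sum>r\<in>L. g r B\<bar> \<le> C"
  shows "\<bar>\<Sum>r\<in>L. E (\<lambda>B. f r B * g r B)\<bar> \<le> small_ball_const * real n powr (1 - 1 / 2400) * C"
proof -
  have C0: "0 \<le> C" using C[of "{}"] by linarith
  define x where "x = root 2400 N"
  \<comment> \<open>The integer part of the root is less than 1 below it, hence at least half of it
    as soon as it reaches 100.\<close>
  define g' where "g' = nat \<lfloor>x\<rfloor>"
  have x: "0 \<le> x" "x ^ 2400 = N" by (simp_all add: x_def)
  have "real g' \<le> x" "x < real g' + 1" using x(1) by (simp_all add: g'_def)
  then have g': "real g' ^ 2400 \<le> N" "N < (real g' + 1) ^ 2400"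
    unfolding x(2)[symmetric] using x(1) by (auto intro: power_mono power_strict_mono)
  have n1: "1 \<le> real n powr (1 - 1 / 2400)" using n by (intro ge_one_powr_ge_zero) auto
  show ?thesis
  proof (cases "100 \<le> g'")
    case False
    define b where "b = (100 :: real) ^ 2400"
    have "N \<le> (real g' + 1) ^ 2400" using g'(2) by simp
    also have "\<dots> \<le> b" unfolding b_def using False by (intro power_mono) auto
    finally have "N\<^sup>2 \<le> b\<^sup>2" by (intro power_mono) auto
    also have "\<dots> \<le> small_ball_const * 1" unfolding b_def using small_ball_const(2) by (simp only: mult_1_right)
    also have "\<dots> \<le> small_ball_const * real n powr (1 - 1 / 2400)"
      using n1 small_ball_const(1) by (intro mult_left_mono) auto
    finally have "N\<^sup>2 * C \<le> small_ball_const * real n powr (1 - 1 / 2400) * C"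
      using C0 by (rule mult_right_mono)
    then show ?thesis using trivial_bound[OF f g C] by linarith
  next
    case True
    interpret P: parameters n g' f by unfold_locales (use True g' f in auto)
    have G: "0 < real g'" using True by simp
    have "N powr (1 / 2400) = x" unfolding x_def by (simp add: root_powr_inverse)
    then have "N powr (1 / 2400) \<le> 2 * real g'" using \<open>x < real g' + 1\<close> True by linarith
    then have "N powr (1 / 2400) * (6 * C * N powr (1 - 1 / 2400)) \<le> (2 * real g') * (6 * C * N powr (1 - 1 / 2400))"
      using C0 by (intro mult_right_mono) auto
    moreover have "N powr (1 / 2400) * (6 * C * N powr (1 - 1 / 2400)) = 6 * N * C"
    proof -
      have "N powr (1 / 2400) * N powr (1 - 1 / 2400) = N" by (simp add: powr_add[symmetric])
      then have "6 * C * (N powr (1 / 2400) * N powr (1 - 1 / 2400)) = 6 * C * N" by presburger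
      then show ?thesis by (simp only: ac_simps)
    qed
    moreover have "(2 * real g') * (6 * C * N powr (1 - 1 / 2400)) = 12 * N powr (1 - 1 / 2400) * C * real g'"
      by simp
    ultimately have "6 * N * C / real g' \<le> 12 * N powr (1 - 1 / 2400) * C"
      unfolding pos_divide_le_eq[OF G] by linarith
    also have "\<dots> \<le> 12 * (2 * real n powr (1 - 1 / 2400)) * C"
    proof (intro mult_right_mono mult_left_mono)
      have "N powr (1 - 1 / 2400) \<le> (2 * real n) powr (1 - 1 / 2400)" using n by (intro powr_mono2) auto
      also have "\<dots> = 2 powr (1 - 1 / 2400) * real n powr (1 - 1 / 2400)" by (simp add: powr_mult)
      also have "\<dots> \<le> 2 powr 1 * real n powr (1 - 1 / 2400)" by (intro mult_right_mono powr_mono) auto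
      finally show "N powr (1 - 1 / 2400) \<le> 2 * real n powr (1 - 1 / 2400)" by simp
    qed (use C0 in auto)
    also have "\<dots> = 24 * real n powr (1 - 1 / 2400) * C" by simp
    also have "\<dots> \<le> small_ball_const * real n powr (1 - 1 / 2400) * C"
      using small_ball_const(1) C0 by (intro mult_right_mono) auto
    finally show ?thesis using P.large_bound[OF g C] by linarith
  qed
qed

section \<open>Haar functions and bits\<close>

text \<open>The first \<open>m\<close> digits of coordinate \<open>i\<close>, read with the leading
  digit first: the position of the dyadic interval of side \<open>2^(-m)\<close> that contains the
  point. Digit \<open>m\<close> then tells the left half from the right half.\<close>

primrec code :: "nat \<Rightarrow> 3 \<Rightarrow> bits \<Rightarrow> nat" where
  "code 0 i B = 0"
| "code (Suc m) i B = 2 * code m i B + of_bool ((i, m) \<in> B)"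

definition sg :: "3 \<Rightarrow> nat \<Rightarrow> bits \<Rightarrow> real" where
  "sg i m B = (if (i, m) \<in> B then 1 else - 1)"

definition idx :: "(3 \<Rightarrow> nat) \<Rightarrow> bits \<Rightarrow> 3 \<Rightarrow> nat" where
  "idx r B = (\<lambda>i. code (r i) i B)"

definition sgs :: "(3 \<Rightarrow> nat) \<Rightarrow> bits \<Rightarrow> real" where
  "sgs r B = (\<Prod>i\<in>UNIV. sg i (r i) B)"

definition side :: "nat \<Rightarrow> nat \<Rightarrow> real set" where
  "side m a = {real a / 2 ^ m ..< (real a + 1) / 2 ^ m}"

definition rect :: "(3 \<Rightarrow> nat) \<Rightarrow> (3 \<Rightarrow> nat) \<Rightarrow> (real ^ 3) set" where
  "rect r a = {x. \<forall>i. x $ i \<in> side (r i) (a i)}"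

lemma code_lt: "code m i B < 2 ^ m"
  by (induction m) auto

lemma code_flip: "i' \<noteq> i \<or> m \<le> j \<Longrightarrow> code m i (flip (i', j) B) = code m i B"
  by (induction m) (auto simp: flip_def)

lemma sg_flip: "sg i m (flip (i, m) B) = - sg i m B" "(i', j) \<noteq> (i, m) \<Longrightarrow> sg i m (flip (i', j) B) = sg i m B"
  by (auto simp: sg_def flip_def)

lemma idx_flip: "r i \<le> j \<Longrightarrow> idx r (flip (i, j) B) = idx r B"
  unfolding idx_def by (rule ext) (metis code_flip)

lemma sgs_flip: "sgs r (flip (i, r i) B) = - sgs r B" "r i < j \<Longrightarrow> sgs r (flip (i, j) B) = sgs r B"
proof -
  have "sgs r B = sg i (r i) B * (\<Prod>i'\<in>UNIV - {i}. sg i' (r i') B)" for B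
    unfolding sgs_def by (rule prod.remove) auto
  moreover have "(\<Prod>i'\<in>UNIV - {i}. sg i' (r i') (flip (i, r i) B)) = (\<Prod>i'\<in>UNIV - {i}. sg i' (r i') B)"
    by (intro prod.cong) (auto simp: sg_flip)
  ultimately show "sgs r (flip (i, r i) B) = - sgs r B" by (simp add: sg_flip)
  assume "r i < j"
  then show "sgs r (flip (i, j) B) = sgs r B"
    unfolding sgs_def by (intro prod.cong) (auto simp: sg_def flip_def)
qed

text \<open>The coefficient may depend on the position of the rectangle, because that position is
  determined by digits strictly before those giving the sign. This covers both the coefficients
  themselves and their signs.\<close>

lemma lev_sgs: "lev i (r i) (\<lambda>B. c (idx r B) * sgs r B)"
  by (auto simp: lev_def below_def sgs_flip idx_flip)

lemma sgs_sq: "sgs r B * sgs r B = 1"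
  unfolding sgs_def prod.distrib[symmetric] by (intro prod.neutral) (auto simp: sg_def)

lemma abs_sgs: "\<bar>sgs r B\<bar> = 1"
  unfolding sgs_def abs_prod by (intro prod.neutral) (auto simp: sg_def)

lemma side_pos: "real a / 2 ^ m < (real a + 1) / 2 ^ m"
  by (simp add: divide_strict_right_mono)

lemma side_code: "x \<in> side (m + d) (code (m + d) i B) \<Longrightarrow> x \<in> side m (code m i B)"
proof (induction d)
  case 0
  then show ?case by simp
next
  case (Suc d)
  have "x \<in> side (m + d) (code (m + d) i B)"
  proof -
    define c b p where "c = real (code (m + d) i B)" and "b = (of_bool ((i, m + d) \<in> B) :: real)" and "p = (2 :: real) ^ (m + d)"
    have p: "0 < p" by (simp add: p_def)
    have "(2 * c + b) / (2 * p) \<le> x" "x < (2 * c + b + 1) / (2 * p)"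
      using Suc.prems by (simp_all add: side_def c_def b_def p_def)
    then have "2 * c + b \<le> x * (2 * p)" "x * (2 * p) < 2 * c + b + 1"
      using p by (simp_all add: divide_le_eq less_divide_eq)
    moreover have "0 \<le> b" "b \<le> 1" by (auto simp: b_def)
    ultimately have "c \<le> x * p" "x * p < c + 1" by (linarith, linarith)
    then show ?thesis using p by (simp add: side_def c_def p_def divide_le_eq less_divide_eq)
  qed
  then show ?case by (rule Suc.IH)
qed

lemma side_disjoint: "x \<in> side m a \<Longrightarrow> x \<in> side m b \<Longrightarrow> a = b"
proof -
  assume "x \<in> side m a" "x \<in> side m b"
  then have "real a \<le> x * 2 ^ m" "x * 2 ^ m < real a + 1" "real b \<le> x * 2 ^ m" "x * 2 ^ m < real b + 1"
    by (simp_all add: side_def divide_le_eq less_divide_eq)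
  then show "a = b" by linarith
qed

lemma Inf_side: "Inf (side m a) = real a / 2 ^ m" and Sup_side: "Sup (side m a) = (real a + 1) / 2 ^ m"
  unfolding side_def using side_pos by (auto intro: cInf_atLeastLessThan cSup_atLeastLessThan)

lemma halves_side: "left_half (side m a) = side (Suc m) (2 * a)" "right_half (side m a) = side (Suc m) (2 * a + 1)"
proof -
  have mid: "(real a / 2 ^ m + (real a + 1) / 2 ^ m) / 2 = (2 * real a + 1) / 2 ^ Suc m"
    by (simp add: add_divide_distrib[symmetric])
  have ends: "real a / 2 ^ m = (2 * real a) / 2 ^ Suc m" "(real a + 1) / 2 ^ m = (2 * real a + 2) / 2 ^ Suc m"
    by (simp_all add: field_simps)
  show "left_half (side m a) = side (Suc m) (2 * a)"
    unfolding left_half_def Inf_side Sup_side mid unfolding ends side_def by (simp add: add.commute)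
  show "right_half (side m a) = side (Suc m) (2 * a + 1)"
    unfolding right_half_def Inf_side Sup_side mid unfolding ends side_def by (simp add: add.commute)
qed

text \<open>The strict inequality \<open>m < M\<close> matters: an interval of side
  \<open>2^(-M)\<close> must already know digit \<open>m\<close>, which decides in which half it
  lies.\<close>

lemma haar_side:
  assumes "x \<in> side M (code M i B)" "m < M"
  shows "haar (side m a) x = of_bool (code m i B = a) * sg i m B"
proof -
  have x: "x \<in> side (Suc m) (code (Suc m) i B)"
    using side_code[of x "Suc m" "M - Suc m" i B] assms by simp
  have l: "x \<in> side (Suc m) (2 * a) \<longleftrightarrow> code m i B = a \<and> (i, m) \<notin> B"
    using x side_disjoint[OF x, of "2 * a"] by (auto simp: of_bool_def split: if_splits) presburger+
  have r: "x \<in> side (Suc m) (2 * a + 1) \<longleftrightarrow> code m i B = a \<and> (i, m) \<in> B"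
    using x side_disjoint[OF x, of "2 * a + 1"] by (auto simp: of_bool_def split: if_splits) presburger+
  show ?thesis unfolding haar_def halves_side using l r by (auto simp: sg_def indicator_def)
qed

lemma rect_factor_rect: "rect_factor (rect r a) i = side (r i) (a i)"
proof
  show "rect_factor (rect r a) i \<subseteq> side (r i) (a i)" by (auto simp: rect_factor_def rect_def)
  show "side (r i) (a i) \<subseteq> rect_factor (rect r a) i"
  proof
    fix y assume y: "y \<in> side (r i) (a i)"
    define x :: "real ^ 3" where "x = (\<chi> j. if j = i then y else real (a j) / 2 ^ r j)"
    have "x \<in> rect r a" using y side_pos by (auto simp: rect_def x_def side_def)
    moreover have "x $ i = y" by (simp add: x_def)
    ultimately show "y \<in> rect_factor (rect r a) i" by (auto simp: rect_factor_def)
  qed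
qed

lemma side_eq_iff: "side m a = side m' a' \<longleftrightarrow> m = m' \<and> a = a'"
proof
  assume eq: "side m a = side m' a'"
  have e: "real a / 2 ^ m = real a' / 2 ^ m'" "(real a + 1) / 2 ^ m = (real a' + 1) / 2 ^ m'"
    using arg_cong[OF eq, of Inf] arg_cong[OF eq, of Sup] by (simp_all add: Inf_side Sup_side)
  then have "1 / 2 ^ m = 1 / (2 ^ m' :: real)" by (simp add: add_divide_distrib)
  then have "m = m'" by simp
  then show "m = m' \<and> a = a'" using e(1) by simp
qed simp

lemma rect_eq_iff: "rect r a = rect r' a' \<longleftrightarrow> r = r' \<and> a = a'"
proof
  assume "rect r a = rect r' a'"
  then have "side (r i) (a i) = side (r' i) (a' i)" for i using rect_factor_rect by metis
  then show "r = r' \<and> a = a'" by (auto simp: side_eq_iff)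
qed simp

text \<open>The half-open box is squeezed between the open and the closed box, which have the same
  measure.\<close>

lemma measure_product:
  fixes l u :: "real ^ 3"
  assumes "\<And>i. l $ i \<le> u $ i"
  shows "{x. \<forall>i. l $ i \<le> x $ i \<and> x $ i < u $ i} \<in> sets lborel" (is "?R \<in> _")
    and "emeasure lborel {x. \<forall>i. l $ i \<le> x $ i \<and> x $ i < u $ i} = ennreal (\<Prod>i\<in>UNIV. u $ i - l $ i)"
proof -
  have "?R = (\<Inter>i\<in>UNIV. {x. l $ i \<le> x $ i} \<inter> {x. x $ i < u $ i})" by auto
  also have "\<dots> \<in> sets borel"
    by (intro sets.finite_INT borel_closed[THEN sets.Int[OF _ borel_open]])
      (auto intro!: closed_Collect_le open_Collect_less continuous_intros)
  finally show R: "?R \<in> sets lborel" by simp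
  have c: "cbox l u \<noteq> {}" using assms by (simp add: interval_ne_empty_cart)
  have prod: "measure lborel (cbox l u) = (\<Prod>i\<in>UNIV. u $ i - l $ i)" by (rule content_cbox_cart[OF c])
  have "emeasure lborel (box l u) \<le> emeasure lborel ?R"
    using R by (intro emeasure_mono) (auto simp: mem_box_cart less_imp_le)
  moreover have "emeasure lborel ?R \<le> emeasure lborel (cbox l u)"
    by (intro emeasure_mono) (auto simp: mem_box_cart less_imp_le)
  moreover have "emeasure lborel (box l u) = emeasure lborel (cbox l u)"
    by (simp add: emeasure_lborel_box_eq emeasure_lborel_cbox_eq)
  ultimately have "emeasure lborel ?R = emeasure lborel (cbox l u)" by simp
  also have "\<dots> = ennreal (measure lborel (cbox l u))"
    by (intro emeasure_eq_ennreal_measure) (simp add: emeasure_lborel_cbox_eq)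
  finally show "emeasure lborel ?R = ennreal (\<Prod>i\<in>UNIV. u $ i - l $ i)" using prod by simp
qed

lemma rect_product: "rect r a = {x. \<forall>i. (\<chi> i. real (a i) / 2 ^ r i) $ i \<le> x $ i \<and> x $ i < (\<chi> i. (real (a i) + 1) / 2 ^ r i) $ i}"
  by (auto simp: rect_def side_def)

lemma emeasure_rect: "rect r a \<in> sets lborel" "emeasure lborel (rect r a) = ennreal (\<Prod>i\<in>UNIV. 1 / 2 ^ r i)"
proof -
  have le: "(\<chi> i. real (a i) / 2 ^ r i :: real ^ 3) $ i \<le> (\<chi> i. (real (a i) + 1) / 2 ^ r i) $ i" for i
    using side_pos[of "a i" "r i"] by simp
  show "rect r a \<in> sets lborel" unfolding rect_product by (rule measure_product(1)[OF le])
  show "emeasure lborel (rect r a) = ennreal (\<Prod>i\<in>UNIV. 1 / 2 ^ r i)"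
    unfolding rect_product measure_product(2)[OF le] by (simp add: diff_divide_distrib[symmetric])
qed

lemma measure_rect: "measure lborel (rect r a) = 1 / 2 ^ (r 1 + r 2 + r 3)"
proof -
  have "measure lborel (rect r a) = (\<Prod>i\<in>UNIV. 1 / 2 ^ r i)"
    unfolding measure_def emeasure_rect(2) by (simp add: prod_nonneg)
  also have "\<dots> = 1 / 2 ^ (r 1 + r 2 + r 3)"
    unfolding UNIV_3 by (simp add: power_add)
  finally show ?thesis .
qed

section \<open>Dyadic rectangles, cells and the essential supremum\<close>

context cube
begin

abbreviation codes :: "(3 \<Rightarrow> nat) \<Rightarrow> (3 \<Rightarrow> nat) set" where
  "codes r \<equiv> Pi\<^sub>E UNIV (\<lambda>i. {..<2 ^ r i})"

lemma rect_subset: "a \<in> codes r \<Longrightarrow> rect r a \<subseteq> cbox 0 1"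
proof
  fix x assume a: "a \<in> codes r" and x: "x \<in> rect r a"
  have "0 \<le> x $ i \<and> x $ i \<le> 1" for i
  proof -
    have "a i < 2 ^ r i" using a by auto
    then have "real (a i) + 1 \<le> 2 ^ r i" by (metis Suc_leI of_nat_Suc of_nat_le_iff of_nat_numeral of_nat_power add.commute)
    then have "(real (a i) + 1) / 2 ^ r i \<le> 1" by simp
    moreover have "real (a i) / 2 ^ r i \<le> x $ i" "x $ i < (real (a i) + 1) / 2 ^ r i" using x by (auto simp: rect_def side_def)
    moreover have "0 \<le> real (a i) / 2 ^ r i" by simp
    ultimately show ?thesis by linarith
  qed
  then show "x \<in> cbox 0 1" by (simp add: mem_box_cart)
qed

lemma dyadic_rectangles_eq: "dyadic_rectangles n = (\<lambda>(r, a). rect r a) ` Sigma L codes"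
proof (intro set_eqI iffI)
  fix R :: "(real ^ 3) set" assume "R \<in> (\<lambda>(r, a). rect r a) ` Sigma L codes"
  then obtain r a where ra: "r \<in> L" "a \<in> codes r" "R = rect r a" by auto
  have "dyadic_interval (side m b)" for m b
  proof -
    have "side m b = {of_int (int b) * 2 powi (- int m) ..< of_int (int b + 1) * 2 powi (- int m)}"
      by (simp add: side_def power_int_minus divide_inverse)
    then show ?thesis unfolding dyadic_interval_def by blast
  qed
  then have "dyadic_rectangle R" unfolding dyadic_rectangle_def ra(3) rect_def
    by (intro exI[of _ "\<lambda>i. side (r i) (a i)"]) simp
  moreover have "measure lborel R = 2 powi (- int n)"
    using ra(1) by (simp add: ra(3) measure_rect L_def power_int_minus divide_inverse)
  ultimately show "R \<in> dyadic_rectangles n" using rect_subset[OF ra(2)] by (simp add: dyadic_rectangles_def ra(3))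
next
  fix R :: "(real ^ 3) set" assume "R \<in> dyadic_rectangles n"
  then have R: "dyadic_rectangle R" "R \<subseteq> cbox 0 1" "measure lborel R = 2 powi (- int n)"
    by (auto simp: dyadic_rectangles_def)
  obtain I where I: "\<And>i. dyadic_interval (I i)" "R = {x. \<forall>i. x $ i \<in> I i}"
    using R(1) by (auto simp: dyadic_rectangle_def)
  obtain j k where jk: "\<And>i. I i = {of_int (j i) * 2 powi k i ..< of_int (j i + 1) * 2 powi k i}"
    using I(1) unfolding dyadic_interval_def by metis
  have lt: "of_int (j i) * 2 powi k i < (of_int (j i + 1) * 2 powi k i :: real)" for i by simp
  have bounds: "0 \<le> y \<and> y \<le> 1" if y: "y \<in> I i" for y i
  proof -
    \<comment> \<open>The other coordinates sit at the left endpoints of their intervals, so the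
      point lies in \<open>R\<close> and the inclusion in the cube can be read off in coordinate
      \<open>i\<close>.\<close>
    define x :: "real ^ 3" where "x = (\<chi> i'. if i' = i then y else of_int (j i') * 2 powi k i')"
    have "x \<in> R" unfolding I(2) using y lt by (auto simp: x_def jk)
    then have "x \<in> cbox 0 1" using R(2) by blast
    then have "0 \<le> x $ i \<and> x $ i \<le> 1" by (simp add: mem_box_cart)
    then show ?thesis by (simp add: x_def)
  qed
  have j0: "0 \<le> j i" for i
  proof -
    have "0 \<le> of_int (j i) * (2 powi k i :: real)" using bounds[of "of_int (j i) * 2 powi k i" i] lt[of i] by (simp add: jk)
    moreover have "0 < (2 powi k i :: real)" by simp
    ultimately have "0 \<le> (of_int (j i) :: real)" by (metis not_le mult_neg_pos)
    then show ?thesis by simp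
  qed
  \<comment> \<open>The right endpoint does not belong to the interval, so it is reached as a
    supremum of interior points.\<close>
  have j1: "of_int (j i + 1) * 2 powi k i \<le> (1::real)" for i
  proof (rule dense_le_bounded[OF lt[of i]])
    fix y :: real assume "of_int (j i) * 2 powi k i < y" "y < of_int (j i + 1) * 2 powi k i"
    then show "y \<le> 1" using bounds[of y i] by (simp add: jk)
  qed
  have k0: "k i \<le> 0" for i
  proof (rule ccontr)
    assume "\<not> k i \<le> 0"
    then have "(2::real) powi 1 \<le> 2 powi k i" by (intro power_int_increasing) auto
    moreover have "1 * (2 powi k i) \<le> of_int (j i + 1) * (2 powi k i :: real)" using j0[of i] by (intro mult_right_mono) auto
    ultimately show False using j1[of i] by simp
  qed
  define r a where "r i = nat (- k i)" and "a i = nat (j i)" for i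
  have pow: "(2 powi k i :: real) = 1 / 2 ^ r i" for i
  proof -
    have "k i = - int (r i)" using k0[of i] by (simp add: r_def)
    then show ?thesis by (simp add: power_int_minus divide_inverse)
  qed
  have ja: "of_int (j i) = real (a i)" for i using j0[of i] by (simp add: a_def)
  have "I i = side (r i) (a i)" for i
    unfolding jk side_def pow of_int_add ja by simp
  then have Rr: "R = rect r a" by (simp add: I(2) rect_def)
  have "a i < 2 ^ r i" for i
  proof -
    have "(real (a i) + 1) / 2 ^ r i \<le> 1" using j1[of i] unfolding pow of_int_add ja by simp
    then have "real (a i) + 1 \<le> 2 ^ r i" by (simp add: divide_le_eq)
    then have "real (a i) < 2 ^ r i" by linarith
    then show ?thesis by (metis of_nat_less_iff of_nat_numeral of_nat_power)
  qed
  moreover have "r \<in> L"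
  proof -
    have "1 / 2 ^ (r 1 + r 2 + r 3) = (1 / 2 ^ n :: real)"
      using R(3) unfolding Rr measure_rect by (simp add: power_int_minus divide_inverse)
    then show ?thesis by (simp add: L_def)
  qed
  ultimately show "R \<in> (\<lambda>(r, a). rect r a) ` Sigma L codes" unfolding Rr by (intro image_eqI[of _ _ "(r, a)"]) auto
qed

lemma sum_dyadic_rectangles: "(\<Sum>R\<in>dyadic_rectangles n. \<phi> R) = (\<Sum>r\<in>L. \<Sum>a\<in>codes r. \<phi> (rect r a))"
proof -
  have "inj_on (\<lambda>(r, a). rect r a) (Sigma L codes)" by (auto simp: inj_on_def rect_eq_iff)
  then have "(\<Sum>R\<in>dyadic_rectangles n. \<phi> R) = (\<Sum>(r, a)\<in>Sigma L codes. \<phi> (rect r a))"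
    unfolding dyadic_rectangles_eq by (subst sum.reindex) (auto simp: case_prod_unfold)
  then show ?thesis by (simp add: sum.Sigma finite_PiE)
qed

lemma idx_codes: "idx r B \<in> codes r"
  by (auto simp: idx_def code_lt)

text \<open>Side \<open>2^(-(n + 1))\<close>, since a Haar function of level \<open>n\<close>
  changes its sign at the midpoint of an interval of side \<open>2^(-n)\<close>. On a cell every
  Haar function in question is constant.\<close>

definition cell :: "bits \<Rightarrow> (real ^ 3) set" where
  "cell B = rect (\<lambda>i. Suc n) (idx (\<lambda>i. Suc n) B)"

lemma haar_rect_cell:
  assumes "x \<in> cell B" "r \<in> L"
  shows "haar_rect (rect r a) x = of_bool (idx r B = a) * sgs r B"
proof -
  have "haar (side (r i) (a i)) (x $ i) = of_bool (code (r i) i B = a i) * sg i (r i) B" for i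
    using assms(1) L_le[OF assms(2), of i] by (intro haar_side[of _ "Suc n"]) (auto simp: cell_def rect_def idx_def)
  then have "haar_rect (rect r a) x = (\<Prod>i\<in>UNIV. of_bool (code (r i) i B = a i)) * sgs r B"
    unfolding haar_rect_def rect_factor_rect sgs_def prod.distrib[symmetric] by simp
  also have "(\<Prod>i\<in>UNIV. of_bool (code (r i) i B = a i) :: real) = of_bool (idx r B = a)"
  proof (cases "idx r B = a")
    case True
    then show ?thesis by (auto simp: idx_def)
  next
    case False
    then obtain i where "code (r i) i B \<noteq> a i" by (auto simp: idx_def fun_eq_iff)
    then show ?thesis using False by (auto intro!: prod_zero)
  qed
  finally show ?thesis .
qed

lemma sum_haar_cell:
  assumes "x \<in> cell B"
  shows "(\<Sum>R\<in>dyadic_rectangles n. \<alpha> R * haar_rect R x) = (\<Sum>r\<in>L. \<alpha> (rect r (idx r B)) * sgs r B)"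
proof -
  have "(\<Sum>a\<in>codes r. \<alpha> (rect r a) * haar_rect (rect r a) x) = \<alpha> (rect r (idx r B)) * sgs r B" if "r \<in> L" for r
  proof -
    have "(\<Sum>a\<in>codes r. \<alpha> (rect r a) * haar_rect (rect r a) x) = (\<Sum>a\<in>codes r. if idx r B = a then \<alpha> (rect r a) * sgs r B else 0)"
      using haar_rect_cell[OF assms that] by (intro sum.cong) auto
    then show ?thesis using idx_codes[of r B] by (simp add: sum.delta finite_PiE)
  qed
  then show ?thesis unfolding sum_dyadic_rectangles by simp
qed

text \<open>The sum is constant on a cell, and a cell has positive measure, so its value there
  cannot exceed the essential supremum.\<close>

lemma cell_le_Linf: "ereal \<bar>\<Sum>r\<in>L. \<alpha> (rect r (idx r B)) * sgs r B\<bar> \<le> Linf_norm (\<lambda>x. \<Sum>R\<in>dyadic_rectangles n. \<alpha> R * haar_rect R x)"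
proof (rule ccontr)
  assume no: "\<not> ?thesis"
  let ?H = "\<lambda>x. \<Sum>R\<in>dyadic_rectangles n. \<alpha> R * haar_rect R x"
  have sub: "cell B \<subseteq> cbox 0 1" unfolding cell_def by (rule rect_subset[OF idx_codes])
  have "AE x in restrict_space lborel (cbox 0 1). ereal \<bar>?H x\<bar> \<le> Linf_norm ?H"
    unfolding Linf_norm_def by (rule esssup_AE)
  then have "AE x in lborel. x \<in> cbox 0 1 \<longrightarrow> ereal \<bar>?H x\<bar> \<le> Linf_norm ?H"
    by (subst (asm) AE_restrict_space_iff) auto
  moreover have "\<not> ereal \<bar>?H x\<bar> \<le> Linf_norm ?H" if "x \<in> cell B" for x
    using no unfolding sum_haar_cell[OF that] .
  ultimately have "AE x in lborel. x \<notin> cell B"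
    using sub by (auto elim!: eventually_mono)
  then have "emeasure lborel (cell B) = 0"
    using emeasure_rect(1) unfolding cell_def by (subst (asm) AE_iff_measurable[OF _ refl]) auto
  moreover have "0 < emeasure lborel (cell B)"
    unfolding cell_def emeasure_rect(2) by (simp add: prod_pos)
  ultimately show False by simp
qed

text \<open>Every further prescribed digit halves the mean, because flipping that digit exchanges
  the two possibilities and leaves all other factors alone. The factor \<open>X\<close> allows one
  coordinate to be treated after the other.\<close>

lemma E_code:
  assumes "m \<le> Suc n" "a < 2 ^ m" "below i 0 X"
  shows "E (\<lambda>B. of_bool (code m i B = a) * X B) = E X / 2 ^ m"
  using assms(1,2)
proof (induction m arbitrary: a)
  case 0
  then show ?case by simp
next
  case (Suc m)
  define Y where "Y B = of_bool (code m i B = a div 2) * X B" for B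
  define b where "b B = (of_bool ((i, m) \<in> B \<longleftrightarrow> odd a) :: real)" for B :: bits
  have eq: "of_bool (code (Suc m) i B = a) * X B = Y B * b B" for B
  proof -
    have "code (Suc m) i B = a \<longleftrightarrow> code m i B = a div 2 \<and> ((i, m) \<in> B \<longleftrightarrow> odd a)"
      by (cases "(i, m) \<in> B") (simp_all, presburger+)
    then show ?thesis by (simp add: Y_def b_def)
  qed
  have Yf: "Y (flip (i, m) B) = Y B" for B using assms(3) by (simp add: Y_def code_flip below_def)
  have bf: "b (flip (i, m) B) = 1 - b B" for B by (auto simp: b_def flip_def)
  have "E (\<lambda>B. Y B * b B) = E (\<lambda>B. Y B * (1 - b B))"
    using E_flip[of m "\<lambda>B. Y B * b B" i] Suc.prems by (simp add: Yf bf)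
  also have "\<dots> = E Y - E (\<lambda>B. Y B * b B)" unfolding E_diff[symmetric] by (simp add: right_diff_distrib)
  finally have "E (\<lambda>B. Y B * b B) = E Y / 2" by simp
  moreover have "E Y = E X / 2 ^ m" unfolding Y_def using Suc.prems by (intro Suc.IH) auto
  ultimately show ?case unfolding eq by simp
qed

lemma E_idx:
  assumes "r \<in> L" "a \<in> codes r"
  shows "E (\<lambda>B. of_bool (idx r B = a)) = 1 / 2 ^ n"
proof -
  have le: "r i \<le> Suc n" and lt: "a i < 2 ^ r i" for i using L_le[OF assms(1), of i] assms(2) by auto
  have eq: "of_bool (idx r B = a) = (of_bool (code (r 1) 1 B = a 1) * (of_bool (code (r 2) 2 B = a 2) * (of_bool (code (r 3) 3 B = a 3) * 1)) :: real)" for B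
    by (auto simp: idx_def fun_eq_iff forall_3)
  have i: "below i 0 (\<lambda>B. of_bool (code m i' B = c))" if "i \<noteq> i'" for i i' m c
    using that by (simp add: below_def code_flip)
  have "E (\<lambda>B. of_bool (idx r B = a)) = E (\<lambda>B. of_bool (code (r 2) 2 B = a 2) * (of_bool (code (r 3) 3 B = a 3) * 1)) / 2 ^ r 1"
    unfolding eq by (intro E_code le lt below_mult i below_const) auto
  also have "E (\<lambda>B. of_bool (code (r 2) 2 B = a 2) * (of_bool (code (r 3) 3 B = a 3) * 1)) = E (\<lambda>B. of_bool (code (r 3) 3 B = a 3) * 1) / 2 ^ r 2"
    by (intro E_code le lt below_mult i below_const) auto
  also have "E (\<lambda>B. of_bool (code (r 3) 3 B = a 3) * 1) = E (\<lambda>B. 1) / 2 ^ r 3"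
    by (intro E_code le lt below_const)
  finally show ?thesis using assms(1) by (simp add: L_def power_add[symmetric] add.commute)
qed

lemma E_comp_idx:
  assumes "r \<in> L"
  shows "E (\<lambda>B. \<phi> (idx r B)) = (\<Sum>a\<in>codes r. \<phi> a) / 2 ^ n"
proof -
  have "\<phi> (idx r B) = (\<Sum>a\<in>codes r. \<phi> a * of_bool (idx r B = a))" for B
  proof -
    have "(\<Sum>a\<in>codes r. \<phi> a * of_bool (idx r B = a)) = (\<Sum>a\<in>codes r. if idx r B = a then \<phi> a else 0)"
      by (intro sum.cong) auto
    then show ?thesis using idx_codes[of r B] by (simp add: sum.delta finite_PiE)
  qed
  then have "E (\<lambda>B. \<phi> (idx r B)) = (\<Sum>a\<in>codes r. \<phi> a * E (\<lambda>B. of_bool (idx r B = a)))"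
    unfolding E_cmult[symmetric] E_sum[symmetric] by presburger
  also have "\<dots> = (\<Sum>a\<in>codes r. \<phi> a / 2 ^ n)" using E_idx[OF assms] by (intro sum.cong) auto
  finally show ?thesis by (simp add: sum_divide_distrib)
qed

lemma small_ball:
  fixes \<alpha> :: "(real ^ 3) set \<Rightarrow> real"
  assumes n: "1 \<le> n"
  shows "ereal (2 powi (- int n) * (\<Sum>R\<in>dyadic_rectangles n. \<bar>\<alpha> R\<bar>))
      \<le> ereal (small_ball_const * real n powr (1 - 1 / 2400))
          * Linf_norm (\<lambda>x. \<Sum>R\<in>dyadic_rectangles n. \<alpha> R * haar_rect R x)"
proof -
  let ?K = "small_ball_const * real n powr (1 - 1 / 2400)"
  define l where "l = Linf_norm (\<lambda>x. \<Sum>R\<in>dyadic_rectangles n. \<alpha> R * haar_rect R x)"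
  \<comment> \<open>With the sign of the coefficient in front, the product of \<open>f r\<close> and
    \<open>g r\<close> is the absolute coefficient of the rectangle of exponent \<open>r\<close>
    containing the point; its mean is the normalised sum over these rectangles.\<close>
  define f where "f r B = sgn (\<alpha> (rect r (idx r B))) * sgs r B" for r B
  define g where "g r B = \<alpha> (rect r (idx r B)) * sgs r B" for r B
  have g_le: "ereal \<bar>\<Sum>r\<in>L. g r B\<bar> \<le> l" for B unfolding g_def l_def by (rule cell_le_Linf)
  have Kpos: "0 < ?K" using n small_ball_const(1) by (intro mult_pos_pos) auto
  have l0: "0 \<le> l" using g_le[of "{}"] by (meson abs_ge_zero ereal_less_eq(5) order_trans)
  show ?thesis
  proof (cases "l = \<infinity>")
    \<comment> \<open>The sum has not been shown to be bounded, so an infinite norm is possible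
      here; strict positivity of the constant keeps the right-hand side infinite.\<close>
    case True
    have "ereal c * \<infinity> = \<infinity>" if "0 < c" for c using that by simp
    from this[OF Kpos] show ?thesis unfolding l_def[symmetric] True by (simp only: ereal_less_eq)
  next
    case False
    then obtain C where C: "l = ereal C" using l0 by (cases l) auto
    have f1: "\<bar>f r B\<bar> \<le> 1" for r B by (simp add: f_def abs_mult abs_sgs sgn_if)
    have f2: "lev i (r i) (f r)" for r i unfolding f_def by (rule lev_sgs[of _ _ "\<lambda>a. sgn (\<alpha> (rect r a))"])
    have g2: "lev i (r i) (g r)" for r i unfolding g_def by (rule lev_sgs[of _ _ "\<lambda>a. \<alpha> (rect r a)"])
    have "\<bar>\<Sum>r\<in>L. g r B\<bar> \<le> C" for B using g_le[of B] unfolding C by simp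
    then have "\<bar>\<Sum>r\<in>L. E (\<lambda>B. f r B * g r B)\<bar> \<le> ?K * C"
      by (intro hyperbolic_bound[OF n f1 f2 g2])
    moreover have "(\<Sum>r\<in>L. E (\<lambda>B. f r B * g r B)) = 2 powi (- int n) * (\<Sum>R\<in>dyadic_rectangles n. \<bar>\<alpha> R\<bar>)"
    proof -
      have "f r B * g r B = \<bar>\<alpha> (rect r (idx r B))\<bar>" for r B
      proof -
        have "f r B * g r B = (sgn (\<alpha> (rect r (idx r B))) * \<alpha> (rect r (idx r B))) * (sgs r B * sgs r B)"
          by (simp only: f_def g_def ac_simps)
        then show ?thesis unfolding sgs_sq by (simp add: abs_sgn mult.commute)
      qed
      then have "(\<Sum>r\<in>L. E (\<lambda>B. f r B * g r B)) = (\<Sum>r\<in>L. (\<Sum>a\<in>codes r. \<bar>\<alpha> (rect r a)\<bar>) / 2 ^ n)"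
        using E_comp_idx[of _ "\<lambda>a. \<bar>\<alpha> (rect _ a)\<bar>"] by (intro sum.cong) auto
      then show ?thesis unfolding sum_dyadic_rectangles
        by (simp add: sum_distrib_left power_int_minus divide_inverse mult.commute)
    qed
    ultimately have "2 powi (- int n) * (\<Sum>R\<in>dyadic_rectangles n. \<bar>\<alpha> R\<bar>) \<le> ?K * C" by linarith
    then show ?thesis unfolding l_def[symmetric] C by simp
  qed
qed

end

theorem theorem1p1p7:
  shows "\<exists>\<epsilon>>0. \<exists>K::real. \<forall>n\<ge>1. \<forall>\<alpha> :: (real ^ 3) set \<Rightarrow> real.
    ereal (2 powi (- int n) * (\<Sum>R\<in>dyadic_rectangles n. \<bar>\<alpha> R\<bar>))
      \<le> ereal (K * real n powr (1 - \<epsilon>))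
          * Linf_norm (\<lambda>x. \<Sum>R\<in>dyadic_rectangles n. \<alpha> R * haar_rect R x)"
proof (intro exI conjI allI impI)
  show "(0::real) < 1 / 2400" by simp
qed (rule cube.small_ball)

end
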